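(* (Rate with noiseless compressed communication and noisy gradients.) Consider the TiCoPD recursion defined in the context. Assume: (i) for any fixed $\mathbf X\in\mathbb R^{nd}$ there exist $\delta\in(0,1]$, $r>0$ and $\sigma_\xi\ge0$ such that $Q(\mathbf X;\xi_q)=\widehat Q(\mathbf X;\bar\xi_q)+\mathbf W$, where $\mathbb E[\mathbf W]=0$, $\mathbb E\|\mathbf W\|^2\le\sigma_\xi^2$, and $\mathbb E_{\bar\xi_q}\|\mathbf X-\widehat Q(\mathbf X;\bar\xi_q)/r\|^2\le(1-\delta)^2\|\mathbf X\|^2$; and the communication is noiseless, $\sigma_\xi=0$; (ii) each $f_i$ is $L$-smooth, i.e. $\|\nabla f_i(x)-\nabla f_i(y)\|\le L\|x-y\|$ for all $x,y\in\mathbb R^d$, and there is $f^\star>-\infty$ with $f_i(x)\ge f^\star$ for all $x$ and $i$; (iii) for every $i$ and every fixed $y\in\mathbb R^d$ there is $\sigma_i\ge0$ with $\mathbb E\|\nabla f_i(y;\xi_i)-\nabla f_i(y)\|^2\le\sigma_i^2$, and $\xi_1,\dots,\xi_n$ are mutually independent; and $\bar\sigma^2=\frac1n\sum_{i=1}^n\sigma_i^2>0$; (iv) there are $\rho_{\max}\ge\rho_{\min}>0$ and $\tilde\rho_{\max}\ge\tilde\rho_{\min}>0$ with $\rho_{\min}\mathbf K\preceq\bar{\mathbf A}^\top\mathbf R\bar{\mathbf A}\preceq\rho_{\max}\mathbf K$ and $\tilde\rho_{\min}\mathbf K\preceq\bar{\mathbf A}^\top\bar{\mathbf A}\preceq\tilde\rho_{\max}\mathbf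 K$; (v) $\mathbb E\|\bar{\mathbf A}^\top\bar{\mathbf A}(\xi_a)\mathbf X-\bar{\mathbf A}^\top\mathbf R\bar{\mathbf A}\mathbf X\|^2\le\sigma_A^2\|\bar{\mathbf A}\mathbf X\|_{\mathbf R}^2$ for any fixed $\mathbf X\in\mathbb R^{nd}$. Fix the number of iterations $T\gg1$, let $\mathsf R$ be drawn uniformly and independently from $\{0,1,\dots,T-1\}$, and let the parameters obey the step-size conditions stated in the context, which involve a free quantity $\mathtt a>0$. By selecting $\alpha=\mathcal O(\sqrt{n/(\bar\sigma^2T)})$, $\theta=\mathcal O(\sqrt T)$, $\gamma=1$, $\mathtt a=\mathcal O(1/\sqrt T)$, it follows that $$\mathbb E\|\nabla f(\bar{\mathbf x}^{\mathsf R})\|^2=\mathcal O\Big(\sqrt{\bar\sigma^2/(nT)}\Big),$$ and, with $\mathtt a=1$, $$\mathbb E\|\mathbf X^{\mathsf R}\|_{\mathbf K}^2=\mathcal O(1/T).$$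
   Context: **Graph.** $G=(V,E)$ is an undirected connected graph on $V=\{1,\dots,n\}$ with (signed) incidence matrix $\mathbf A\in\mathbb R^{|E|\times n}$; $\bar{\mathbf A}=\mathbf A\otimes\mathbf I_d$. A random variable $\xi_a$ gives a random diagonal matrix $\mathbf I(\xi_a)\in\{0,1\}^{|E|\times|E|}$ selecting the active edges, and $\mathbf R=\mathbb E[\mathbf I(\xi_a)]\succ c_0\mathbf I$ for some $c_0>0$. Notation: $\bar{\mathbf A}^\top\bar{\mathbf A}(\xi_a)=(\mathbf A^\top\mathbf I(\xi_a)\mathbf A)\otimes\mathbf I_d$, $\bar{\mathbf A}^\top\mathbf R\bar{\mathbf A}=(\mathbf A^\top\mathbf R\mathbf A)\otimes\mathbf I_d$, $\|\bar{\mathbf A}\mathbf X\|_{\mathbf R}^2=\mathbf X^\top\bar{\mathbf A}^\top\mathbf R\bar{\mathbf A}\mathbf X$. **Norms.** For positive semidefinite $\mathbf M$, $\|\mathbf a\|_{\mathbf M}^2=\mathbf a^\top\mathbf M\mathbf a$. $\mathbf K=(\mathbf I_n-\mathbf 1\mathbf 1^\top/n)\otimes\mathbf I_d$. **Objective.** $f_i(x)=\mathbb E_{\xi_i\sim\mathbb P_i}[f_i(x;\xi_i)]$ and $f=\frac1n\sum_{i=1}^n f_i$ on $\mathbb R^d$, each $f_i$ continuously differentiable; $\nabla f_i(x;\xi_i)$ is the stochastic gradient and $\nabla f_i(x)$ the expected gradient. For $\mathbf X=[\mathbf x_1;\dots;\mathbf x_n]\in\mathbb R^{nd}$, $\nabla\mathbf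 f(\mathbf X;\xi)\in\mathbb R^{nd}$ stacks the $\nabla f_i(\mathbf x_i;\xi_i)$. $\bar{\mathbf x}^t=\frac1n\sum_i\mathbf x_i^t$. **TiCoPD.** With step sizes and parameters $\alpha,\theta,\eta,\gamma>0$ and a random map $Q(\cdot;\xi_q)$ on $\mathbb R^{nd}$ (compression operator), for $t\ge0$ a fresh sample $\xi^{t+1}=(\xi_1^{t+1},\dots,\xi_n^{t+1},\xi_a^{t+1})$ and fresh compressor randomness $\xi_q^{t+1}$ are drawn, and $$\mathbf X^{t+1}=\mathbf X^t-\alpha\big(\nabla\mathbf f(\mathbf X^t;\xi^{t+1})+\widetilde{\boldsymbol\lambda}^t+\theta\,\bar{\mathbf A}^\top\bar{\mathbf A}(\xi_a^{t+1})\hat{\mathbf X}^t\big),$$ $$\widetilde{\boldsymbol\lambda}^{t+1}=\widetilde{\boldsymbol\lambda}^t+\eta\,\bar{\mathbf A}^\top\bar{\mathbf A}(\xi_a^{t+1})\hat{\mathbf X}^t,\qquad \hat{\mathbf X}^{t+1}=\hat{\mathbf X}^t+\gamma\,Q(\mathbf X^{t+1}-\hat{\mathbf X}^t;\xi_q^{t+1}).$$ Here $\widetilde{\boldsymbol\lambda}^t=\bar{\mathbf A}^\top\boldsymbol\lambda^t$ for a dual variable $\boldsymbol\lambda^t\in\mathbb R^{|E|d}$. **Step-size conditions.** For a free quantity $\mathtt a>0$ (which may be related to $T$): $\gamma\le\frac1r$, $\eta=\frac{r\gamma\delta}{8\tilde\rho_{\max}}$, $$\theta\ge\frac{4}{\rho_{\min}}\max\Big\{\frac{2L^2}{n\mathtt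 a},\frac{2048\tilde\rho_{\max}}{r\gamma\delta\rho_{\min}},L^2\Big\},$$ $$\alpha\le\frac{r\gamma\delta}{256\,\theta}\min\Big\{\frac{\rho_{\min}^2}{\rho_{\max}^2\tilde\rho_{\max}},\frac{\rho_{\min}^2}{\sigma_A^2\rho_{\max}\tilde\rho_{\max}},\frac{1}{72n\mathtt a\tilde\rho_{\max}},\frac{\rho_{\min}}{2\tilde\rho_{\max}\mathtt a}\Big\}.$$ *)

theory Defs
  imports "HOL-Probability.Probability" "HOL-Library.Landau_Symbols"
begin

section \<open>Stacked vectors, Kronecker products and weighted norms\<close>

text \<open>
  Agents are the numbers \<open>1..n\<close>.  A point \<open>X = [x_1; ...; x_n]\<close> of \<open>R^{nd}\<close> is a function
  \<open>nat \<Rightarrow> 'a\<close> with \<open>'a\<close> a Euclidean space (of dimension \<open>d\<close>), taken to be \<open>undefined\<close> outside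
  \<open>1..n\<close>.  The number of agents is deliberately not a type, because the constant in the final rate
  must not depend on it.
\<close>

abbreviation agents :: "nat \<Rightarrow> nat set" where
  "agents n \<equiv> {1..n}"

definition stacked :: "nat \<Rightarrow> (nat \<Rightarrow> 'a) set" where
  "stacked n = PiE (agents n) (\<lambda>_. UNIV)"

definition stacked_borel :: "nat \<Rightarrow> (nat \<Rightarrow> 'a::euclidean_space) measure" where
  "stacked_borel n = PiM (agents n) (\<lambda>_. borel)"

definition sq_norm :: "nat \<Rightarrow> (nat \<Rightarrow> 'a::euclidean_space) \<Rightarrow> real" where
  "sq_norm n X = (\<Sum>i\<in>agents n. (norm (X i))\<^sup>2)"

text \<open>\<open>kron_id I J B X\<close> is \<open>(B \<otimes> I_d) X\<close> for a real matrix \<open>B\<close> with row set \<open>I\<close> and column set \<open>J\<close>.\<close>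

definition kron_id ::
  "'i set \<Rightarrow> 'j set \<Rightarrow> ('i \<Rightarrow> 'j \<Rightarrow> real) \<Rightarrow> ('j \<Rightarrow> 'a::euclidean_space) \<Rightarrow> 'i \<Rightarrow> 'a" where
  "kron_id I J B X = (\<lambda>i\<in>I. \<Sum>j\<in>J. B i j *\<^sub>R X j)"

text \<open>\<open>qform n B X\<close> is \<open>X\<^sup>T (B \<otimes> I_d) X\<close>, i.e. the squared (semi)norm of \<open>X\<close> weighted by \<open>B \<otimes> I_d\<close>.\<close>

definition qform :: "nat \<Rightarrow> (nat \<Rightarrow> nat \<Rightarrow> real) \<Rightarrow> (nat \<Rightarrow> 'a::euclidean_space) \<Rightarrow> real" where
  "qform n B X = (\<Sum>i\<in>agents n. X i \<bullet> kron_id (agents n) (agents n) B X i)"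

text \<open>Loewner order of \<open>B \<otimes> I_d\<close> and \<open>C \<otimes> I_d\<close>; the \<open>itself\<close> argument supplies \<open>R^d\<close>.\<close>

definition loewner_le ::
  "'a::euclidean_space itself \<Rightarrow> nat \<Rightarrow> (nat \<Rightarrow> nat \<Rightarrow> real) \<Rightarrow> (nat \<Rightarrow> nat \<Rightarrow> real) \<Rightarrow> bool" where
  "loewner_le TYPE('a) n B C \<longleftrightarrow> (\<forall>X\<in>(stacked n :: (nat \<Rightarrow> 'a) set). qform n B X \<le> qform n C X)"

definition mat_scale :: "real \<Rightarrow> (nat \<Rightarrow> nat \<Rightarrow> real) \<Rightarrow> nat \<Rightarrow> nat \<Rightarrow> real" where
  "mat_scale c B = (\<lambda>i j. c * B i j)"

definition centering :: "nat \<Rightarrow> nat \<Rightarrow> nat \<Rightarrow> real" where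
  "centering n i j = (if i = j then 1 else 0) - 1 / real n"

definition agent_mean :: "nat \<Rightarrow> (nat \<Rightarrow> 'a::euclidean_space) \<Rightarrow> 'a" where
  "agent_mean n X = (1 / real n) *\<^sub>R (\<Sum>i\<in>agents n. X i)"

definition gradient :: "('a::euclidean_space \<Rightarrow> real) \<Rightarrow> 'a \<Rightarrow> 'a" where
  "gradient h x = (THE D. GDERIV h x :> D)"

text \<open>The integrability part prevents the Bochner integral from silently defaulting to 0.\<close>

definition expect_le :: "'w measure \<Rightarrow> ('w \<Rightarrow> real) \<Rightarrow> real \<Rightarrow> bool" where
  "expect_le M Z b \<longleftrightarrow> integrable M Z \<and> (LINT w|M. Z w) \<le> b"

text \<open>Independence of two random variables; the library's \<open>indep_var\<close> forces equal value types.\<close>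

definition indep_rv ::
  "'w measure \<Rightarrow> 'b measure \<Rightarrow> ('w \<Rightarrow> 'b) \<Rightarrow> 'c measure \<Rightarrow> ('w \<Rightarrow> 'c) \<Rightarrow> bool" where
  "indep_rv M S X N Y \<longleftrightarrow> X \<in> M \<rightarrow>\<^sub>M S \<and> Y \<in> M \<rightarrow>\<^sub>M N \<and>
     prob_space.indep_set M {X -` A \<inter> space M |A. A \<in> sets S} {Y -` B \<inter> space M |B. B \<in> sets N}"


section \<open>Problem instances\<close>

text \<open>
  Edges are two-element sets of agents; \<open>e_tail\<close> and \<open>e_head\<close> fix an arbitrary orientation, which
  gives the signs in the incidence matrix.  \<open>active z e\<close> is the diagonal entry of \<open>I(z)\<close> at \<open>e\<close>.
  \<open>loss i x s\<close> is \<open>f_i(x; s)\<close> and \<open>data_law i\<close> is the law of \<open>\<xi>_i\<close>.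
  \<open>data_rv t i\<close>, \<open>graph_rv t\<close>, \<open>comp_rv t\<close> are the samples drawn in iteration \<open>t\<close>, which the update
  rule denotes with the superscript \<open>t+1\<close>.  \<open>index_rv T\<close> is the random output index for horizon \<open>T\<close>.
\<close>

record ('a, 's, 'z, 'q, 'w) instance_data =
  num_agents :: nat
  edges :: "nat set set"
  e_tail :: "nat set \<Rightarrow> nat"
  e_head :: "nat set \<Rightarrow> nat"
  active :: "'z \<Rightarrow> nat set \<Rightarrow> bool"
  loss :: "nat \<Rightarrow> 'a \<Rightarrow> 's \<Rightarrow> real"
  compress :: "(nat \<Rightarrow> 'a) \<Rightarrow> 'q \<Rightarrow> nat \<Rightarrow> 'a"
  data_law :: "nat \<Rightarrow> 's measure"
  graph_law :: "'z measure"
  comp_law :: "'q measure"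
  prob :: "'w measure"
  data_rv :: "nat \<Rightarrow> nat \<Rightarrow> 'w \<Rightarrow> 's"
  graph_rv :: "nat \<Rightarrow> 'w \<Rightarrow> 'z"
  comp_rv :: "nat \<Rightarrow> 'w \<Rightarrow> 'q"
  index_rv :: "nat \<Rightarrow> 'w \<Rightarrow> nat"
  x_init :: "nat \<Rightarrow> 'a"
  xhat_init :: "nat \<Rightarrow> 'a"
  dual_init :: "nat set \<Rightarrow> 'a"

type_synonym ('a, 's, 'z, 'q, 'w) inst = "('a, 's, 'z, 'q, 'w) instance_data"


subsection \<open>Graph\<close>

definition incidence :: "('a, 's, 'z, 'q, 'w) inst \<Rightarrow> nat set \<Rightarrow> nat \<Rightarrow> real" where
  "incidence p e i = (if i = e_tail p e then 1 else if i = e_head p e then -1 else 0)"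

text \<open>\<open>gram p w\<close> is \<open>A\<^sup>T D A\<close> with \<open>D\<close> the diagonal matrix with entries \<open>w e\<close>.\<close>

definition gram :: "('a, 's, 'z, 'q, 'w) inst \<Rightarrow> (nat set \<Rightarrow> real) \<Rightarrow> nat \<Rightarrow> nat \<Rightarrow> real" where
  "gram p w i j = (\<Sum>e\<in>edges p. incidence p e i * w e * incidence p e j)"

definition active_diag :: "('a, 's, 'z, 'q, 'w) inst \<Rightarrow> 'z \<Rightarrow> nat set \<Rightarrow> real" where
  "active_diag p z e = of_bool (active p z e)"

definition mean_diag :: "('a, 's, 'z, 'q, 'w) inst \<Rightarrow> nat set \<Rightarrow> real" where
  "mean_diag p e = (LINT z|graph_law p. active_diag p z e)"

definition graph_setup :: "('a, 's, 'z, 'q, 'w) inst \<Rightarrow> bool" where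
  "graph_setup p \<longleftrightarrow>
     num_agents p \<ge> 1 \<and>
     (\<forall>e\<in>edges p. e \<subseteq> agents (num_agents p) \<and> e_tail p e \<noteq> e_head p e
        \<and> e = {e_tail p e, e_head p e}) \<and>
     (\<forall>u\<in>agents (num_agents p). \<forall>v\<in>agents (num_agents p).
        (u, v) \<in> {(a, b). {a, b} \<in> edges p}\<^sup>*) \<and>
     (\<forall>e\<in>edges p. Measurable.pred (graph_law p) (\<lambda>z. active p z e)) \<and>
     (\<exists>c0>0. \<forall>e\<in>edges p. mean_diag p e > c0)"


subsection \<open>Objective\<close>

definition local_obj :: "('a, 's, 'z, 'q, 'w) inst \<Rightarrow> nat \<Rightarrow> 'a \<Rightarrow> real" where
  "local_obj p i x = (LINT s|data_law p i. loss p i x s)"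

definition objective :: "('a, 's, 'z, 'q, 'w) inst \<Rightarrow> 'a \<Rightarrow> real" where
  "objective p x = (1 / real (num_agents p)) * (\<Sum>i\<in>agents (num_agents p). local_obj p i x)"

definition stoch_grad :: "('a::euclidean_space, 's, 'z, 'q, 'w) inst \<Rightarrow> nat \<Rightarrow> 'a \<Rightarrow> 's \<Rightarrow> 'a" where
  "stoch_grad p i x s = gradient (\<lambda>y. loss p i y s) x"

definition objective_setup :: "('a::euclidean_space, 's, 'z, 'q, 'w) inst \<Rightarrow> bool" where
  "objective_setup p \<longleftrightarrow> (\<forall>i\<in>agents (num_agents p).
     (\<forall>x. integrable (data_law p i) (loss p i x)) \<and>
     (\<forall>x. local_obj p i differentiable (at x)) \<and>
     continuous_on UNIV (gradient (local_obj p i)) \<and>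
     (\<forall>s\<in>space (data_law p i). \<forall>x. (\<lambda>y. loss p i y s) differentiable (at x)) \<and>
     (\<lambda>(x, s). stoch_grad p i x s) \<in> borel \<Otimes>\<^sub>M data_law p i \<rightarrow>\<^sub>M borel \<and>
     (\<forall>x. integrable (data_law p i) (stoch_grad p i x)
        \<and> (LINT s|data_law p i. stoch_grad p i x s) = gradient (local_obj p i) x))"


subsection \<open>Randomness\<close>

definition sample_space ::
    "('a, 's, 'z, 'q, 'w) inst \<Rightarrow> ((nat \<Rightarrow> 's) \<times> 'z) measure" where
  "sample_space p = PiM (agents (num_agents p)) (data_law p) \<Otimes>\<^sub>M graph_law p"

definition sample :: "('a, 's, 'z, 'q, 'w) inst \<Rightarrow> nat \<Rightarrow> 'w \<Rightarrow> (nat \<Rightarrow> 's) \<times> 'z" where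
  "sample p t w = ((\<lambda>i\<in>agents (num_agents p). data_rv p t i w), graph_rv p t w)"

text \<open>
  The samples and the compressor randomness of all iterations are mutually independent, and the
  output index is uniform and independent of all of them.  Nothing is assumed about the dependence
  between the graph sample and the data samples of the same iteration.
\<close>

definition randomness_setup :: "('a::euclidean_space, 's, 'z, 'q, 'w) inst \<Rightarrow> bool" where
  "randomness_setup p \<longleftrightarrow>
     prob_space (prob p) \<and>
     (\<forall>t. \<forall>i\<in>agents (num_agents p). data_rv p t i \<in> prob p \<rightarrow>\<^sub>M data_law p i
        \<and> distr (prob p) (data_law p i) (data_rv p t i) = data_law p i) \<and>
     (\<forall>t. graph_rv p t \<in> prob p \<rightarrow>\<^sub>M graph_law p
        \<and> distr (prob p) (graph_law p) (graph_rv p t) = graph_law p) \<and>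
     (\<forall>t. comp_rv p t \<in> prob p \<rightarrow>\<^sub>M comp_law p
        \<and> distr (prob p) (comp_law p) (comp_rv p t) = comp_law p) \<and>
     (\<forall>t. indep_rv (prob p) (sample_space p) (sample p t) (comp_law p) (comp_rv p t)) \<and>
     prob_space.indep_vars (prob p) (\<lambda>_. sample_space p \<Otimes>\<^sub>M comp_law p)
       (\<lambda>t w. (sample p t w, comp_rv p t w)) UNIV \<and>
     (\<forall>T\<ge>1. index_rv p T \<in> prob p \<rightarrow>\<^sub>M count_space UNIV
        \<and> distr (prob p) (count_space UNIV) (index_rv p T) = measure_pmf (pmf_of_set {..<T})
        \<and> indep_rv (prob p) (count_space UNIV) (index_rv p T)
            (PiM UNIV (\<lambda>_. sample_space p \<Otimes>\<^sub>M comp_law p))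
            (\<lambda>w t. (sample p t w, comp_rv p t w)))"

definition init_setup :: "('a::euclidean_space, 's, 'z, 'q, 'w) inst \<Rightarrow> bool" where
  "init_setup p \<longleftrightarrow> x_init p \<in> stacked (num_agents p) \<and> xhat_init p \<in> stacked (num_agents p)"


subsection \<open>The recursion\<close>

text \<open>The state is the triple of primal iterate, transformed dual variable and surrogate iterate.\<close>

primrec ticopd :: "('a::euclidean_space, 's, 'z, 'q, 'w) inst \<Rightarrow> real \<Rightarrow> real \<Rightarrow> real \<Rightarrow> real \<Rightarrow> 'w \<Rightarrow>
    nat \<Rightarrow> (nat \<Rightarrow> 'a) \<times> (nat \<Rightarrow> 'a) \<times> (nat \<Rightarrow> 'a)" where
  "ticopd p \<alpha> \<theta> \<eta> \<gamma> w 0 =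
     (x_init p,
      kron_id (agents (num_agents p)) (edges p) (\<lambda>i e. incidence p e i) (dual_init p),
      xhat_init p)"
| "ticopd p \<alpha> \<theta> \<eta> \<gamma> w (Suc t) =
     (let V = agents (num_agents p);
          (X, lam, Xh) = ticopd p \<alpha> \<theta> \<eta> \<gamma> w t;
          D = kron_id V V (gram p (active_diag p (graph_rv p t w))) Xh;
          X' = (\<lambda>i\<in>V. X i - \<alpha> *\<^sub>R (stoch_grad p i (X i) (data_rv p t i w) + lam i + \<theta> *\<^sub>R D i));
          lam' = (\<lambda>i\<in>V. lam i + \<eta> *\<^sub>R D i);
          q = compress p (\<lambda>i\<in>V. X' i - Xh i) (comp_rv p t w);
          Xh' = (\<lambda>i\<in>V. Xh i + \<gamma> *\<^sub>R q i)
      in (X', lam', Xh'))"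

definition primal :: "('a::euclidean_space, 's, 'z, 'q, 'w) inst \<Rightarrow> real \<Rightarrow> real \<Rightarrow> real \<Rightarrow> real \<Rightarrow> 'w \<Rightarrow>
    nat \<Rightarrow> nat \<Rightarrow> 'a" where
  "primal p \<alpha> \<theta> \<eta> \<gamma> w t = fst (ticopd p \<alpha> \<theta> \<eta> \<gamma> w t)"


section \<open>Assumptions\<close>

text \<open>
  \<open>\<xi>_q\<close> comprises the internal randomness of \<open>Qh\<close> and the channel noise, so both \<open>Qh\<close> and \<open>W\<close>
  are functions of it.
\<close>

definition compressor_assm ::
    "('a::euclidean_space, 's, 'z, 'q, 'w) inst \<Rightarrow> real \<Rightarrow> real \<Rightarrow> real \<Rightarrow> bool" where
  "compressor_assm p \<delta> r \<sigma>\<xi> \<longleftrightarrow>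
     0 < \<delta> \<and> \<delta> \<le> 1 \<and> 0 < r \<and> 0 \<le> \<sigma>\<xi> \<and>
     (\<lambda>(X, s). compress p X s) \<in>
       stacked_borel (num_agents p) \<Otimes>\<^sub>M comp_law p \<rightarrow>\<^sub>M stacked_borel (num_agents p) \<and>
     (\<exists>Qh W. \<forall>X\<in>stacked (num_agents p).
        (\<forall>s\<in>space (comp_law p). \<forall>i\<in>agents (num_agents p). compress p X s i = Qh X s i + W X s i) \<and>
        (\<forall>i\<in>agents (num_agents p). integrable (comp_law p) (\<lambda>s. W X s i)
           \<and> (LINT s|comp_law p. W X s i) = 0) \<and>
        expect_le (comp_law p) (\<lambda>s. sq_norm (num_agents p) (W X s)) (\<sigma>\<xi>\<^sup>2) \<and>
        expect_le (comp_law p) (\<lambda>s. sq_norm (num_agents p) (\<lambda>i. X i - (1 / r) *\<^sub>R Qh X s i))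
          ((1 - \<delta>)\<^sup>2 * sq_norm (num_agents p) X))"

definition smoothness_assm ::
    "('a::euclidean_space, 's, 'z, 'q, 'w) inst \<Rightarrow> real \<Rightarrow> real \<Rightarrow> bool" where
  "smoothness_assm p L fstar \<longleftrightarrow>
     (\<forall>i\<in>agents (num_agents p). \<forall>x y.
        norm (gradient (local_obj p i) x - gradient (local_obj p i) y) \<le> L * norm (x - y)) \<and>
     (\<forall>i\<in>agents (num_agents p). \<forall>x. fstar \<le> local_obj p i x)"

definition mean_variance :: "nat \<Rightarrow> (nat \<Rightarrow> real) \<Rightarrow> real" where
  "mean_variance n \<sigma> = (1 / real n) * (\<Sum>i\<in>agents n. (\<sigma> i)\<^sup>2)"

definition gradient_noise_assm ::
    "('a::euclidean_space, 's, 'z, 'q, 'w) inst \<Rightarrow> (nat \<Rightarrow> real) \<Rightarrow> bool" where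
  "gradient_noise_assm p \<sigma> \<longleftrightarrow>
     (\<forall>i\<in>agents (num_agents p). 0 \<le> \<sigma> i \<and>
        (\<forall>y. expect_le (data_law p i)
           (\<lambda>s. (norm (stoch_grad p i y s - gradient (local_obj p i) y))\<^sup>2) ((\<sigma> i)\<^sup>2))) \<and>
     (\<forall>t. prob_space.indep_vars (prob p) (data_law p) (data_rv p t) (agents (num_agents p))) \<and>
     mean_variance (num_agents p) \<sigma> > 0"

definition spectral_assm ::
    "('a::euclidean_space, 's, 'z, 'q, 'w) inst \<Rightarrow> real \<Rightarrow> real \<Rightarrow> real \<Rightarrow> real \<Rightarrow> bool" where
  "spectral_assm p \<rho>min \<rho>max \<rho>tmin \<rho>tmax \<longleftrightarrow>
     0 < \<rho>min \<and> \<rho>min \<le> \<rho>max \<and> 0 < \<rho>tmin \<and> \<rho>tmin \<le> \<rho>tmax \<and>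
     (let n = num_agents p; LR = gram p (mean_diag p); LA = gram p (\<lambda>_. 1) in
        loewner_le TYPE('a) n (mat_scale \<rho>min (centering n)) LR \<and>
        loewner_le TYPE('a) n LR (mat_scale \<rho>max (centering n)) \<and>
        loewner_le TYPE('a) n (mat_scale \<rho>tmin (centering n)) LA \<and>
        loewner_le TYPE('a) n LA (mat_scale \<rho>tmax (centering n)))"

definition graph_noise_assm ::
    "('a::euclidean_space, 's, 'z, 'q, 'w) inst \<Rightarrow> real \<Rightarrow> bool" where
  "graph_noise_assm p \<sigma>A \<longleftrightarrow>
     (let n = num_agents p; V = agents n in
      \<forall>X\<in>(stacked n :: (nat \<Rightarrow> 'a) set). expect_le (graph_law p)
        (\<lambda>z. sq_norm n (\<lambda>i. kron_id V V (gram p (active_diag p z)) X i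
                           - kron_id V V (gram p (mean_diag p)) X i))
        (\<sigma>A\<^sup>2 * qform n (gram p (mean_diag p)) X))"


section \<open>Step sizes\<close>

text \<open>
  For \<open>\<sigma>A = 0\<close> the second entry of the minimum in the bound on \<open>\<alpha>\<close> is infinite, i.e. void;
  in HOL the quotient would be 0, so that entry is guarded.
\<close>

definition step_size_conditions ::
    "nat \<Rightarrow> real \<Rightarrow> real \<Rightarrow> real \<Rightarrow> real \<Rightarrow> real \<Rightarrow> real \<Rightarrow> real \<Rightarrow>
     real \<Rightarrow> real \<Rightarrow> real \<Rightarrow> real \<Rightarrow> real \<Rightarrow> bool" where
  "step_size_conditions n L \<delta> r \<rho>min \<rho>max \<rho>tmax \<sigma>A a \<alpha> \<theta> \<eta> \<gamma> \<longleftrightarrow>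
     0 < a \<and> 0 < \<alpha> \<and> 0 < \<theta> \<and> 0 < \<eta> \<and> 0 < \<gamma> \<and>
     \<gamma> \<le> 1 / r \<and>
     \<eta> = r * \<gamma> * \<delta> / (8 * \<rho>tmax) \<and>
     \<theta> \<ge> 4 / \<rho>min * Max {2 * L\<^sup>2 / (real n * a), 2048 * \<rho>tmax / (r * \<gamma> * \<delta> * \<rho>min), L\<^sup>2} \<and>
     \<alpha> \<le> r * \<gamma> * \<delta> / (256 * \<theta>) *
       Min ({\<rho>min\<^sup>2 / (\<rho>max\<^sup>2 * \<rho>tmax), 1 / (72 * real n * a * \<rho>tmax), \<rho>min / (2 * \<rho>tmax * a)}
            \<union> (if \<sigma>A = 0 then {} else {\<rho>min\<^sup>2 / (\<sigma>A\<^sup>2 * \<rho>max * \<rho>tmax)}))"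

text \<open>
  The order of \<open>\<alpha>\<close> must be two-sided: a step size that is too small cannot give the rate.
  The constants \<open>c1\<close>, \<open>c2\<close> are explicit because the constant in the rate depends on them.
\<close>

definition alpha_order :: "real \<Rightarrow> real \<Rightarrow> nat \<Rightarrow> real \<Rightarrow> (nat \<Rightarrow> real) \<Rightarrow> bool" where
  "alpha_order c1 c2 n s2 \<alpha> \<longleftrightarrow>
     (\<forall>\<^sub>F T in sequentially.
        c1 * sqrt (real n / (s2 * real T)) \<le> \<alpha> T \<and> \<alpha> T \<le> c2 * sqrt (real n / (s2 * real T)))"

end

theory Submission
  imports Defs
begin

text \<open>
  Write \<open>X\<close>, \<open>lam\<close>, \<open>Xh\<close> for the primal, dual and surrogate iterates, \<open>g\<close> for
  the stacked gradient samples, \<open>D\<close> for the sampled Laplacian applied to \<open>Xh\<close>, and put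
  \<open>\<beta> = \<alpha> \<theta>\<close>, \<open>\<kappa> = \<eta> / \<beta>\<close>, \<open>\<epsilon> = \<eta> / \<theta>\<close>.  For \<open>L > 0\<close>, \<open>\<alpha>\<close> and \<open>\<epsilon>\<close> are of order
  \<open>1 / sqrt T\<close>, while \<open>\<beta>\<close> and \<open>\<kappa>\<close> stay between positive constants: consensus is fast, the dual
  variable and the objective are slow.

  The dual variable is handled through the combination \<open>z = lam + \<kappa> (X - mean)\<close>.  The term \<open>D\<close>
  enters the primal update with \<open>- \<beta>\<close> and the dual update with \<open>\<eta> = \<kappa> \<beta>\<close>, so it cancels in \<open>z\<close>,
  and with it all graph sampling and compression noise: \<open>z\<close> is replaced by the convex combination
  \<open>(1 - \<epsilon>) z + \<epsilon> (\<kappa> (X - mean) - (g - mean of g))\<close> (\<open>corrected_dual_step\<close>).  On the fast time scale the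
  consensus error \<open>u\<close> contracts by a factor \<open>1 - O(\<beta> \<rho>min)\<close> because the mean Laplacian is positive on
  the disagreement space (\<open>consensus_step\<close>), the tracking error \<open>e = X - Xh\<close> contracts because the
  compressor does (\<open>tracking_step\<close>, \<open>tracking_compression\<close>), and the upper bound on \<open>\<alpha> \<theta>\<close> makes the
  coupling of the two weak enough for \<open>u + 4 e\<close> to be a Lyapunov function.  Both are driven only by
  \<open>\<alpha>\<^sup>2\<close> times the size of \<open>z\<close>, \<open>\<kappa> u\<close> and \<open>g\<close>.

  No bound on the gradients or on the heterogeneity of the agents is available.  Instead, smoothness
  and the lower bound \<open>fstar\<close> give \<open>|grad f_i|\<^sup>2 \<le> 2 L (f_i - fstar)\<close> (\<open>gradient_sq_le_gap\<close>), so that the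
  gradients are controlled by the optimality gap, and the gap itself stays bounded over \<open>T\<close> steps by
  the descent inequality (\<open>objective_step\<close>), since \<open>\<alpha>\<^sup>2 T\<close> is bounded.  Summing the recursions over
  \<open>t < T\<close> and absorbing the small multiples of the total consensus error shows that this total is
  bounded independently of \<open>T\<close> (\<open>consensus_sum_bound\<close>, \<open>consensus_sum_const\<close>).  Dividing by \<open>T\<close> is the
  second rate.  In the summed descent inequality the total contributes only \<open>O(1/T)\<close>, and the
  leading terms \<open>2 \<Delta> / (\<alpha> T)\<close> and \<open>L \<alpha> s2 / n\<close> give the first rate with the constant
  \<open>2 \<Delta> / c1 + L c2 + 1\<close>, whose last summand dominates the \<open>O(1/T)\<close> term for large \<open>T\<close>.  The factor \<open>1 / n\<close> in
  \<open>L \<alpha> s2 / n\<close> comes from the independence of the agents' samples (\<open>sgrad_mean_variance\<close>).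

  Conditional expectations are avoided: each estimate is proved for a fixed state and a fresh sample,
  and carried over to the random state by a Fubini argument (\<open>indep_rv_expect_le\<close>).
\<close>

section \<open>Expectations and independence\<close>

lemma expect_le_mono_AE:
  assumes "expect_le M Z' b" "Z \<in> borel_measurable M"
    and "\<And>w. w \<in> space M \<Longrightarrow> 0 \<le> Z w" "AE w in M. Z w \<le> Z' w"
  shows "expect_le M Z b"
proof -
  have int: "integrable M Z'" "(LINT w|M. Z' w) \<le> b" using assms(1) by (auto simp: expect_le_def)
  have "AE w in M. norm (Z w) \<le> norm (Z' w)"
    using assms(4) AE_space by eventually_elim (use assms(3) in force)
  then have "integrable M Z"
    by (rule Bochner_Integration.integrable_bound[OF int(1) assms(2)])
  moreover have "(LINT w|M. Z w) \<le> (LINT w|M. Z' w)"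
    using calculation int(1) assms(4) by (rule integral_mono_AE)
  ultimately show ?thesis using int(2) by (auto simp: expect_le_def)
qed

lemma expect_le_mono:
  assumes "expect_le M Z' b" "Z \<in> borel_measurable M"
    and "\<And>w. w \<in> space M \<Longrightarrow> 0 \<le> Z w" "\<And>w. w \<in> space M \<Longrightarrow> Z w \<le> Z' w"
  shows "expect_le M Z b"
  using assms by (intro expect_le_mono_AE[of M Z' b Z] AE_I2) auto

lemma expect_le_weaken: "expect_le M Z b \<Longrightarrow> b \<le> b' \<Longrightarrow> expect_le M Z b'"
  by (auto simp: expect_le_def)

lemma expect_le_add:
  "expect_le M Z b \<Longrightarrow> expect_le M Z' b' \<Longrightarrow> expect_le M (\<lambda>w. Z w + Z' w) (b + b')"
  by (auto simp: expect_le_def)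

lemma expect_le_cmult: "0 \<le> c \<Longrightarrow> expect_le M Z b \<Longrightarrow> expect_le M (\<lambda>w. c * Z w) (c * b)"
  by (auto simp: expect_le_def intro: mult_left_mono)

lemma expect_le_sum:
  "(\<And>i. i \<in> I \<Longrightarrow> expect_le M (Z i) (b i)) \<Longrightarrow> expect_le M (\<lambda>w. \<Sum>i\<in>I. Z i w) (\<Sum>i\<in>I. b i)"
  by (auto simp: expect_le_def intro!: sum_mono)

lemma (in prob_space) expect_le_const: "c \<le> b \<Longrightarrow> expect_le M (\<lambda>_. c) b"
  by (auto simp: expect_le_def prob_space)

lemma expect_le_distr:
  assumes "Y \<in> M \<rightarrow>\<^sub>M N" "f \<in> borel_measurable N"
  shows "expect_le (distr M N Y) f b \<longleftrightarrow> expect_le M (\<lambda>w. f (Y w)) b"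
  using assms by (simp add: expect_le_def integrable_distr_eq integral_distr)

text \<open>Independence on the two generating \<open>\<pi>\<close>-systems suffices, because a product measure is determined
  by its values on rectangles.\<close>

lemma indep_rv_distr_pair:
  assumes "prob_space M" "indep_rv M N1 S N2 Y"
  shows "distr M (N1 \<Otimes>\<^sub>M N2) (\<lambda>w. (S w, Y w)) = distr M N1 S \<Otimes>\<^sub>M distr M N2 Y"
proof -
  interpret prob_space M by fact
  have mS[measurable]: "S \<in> M \<rightarrow>\<^sub>M N1" and mY[measurable]: "Y \<in> M \<rightarrow>\<^sub>M N2"
    and ind: "indep_set {S -` A \<inter> space M |A. A \<in> sets N1} {Y -` B \<inter> space M |B. B \<in> sets N2}"
    using assms(2) by (auto simp: indep_rv_def)
  interpret D1: prob_space "distr M N1 S" by (rule prob_space_distr) fact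
  interpret D2: prob_space "distr M N2 Y" by (rule prob_space_distr) fact
  have "distr M N1 S \<Otimes>\<^sub>M distr M N2 Y = distr M (N1 \<Otimes>\<^sub>M N2) (\<lambda>w. (S w, Y w))"
  proof (rule pair_measure_eqI)
    show "sigma_finite_measure (distr M N1 S)" "sigma_finite_measure (distr M N2 Y)" by unfold_locales
    show "sets (distr M N1 S \<Otimes>\<^sub>M distr M N2 Y) = sets (distr M (N1 \<Otimes>\<^sub>M N2) (\<lambda>w. (S w, Y w)))"
      by (simp cong: sets_pair_measure_cong)
    fix A B assume "A \<in> sets (distr M N1 S)" "B \<in> sets (distr M N2 Y)"
    then have A[measurable]: "A \<in> sets N1" and B[measurable]: "B \<in> sets N2" by auto
    have eq: "(\<lambda>w. (S w, Y w)) -` (A \<times> B) \<inter> space M = (S -` A \<inter> space M) \<inter> (Y -` B \<inter> space M)" by auto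
    have "prob ((S -` A \<inter> space M) \<inter> (Y -` B \<inter> space M))
        = prob (S -` A \<inter> space M) * prob (Y -` B \<inter> space M)"
      by (rule indep_setD[OF ind]) (use A B in auto)
    then show "emeasure (distr M N1 S) A * emeasure (distr M N2 Y) B
        = emeasure (distr M (N1 \<Otimes>\<^sub>M N2) (\<lambda>w. (S w, Y w))) (A \<times> B)"
      by (simp add: emeasure_distr eq emeasure_eq_measure ennreal_mult'')
  qed
  then show ?thesis by simp
qed

text \<open>
  The substitute for conditioning on the past: a bound that holds when the first argument is frozen
  at any of its values integrates to a bound for the random pair.  Since \<open>h\<close> is nonnegative, Tonelli's
  theorem applies and integrability of the composition is part of the result.
  The bound \<open>b\<close> is a function on the probability space rather than of the value of \<open>S\<close>, so it needs to
  hold for attained values of \<open>S\<close> only.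
\<close>

lemma indep_rv_expect_le:
  fixes h :: "'b \<times> 'c \<Rightarrow> real"
  assumes "prob_space M" and ind: "indep_rv M N1 S N2 Y"
    and h[measurable]: "h \<in> borel_measurable (N1 \<Otimes>\<^sub>M N2)" and h0: "\<And>x. 0 \<le> h x"
    and le: "\<And>w. w \<in> space M \<Longrightarrow> expect_le M (\<lambda>w'. h (S w, Y w')) (b w)"
    and b: "integrable M b"
  shows "expect_le M (\<lambda>w. h (S w, Y w)) (LINT w|M. b w)"
proof -
  interpret prob_space M by fact
  have mS[measurable]: "S \<in> M \<rightarrow>\<^sub>M N1" and mY[measurable]: "Y \<in> M \<rightarrow>\<^sub>M N2"
    using ind by (auto simp: indep_rv_def)
  interpret D2: prob_space "distr M N2 Y" by (rule prob_space_distr) fact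
  have b0: "0 \<le> b w" if "w \<in> space M" for w
  proof -
    have "0 \<le> (LINT w'|M. h (S w, Y w'))" by (rule Bochner_Integration.integral_nonneg) (rule h0)
    then show ?thesis using le[OF that] by (auto simp: expect_le_def)
  qed
  have "(\<integral>\<^sup>+w. h (S w, Y w) \<partial>M) = (\<integral>\<^sup>+x. h x \<partial>distr M (N1 \<Otimes>\<^sub>M N2) (\<lambda>w. (S w, Y w)))"
    by (simp add: nn_integral_distr)
  also have "\<dots> = (\<integral>\<^sup>+x. h x \<partial>(distr M N1 S \<Otimes>\<^sub>M distr M N2 Y))"
    by (simp add: indep_rv_distr_pair[OF assms(1) ind])
  also have "\<dots> = (\<integral>\<^sup>+s. \<integral>\<^sup>+y. h (s, y) \<partial>distr M N2 Y \<partial>distr M N1 S)"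
    by (rule D2.nn_integral_fst[symmetric]) (simp cong: measurable_cong_sets sets_pair_measure_cong)
  also have "\<dots> = (\<integral>\<^sup>+w. \<integral>\<^sup>+y. h (S w, y) \<partial>distr M N2 Y \<partial>M)"
    by (subst nn_integral_distr) (auto simp: measurable_distr_eq1 intro!: D2.borel_measurable_nn_integral_fst[where f="\<lambda>x. ennreal (h x)", simplified] cong: measurable_cong_sets sets_pair_measure_cong)
  also have "\<dots> = (\<integral>\<^sup>+w. \<integral>\<^sup>+w'. h (S w, Y w') \<partial>M \<partial>M)"
    by (rule nn_integral_cong) (subst nn_integral_distr, auto intro: measurable_Pair2 simp: measurable_space[OF mS])
  also have "\<dots> \<le> (\<integral>\<^sup>+w. ennreal (b w) \<partial>M)"
  proof (rule nn_integral_mono)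
    fix w assume "w \<in> space M"
    from le[OF this] have "integrable M (\<lambda>w'. h (S w, Y w'))" "(LINT w'|M. h (S w, Y w')) \<le> b w"
      by (auto simp: expect_le_def)
    then show "(\<integral>\<^sup>+w'. h (S w, Y w') \<partial>M) \<le> ennreal (b w)"
      by (subst nn_integral_eq_integral) (auto simp: h0 ennreal_leI)
  qed
  also have "\<dots> = ennreal (LINT w|M. b w)"
    by (rule nn_integral_eq_integral[OF b]) (auto intro: b0 AE_I2)
  finally have *: "(\<integral>\<^sup>+w. h (S w, Y w) \<partial>M) \<le> ennreal (LINT w|M. b w)" .
  have "integrable M (\<lambda>w. h (S w, Y w))"
    by (rule integrableI_bounded) (use * h0 in \<open>auto intro: le_less_trans\<close>)
  moreover from this * have "(LINT w|M. h (S w, Y w)) \<le> (LINT w|M. b w)"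
    by (subst (asm) nn_integral_eq_integral)
       (simp_all add: h0 ennreal_le_iff Bochner_Integration.integral_nonneg b0)
  ultimately show ?thesis by (simp add: expect_le_def)
qed

text \<open>Variances of independent centred vectors add up, since the mixed inner products have mean zero.
  After averaging over the agents this is what produces the factor \<open>1 / n\<close> in the rate.\<close>

lemma (in prob_space) indep_vars_sum_sq_norm:
  fixes Z :: "'i \<Rightarrow> 'a \<Rightarrow> 'b::euclidean_space"
  assumes fin: "finite I" and ind: "indep_vars (\<lambda>_. borel) Z I"
    and mean: "\<And>i. i \<in> I \<Longrightarrow> integrable M (Z i)" "\<And>i. i \<in> I \<Longrightarrow> expectation (Z i) = 0"
    and var: "\<And>i. i \<in> I \<Longrightarrow> expect_le M (\<lambda>w. (norm (Z i w))\<^sup>2) (v i)"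
  shows "expect_le M (\<lambda>w. (norm (\<Sum>i\<in>I. Z i w))\<^sup>2) (\<Sum>i\<in>I. v i)"
proof -
  have cross: "integrable M (\<lambda>w. Z i w \<bullet> Z j w) \<and> expectation (\<lambda>w. Z i w \<bullet> Z j w) = 0"
    if ij: "i \<in> I" "j \<in> I" "i \<noteq> j" for i j
  proof -
    have one: "integrable M (\<lambda>w. (Z i w \<bullet> b) * (Z j w \<bullet> b)) \<and> expectation (\<lambda>w. (Z i w \<bullet> b) * (Z j w \<bullet> b)) = 0" for b
    proof -
      have iv: "indep_vars (\<lambda>_. borel) (\<lambda>k w. Z k w \<bullet> b) {i, j}"
        by (rule indep_vars_compose2[OF indep_vars_subset[OF ind]]) (use ij in auto)
      have int: "integrable M (\<lambda>w. Z k w \<bullet> b)" if "k \<in> {i,j}" for k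
        using mean(1)[of k] that ij by auto
      have "integrable M (\<lambda>w. \<Prod>k\<in>{i,j}. Z k w \<bullet> b)"
        by (rule indep_vars_integrable[OF _ iv int]) auto
      moreover have "expectation (\<lambda>w. \<Prod>k\<in>{i,j}. Z k w \<bullet> b) = (\<Prod>k\<in>{i,j}. expectation (\<lambda>w. Z k w \<bullet> b))"
        by (rule indep_vars_lebesgue_integral[OF _ iv int]) auto
      moreover have "expectation (\<lambda>w. Z i w \<bullet> b) = 0"
        using mean[of i] ij by simp
      ultimately show ?thesis using ij by simp
    qed
    have eq: "(\<lambda>w. Z i w \<bullet> Z j w) = (\<lambda>w. \<Sum>b\<in>Basis. (Z i w \<bullet> b) * (Z j w \<bullet> b))"
      by (rule ext) (rule euclidean_inner)
    show ?thesis unfolding eq using one by simp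
  qed
  have sq: "integrable M (\<lambda>w. Z i w \<bullet> Z i w) \<and> expectation (\<lambda>w. Z i w \<bullet> Z i w) \<le> v i" if "i \<in> I" for i
    using var[OF that] by (simp add: expect_le_def dot_square_norm)
  have int: "integrable M (\<lambda>w. Z i w \<bullet> Z j w)" if "i \<in> I" "j \<in> I" for i j
    using cross[OF that] sq[of i] that by (cases "i = j") auto
  have eq: "(\<lambda>w. (norm (\<Sum>i\<in>I. Z i w))\<^sup>2) = (\<lambda>w. \<Sum>i\<in>I. \<Sum>j\<in>I. Z i w \<bullet> Z j w)"
    by (simp add: power2_norm_eq_inner inner_sum_left inner_sum_right)
       (subst sum.swap, rule refl)
  have "expectation (\<lambda>w. \<Sum>i\<in>I. \<Sum>j\<in>I. Z i w \<bullet> Z j w)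
      = (\<Sum>i\<in>I. \<Sum>j\<in>I. expectation (\<lambda>w. Z i w \<bullet> Z j w))"
    by (subst Bochner_Integration.integral_sum)
       (auto intro!: int sum.cong Bochner_Integration.integral_sum)
  also have "\<dots> = (\<Sum>i\<in>I. \<Sum>j\<in>I. if i = j then expectation (\<lambda>w. Z i w \<bullet> Z i w) else 0)"
    using cross by (intro sum.cong) auto
  also have "\<dots> = (\<Sum>i\<in>I. expectation (\<lambda>w. Z i w \<bullet> Z i w))"
    using fin by (simp add: sum.delta)
  also have "\<dots> \<le> (\<Sum>i\<in>I. v i)" using sq by (intro sum_mono) auto
  finally show ?thesis unfolding eq expect_le_def by (auto intro!: int)
qed

section \<open>Smooth functions\<close>

lemma gderiv_unique:
  assumes "GDERIV f x :> D" "GDERIV f x :> D'" shows "D = D'"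
proof -
  have "(\<lambda>h. h \<bullet> D) = (\<lambda>h. h \<bullet> D')"
    using has_derivative_unique assms unfolding gderiv_def by blast
  then show ?thesis by (metis inner_commute vector_eq_ldot)
qed

lemma gradient_eq: "GDERIV f x :> D \<Longrightarrow> gradient f x = D"
  unfolding gradient_def using gderiv_unique by blast

lemma gderiv_gradient:
  assumes "f differentiable (at x)" shows "GDERIV f x :> gradient f x"
proof -
  obtain f' where f': "(f has_derivative f') (at x)" using assms by (auto simp: differentiable_def)
  then interpret f': bounded_linear f' by (rule has_derivative_bounded_linear)
  have "f' h = h \<bullet> (\<Sum>b\<in>Basis. f' b *\<^sub>R b)" for h
  proof -
    have "f' h = f' (\<Sum>b\<in>Basis. (h \<bullet> b) *\<^sub>R b)" by (simp add: euclidean_representation)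
    also have "\<dots> = (\<Sum>b\<in>Basis. (h \<bullet> b) * f' b)" by (simp add: f'.sum f'.scaleR)
    finally show ?thesis by (simp add: inner_sum_right mult.commute)
  qed
  then have "f' = (\<lambda>h. h \<bullet> (\<Sum>b\<in>Basis. f' b *\<^sub>R b))" by (rule ext)
  with f' have "GDERIV f x :> (\<Sum>b\<in>Basis. f' b *\<^sub>R b)" unfolding gderiv_def by metis
  then show ?thesis using gradient_eq by metis
qed

text \<open>Along the segment from \<open>x\<close> to \<open>x + d\<close> the difference between \<open>f\<close> and its quadratic upper model has
  a nonpositive derivative.\<close>

lemma descent_lemma:
  fixes f :: "'a::euclidean_space \<Rightarrow> real"
  assumes g: "\<And>x. GDERIV f x :> g x" and lip: "\<And>x y. norm (g x - g y) \<le> L * norm (x - y)"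
  shows "f (x + d) \<le> f x + g x \<bullet> d + L / 2 * (norm d)\<^sup>2"
proof -
  define \<phi> where "\<phi> s = f (x + s *\<^sub>R d) - s * (g x \<bullet> d) - L / 2 * s\<^sup>2 * (norm d)\<^sup>2" for s :: real
  have der: "(\<phi> has_real_derivative (g (x + s *\<^sub>R d) \<bullet> d - g x \<bullet> d - L * s * (norm d)\<^sup>2)) (at s)" for s
  proof -
    have 1: "((\<lambda>s. x + s *\<^sub>R d) has_derivative (\<lambda>h. h *\<^sub>R d)) (at s)"
      by (auto intro!: derivative_eq_intros)
    have "((\<lambda>s. f (x + s *\<^sub>R d)) has_derivative (\<lambda>h. (h *\<^sub>R d) \<bullet> g (x + s *\<^sub>R d))) (at s)"
      using has_derivative_compose[OF 1] g[of "x + s *\<^sub>R d"] unfolding gderiv_def by blast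
    then have "((\<lambda>s. f (x + s *\<^sub>R d)) has_real_derivative (g (x + s *\<^sub>R d) \<bullet> d)) (at s)"
      unfolding has_field_derivative_def by (simp add: inner_commute mult.commute[of _ "_ \<bullet> _"])
    then show ?thesis unfolding \<phi>_def
      by (auto intro!: derivative_eq_intros simp: power2_eq_square)
  qed
  have "\<phi> 1 \<le> \<phi> 0"
  proof (rule DERIV_nonpos_imp_nonincreasing[where f = \<phi> and a = 0 and b = 1])
    fix s :: real assume s: "0 \<le> s" "s \<le> 1"
    have "(g (x + s *\<^sub>R d) - g x) \<bullet> d \<le> norm (g (x + s *\<^sub>R d) - g x) * norm d"
      by (rule norm_cauchy_schwarz)
    also have "\<dots> \<le> (L * norm (x + s *\<^sub>R d - x)) * norm d"
      by (rule mult_right_mono[OF lip]) simp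
    also have "\<dots> = L * s * (norm d)\<^sup>2" using s by (simp add: power2_eq_square)
    finally show "\<exists>y. (\<phi> has_real_derivative y) (at s) \<and> y \<le> 0"
      using der[of s] by (auto simp: inner_diff_left intro!: exI)
  qed simp
  then show ?thesis by (simp add: \<phi>_def inner_commute)
qed

text \<open>
  A gradient step of length \<open>s\<close> lowers \<open>f\<close> by at least \<open>(s - L s\<^sup>2 / 2) |g|\<^sup>2\<close>, which cannot exceed the
  gap to a lower bound; the best choice is \<open>s = 1 / L\<close>.  For \<open>L = 0\<close> arbitrarily long steps are allowed and
  the gradient has to vanish.  This replaces an assumption of bounded gradients.
\<close>

lemma gradient_sq_le_gap:
  fixes f :: "'a::euclidean_space \<Rightarrow> real"
  assumes g: "\<And>x. GDERIV f x :> g x" and lip: "\<And>x y. norm (g x - g y) \<le> L * norm (x - y)"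
    and low: "\<And>x. m \<le> f x" and L: "0 \<le> L"
  shows "(norm (g x))\<^sup>2 \<le> 2 * L * (f x - m)"
proof -
  have step: "(s - L / 2 * s\<^sup>2) * (norm (g x))\<^sup>2 \<le> f x - m" for s
  proof -
    have "m \<le> f (x + (- s) *\<^sub>R g x)" by (rule low)
    also have "\<dots> \<le> f x + g x \<bullet> ((- s) *\<^sub>R g x) + L / 2 * (norm ((- s) *\<^sub>R g x))\<^sup>2"
      by (rule descent_lemma[OF g lip])
    also have "\<dots> = f x - (s - L / 2 * s\<^sup>2) * (norm (g x))\<^sup>2"
      by (simp add: power_mult_distrib dot_square_norm algebra_simps)
    finally show ?thesis by simp
  qed
  show ?thesis
  proof (cases "L = 0")
    case True
    have "norm (g x) = 0"
    proof (rule ccontr)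
      assume "norm (g x) \<noteq> 0"
      then have "0 < (norm (g x))\<^sup>2" by simp
      with step[of "(f x - m + 1) / (norm (g x))\<^sup>2"] True show False by simp
    qed
    then show ?thesis using True by simp
  next
    case False
    with L have "0 < L" by simp
    with step[of "1 / L"] show ?thesis
      by (simp add: field_simps power2_eq_square)
  qed
qed

declare One_nat_def [simp del]

section \<open>Stacked vectors\<close>

text \<open>The projection \<open>K\<close> applied to \<open>X\<close>, without restriction to the agents.\<close>

definition deviation :: "nat \<Rightarrow> (nat \<Rightarrow> 'a::euclidean_space) \<Rightarrow> nat \<Rightarrow> 'a" where
  "deviation n X = (\<lambda>i. X i - agent_mean n X)"

lemma sq_norm_nonneg [simp]: "0 \<le> sq_norm n X"
  by (auto simp: sq_norm_def intro: sum_nonneg)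

lemma sq_norm_cong: "(\<And>i. i \<in> agents n \<Longrightarrow> X i = Y i) \<Longrightarrow> sq_norm n X = sq_norm n Y"
  by (auto simp: sq_norm_def)

lemma sq_norm_scale: "sq_norm n (\<lambda>i. c *\<^sub>R X i) = c\<^sup>2 * sq_norm n X"
  by (simp add: sq_norm_def power_mult_distrib sum_distrib_left)

lemma young_inner:
  fixes x y :: "'a::real_inner"
  assumes "0 < s"
  shows "2 * (x \<bullet> y) \<le> s * (x \<bullet> x) + (1 / s) * (y \<bullet> y)"
proof -
  have "0 \<le> (norm (sqrt s *\<^sub>R x - (1 / sqrt s) *\<^sub>R y))\<^sup>2" by simp
  also have "\<dots> = s * (x \<bullet> x) + (1 / s) * (y \<bullet> y) - 2 * (x \<bullet> y)"
    using assms by (simp add: power2_norm_eq_inner inner_diff_left inner_diff_right inner_commute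
        real_sqrt_mult_self algebra_simps)
  finally show ?thesis by simp
qed

lemma norm_add_sq_le:
  fixes x y :: "'a::real_inner"
  assumes "0 < s"
  shows "(norm (x + y))\<^sup>2 \<le> (1 + s) * (norm x)\<^sup>2 + (1 + 1 / s) * (norm y)\<^sup>2"
  using young_inner[OF assms, of x y] unfolding power2_norm_eq_inner
  by (simp add: inner_add_left inner_add_right inner_commute distrib_right)

lemma sq_norm_add_le:
  assumes "0 < s"
  shows "sq_norm n (\<lambda>i. X i + Y i) \<le> (1 + s) * sq_norm n X + (1 + 1 / s) * sq_norm n Y"
proof -
  have "sq_norm n (\<lambda>i. X i + Y i)
      \<le> (\<Sum>i\<in>agents n. (1 + s) * (norm (X i))\<^sup>2 + (1 + 1 / s) * (norm (Y i))\<^sup>2)"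
    unfolding sq_norm_def by (intro sum_mono norm_add_sq_le assms)
  also have "\<dots> = (1 + s) * sq_norm n X + (1 + 1 / s) * sq_norm n Y"
    by (simp add: sq_norm_def sum.distrib sum_distrib_left)
  finally show ?thesis .
qed

lemma sq_norm_add2_le: "sq_norm n (\<lambda>i. X i + Y i) \<le> 2 * sq_norm n X + 2 * sq_norm n Y"
  using sq_norm_add_le[of 1 n X Y] by simp

lemma sq_norm_diff2_le: "sq_norm n (\<lambda>i. X i - Y i) \<le> 2 * sq_norm n X + 2 * sq_norm n Y"
  using sq_norm_add2_le[of n X "\<lambda>i. - Y i"] by (simp add: sq_norm_def)

lemma sq_norm_add3_le:
  "sq_norm n (\<lambda>i. X i + Y i + Z i) \<le> 3 * sq_norm n X + 3 * sq_norm n Y + 3 * sq_norm n Z"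
  using sq_norm_add_le[of 2 n X "\<lambda>i. Y i + Z i"] sq_norm_add2_le[of n Y Z]
  by (simp add: add.assoc)

lemma sq_norm_convex:
  assumes "0 \<le> c" "c \<le> 1"
  shows "sq_norm n (\<lambda>i. (1 - c) *\<^sub>R X i + c *\<^sub>R Y i) \<le> (1 - c) * sq_norm n X + c * sq_norm n Y"
proof -
  have "(norm ((1 - c) *\<^sub>R x + c *\<^sub>R y))\<^sup>2 \<le> (1 - c) * (norm x)\<^sup>2 + c * (norm y)\<^sup>2" for x y :: 'a
  proof -
    have "(1 - c) * (norm x)\<^sup>2 + c * (norm y)\<^sup>2 - (norm ((1 - c) *\<^sub>R x + c *\<^sub>R y))\<^sup>2
        = c * (1 - c) * (norm (x - y))\<^sup>2"
      unfolding power2_norm_eq_inner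
      by (simp add: inner_diff_left inner_diff_right inner_add_left inner_add_right
          inner_commute algebra_simps)
    moreover have "0 \<le> c * (1 - c) * (norm (x - y))\<^sup>2" using assms by simp
    ultimately show ?thesis by linarith
  qed
  then have "sq_norm n (\<lambda>i. (1 - c) *\<^sub>R X i + c *\<^sub>R Y i)
      \<le> (\<Sum>i\<in>agents n. (1 - c) * (norm (X i))\<^sup>2 + c * (norm (Y i))\<^sup>2)"
    unfolding sq_norm_def by (intro sum_mono)
  then show ?thesis by (simp add: sq_norm_def sum.distrib sum_distrib_left)
qed

lemma agent_mean_add: "agent_mean n (\<lambda>i. X i + Y i) = agent_mean n X + agent_mean n Y"
  and agent_mean_diff: "agent_mean n (\<lambda>i. X i - Y i) = agent_mean n X - agent_mean n Y"
  and agent_mean_scale: "agent_mean n (\<lambda>i. c *\<^sub>R X i) = c *\<^sub>R agent_mean n X"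
  by (simp_all add: agent_mean_def sum.distrib sum_subtractf scaleR_sum_right scaleR_add_right scaleR_diff_right mult.commute)

lemma agent_mean_cong: "(\<And>i. i \<in> agents n \<Longrightarrow> X i = Y i) \<Longrightarrow> agent_mean n X = agent_mean n Y"
  by (auto simp: agent_mean_def)

lemma deviation_add: "deviation n (\<lambda>i. X i + Y i) = (\<lambda>i. deviation n X i + deviation n Y i)"
  and deviation_diff: "deviation n (\<lambda>i. X i - Y i) = (\<lambda>i. deviation n X i - deviation n Y i)"
  and deviation_scale: "deviation n (\<lambda>i. c *\<^sub>R X i) = (\<lambda>i. c *\<^sub>R deviation n X i)"
  by (simp_all add: deviation_def agent_mean_add agent_mean_diff agent_mean_scale scaleR_diff_right fun_eq_iff)

lemma deviation_cong:
  assumes "\<And>i. i \<in> agents n \<Longrightarrow> X i = Y i" "i \<in> agents n"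
  shows "deviation n X i = deviation n Y i"
  using assms agent_mean_cong[of n X Y] by (simp add: deviation_def)

lemma sum_deviation: "(\<Sum>i\<in>agents n. deviation n X i) = 0"
  by (cases "n = 0") (simp_all add: deviation_def agent_mean_def sum_subtractf scaleR_sum_right[symmetric] sum_constant_scaleR)

lemma sum_inner_deviation: "(\<Sum>i\<in>agents n. c \<bullet> deviation n X i) = 0"
  by (simp add: inner_sum_right[symmetric] sum_deviation)

lemma sq_norm_decompose:
  "sq_norm n X = sq_norm n (deviation n X) + real n * (norm (agent_mean n X))\<^sup>2"
proof -
  have "(norm (X i))\<^sup>2 = (norm (deviation n X i))\<^sup>2 + 2 * (agent_mean n X \<bullet> deviation n X i)
      + (norm (agent_mean n X))\<^sup>2" for i
    by (simp add: deviation_def power2_norm_eq_inner inner_diff_left inner_diff_right inner_commute)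
  then show ?thesis
    by (simp add: sq_norm_def sum.distrib sum_distrib_left[symmetric] sum_inner_deviation)
qed

lemma sq_norm_deviation_le: "sq_norm n (deviation n X) \<le> sq_norm n X"
  using sq_norm_decompose[of n X] by simp

lemma agent_mean_sq_le: "real n * (norm (agent_mean n X))\<^sup>2 \<le> sq_norm n X"
  using sq_norm_decompose[of n X] by simp

text \<open>\<open>K\<close> is an orthogonal projection, so its quadratic form is the squared norm of the projected vector.\<close>

lemma qform_centering: "qform n (centering n) X = sq_norm n (deviation n X)"
proof -
  have "kron_id (agents n) (agents n) (centering n) X i = deviation n X i" if "i \<in> agents n" for i
    using that by (simp add: kron_id_def centering_def deviation_def agent_mean_def scaleR_diff_left
        sum_subtractf scaleR_sum_right if_distrib[of "\<lambda>c. c *\<^sub>R _"] sum.delta cong: if_cong)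
  then have "qform n (centering n) X = (\<Sum>i\<in>agents n. X i \<bullet> deviation n X i)"
    by (simp add: qform_def)
  also have "\<dots> = (\<Sum>i\<in>agents n. (norm (deviation n X i))\<^sup>2 + agent_mean n X \<bullet> deviation n X i)"
    by (intro sum.cong refl) (simp add: deviation_def power2_norm_eq_inner inner_diff_left)
  also have "\<dots> = sq_norm n (deviation n X)"
    by (simp add: sum.distrib sum_inner_deviation sq_norm_def)
  finally show ?thesis .
qed

lemma sq_norm_single_agent: "n \<le> 1 \<Longrightarrow> sq_norm n (deviation n X) = 0"
  by (cases "n = 0"; cases "n = 1") (auto simp: sq_norm_def deviation_def agent_mean_def)

section \<open>Graph Laplacians\<close>

definition edge_diff :: "('a::euclidean_space, 's, 'z, 'q, 'w) inst \<Rightarrow> (nat \<Rightarrow> 'a) \<Rightarrow> nat set \<Rightarrow> 'a" where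
  "edge_diff p X e = X (e_tail p e) - X (e_head p e)"

definition laplacian ::
    "('a::euclidean_space, 's, 'z, 'q, 'w) inst \<Rightarrow> (nat set \<Rightarrow> real) \<Rightarrow> (nat \<Rightarrow> 'a) \<Rightarrow> nat \<Rightarrow> 'a" where
  "laplacian p w = kron_id (agents (num_agents p)) (agents (num_agents p)) (gram p w)"

text \<open>The bilinear form \<open>X\<^sup>T (A\<^sup>T diag w A \<otimes> I_d) Y\<close>, written edge by edge.\<close>

definition dirichlet ::
    "('a::euclidean_space, 's, 'z, 'q, 'w) inst \<Rightarrow> (nat set \<Rightarrow> real) \<Rightarrow> (nat \<Rightarrow> 'a) \<Rightarrow> (nat \<Rightarrow> 'a) \<Rightarrow> real" where
  "dirichlet p w X Y = (\<Sum>e\<in>edges p. w e * (edge_diff p X e \<bullet> edge_diff p Y e))"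

lemma edge_diff_deviation: "edge_diff p (deviation n X) = edge_diff p X"
  by (simp add: edge_diff_def deviation_def fun_eq_iff)

lemma edge_diff_diff: "edge_diff p (\<lambda>i. X i - Y i) e = edge_diff p X e - edge_diff p Y e"
  by (simp add: edge_diff_def)

lemma dirichlet_deviation: "dirichlet p w (deviation n X) Y = dirichlet p w X Y"
  "dirichlet p w X (deviation n Y) = dirichlet p w X Y"
  by (simp_all add: dirichlet_def edge_diff_deviation)

lemma dirichlet_diff: "dirichlet p w X (\<lambda>i. Y i - Z i) = dirichlet p w X Y - dirichlet p w X Z"
  by (simp add: dirichlet_def edge_diff_diff inner_diff_right right_diff_distrib sum_subtractf)

text \<open>Young's inequality in the semi-inner product given by nonnegative edge weights.\<close>

lemma dirichlet_young:
  assumes "0 < s" "\<And>e. e \<in> edges p \<Longrightarrow> 0 \<le> w e"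
  shows "2 * dirichlet p w X Y \<le> s * dirichlet p w X X + (1 / s) * dirichlet p w Y Y"
proof -
  have "w e * (2 * (edge_diff p X e \<bullet> edge_diff p Y e)) \<le>
      w e * (s * (edge_diff p X e \<bullet> edge_diff p X e) + (1 / s) * (edge_diff p Y e \<bullet> edge_diff p Y e))"
    if "e \<in> edges p" for e
    by (intro mult_left_mono young_inner assms that)
  then have "(\<Sum>e\<in>edges p. w e * (2 * (edge_diff p X e \<bullet> edge_diff p Y e))) \<le>
      (\<Sum>e\<in>edges p. w e * (s * (edge_diff p X e \<bullet> edge_diff p X e) + (1 / s) * (edge_diff p Y e \<bullet> edge_diff p Y e)))"
    by (rule sum_mono)
  then show ?thesis
    by (simp add: dirichlet_def sum_distrib_left sum.distrib algebra_simps)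
qed

locale agent_graph =
  fixes p :: "('a::euclidean_space, 's, 'z, 'q, 'w) inst"
  assumes graph: "graph_setup p"
begin

abbreviation "n \<equiv> num_agents p"
abbreviation "V \<equiv> agents n"

lemma n_pos: "1 \<le> n" using graph by (simp add: graph_setup_def)

lemma edge_ends: assumes "e \<in> edges p"
  shows "e_tail p e \<in> V" "e_head p e \<in> V" "e_tail p e \<noteq> e_head p e"
proof -
  have "e \<subseteq> V" "e_tail p e \<noteq> e_head p e" "e = {e_tail p e, e_head p e}"
    using graph assms by (auto simp: graph_setup_def)
  then show "e_tail p e \<in> V" "e_head p e \<in> V" "e_tail p e \<noteq> e_head p e" by blast+
qed

lemma incidence_sum:
  assumes "e \<in> edges p"
  shows "(\<Sum>i\<in>V. incidence p e i *\<^sub>R X i) = edge_diff p X e"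
proof -
  have "(\<Sum>i\<in>V. incidence p e i *\<^sub>R X i)
      = (\<Sum>i\<in>V. (if i = e_tail p e then X i else 0) - (if i = e_head p e then X i else 0))"
    using edge_ends(3)[OF assms] by (intro sum.cong) (auto simp: incidence_def)
  then show ?thesis using edge_ends[OF assms] by (simp add: sum_subtractf sum.delta' edge_diff_def)
qed

lemma incidence_sum_zero:
  assumes "e \<in> edges p"
  shows "(\<Sum>i\<in>V. incidence p e i) = 0"
proof -
  obtain b :: 'a where b: "b \<in> Basis" using nonempty_Basis by blast
  have "(\<Sum>i\<in>V. incidence p e i) *\<^sub>R b = 0"
    using incidence_sum[OF assms, of "\<lambda>_. b"] by (simp add: edge_diff_def scaleR_sum_left)
  then show ?thesis using b by auto
qed

lemma laplacian_eq:
  assumes "i \<in> V"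
  shows "laplacian p w X i = (\<Sum>e\<in>edges p. (incidence p e i * w e) *\<^sub>R edge_diff p X e)"
proof -
  have "laplacian p w X i = (\<Sum>j\<in>V. \<Sum>e\<in>edges p. (incidence p e i * w e) *\<^sub>R incidence p e j *\<^sub>R X j)"
    using assms by (simp add: laplacian_def kron_id_def gram_def scaleR_sum_left)
  also have "\<dots> = (\<Sum>e\<in>edges p. (incidence p e i * w e) *\<^sub>R (\<Sum>j\<in>V. incidence p e j *\<^sub>R X j))"
    by (subst sum.swap) (simp only: scaleR_sum_right)
  finally show ?thesis by (simp add: incidence_sum)
qed

lemma inner_laplacian: "(\<Sum>i\<in>V. X i \<bullet> laplacian p w Y i) = dirichlet p w X Y"
proof -
  have "(\<Sum>i\<in>V. X i \<bullet> laplacian p w Y i)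
      = (\<Sum>i\<in>V. \<Sum>e\<in>edges p. w e * ((incidence p e i *\<^sub>R X i) \<bullet> edge_diff p Y e))"
    by (intro sum.cong refl) (simp add: laplacian_eq inner_sum_right algebra_simps)
  also have "\<dots> = (\<Sum>e\<in>edges p. w e * ((\<Sum>i\<in>V. incidence p e i *\<^sub>R X i) \<bullet> edge_diff p Y e))"
    by (subst sum.swap) (simp add: inner_sum_left sum_distrib_left)
  finally show ?thesis by (simp add: incidence_sum dirichlet_def)
qed

lemma qform_gram: "qform n (gram p w) X = dirichlet p w X X"
  using inner_laplacian[of X w X] by (simp add: qform_def laplacian_def)

lemma sum_laplacian: "(\<Sum>i\<in>V. laplacian p w X i) = 0"
proof -
  have "(\<Sum>i\<in>V. laplacian p w X i)
      = (\<Sum>e\<in>edges p. ((\<Sum>i\<in>V. incidence p e i) * w e) *\<^sub>R edge_diff p X e)"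
    by (simp add: laplacian_eq scaleR_sum_left sum_distrib_right) (rule sum.swap)
  then show ?thesis by (simp add: incidence_sum_zero)
qed

end

locale spectral_graph = agent_graph p
  for p :: "('a::euclidean_space, 's, 'z, 'q, 'w) inst" +
  fixes \<rho>min \<rho>max \<rho>tmin \<rho>tmax :: real
  assumes spectral: "spectral_assm p \<rho>min \<rho>max \<rho>tmin \<rho>tmax"
    and prob_graph: "prob_space (graph_law p)"
begin

lemma rho_pos: "0 < \<rho>min" "\<rho>min \<le> \<rho>max" "0 < \<rho>max" "0 < \<rho>tmax"
  using spectral by (auto simp: spectral_assm_def)

lemma mean_diag_nonneg: "0 \<le> mean_diag p e"
  by (auto simp: mean_diag_def active_diag_def intro!: Bochner_Integration.integral_nonneg)

lemma mean_diag_le_1: "mean_diag p e \<le> 1"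
proof -
  interpret prob_space "graph_law p" by (rule prob_graph)
  have "mean_diag p e \<le> (LINT z|graph_law p. (1::real))"
    unfolding mean_diag_def active_diag_def
    by (rule integral_mono') auto
  then show ?thesis by (simp add: prob_space)
qed

lemma loewner_scale_centering:
  fixes X :: "nat \<Rightarrow> 'a"
  shows "loewner_le TYPE('a) n (mat_scale c (centering n)) (gram p w)
      \<Longrightarrow> c * sq_norm n (deviation n X) \<le> dirichlet p w X X"
    and "loewner_le TYPE('a) n (gram p w) (mat_scale c (centering n))
      \<Longrightarrow> dirichlet p w X X \<le> c * sq_norm n (deviation n X)"
proof -
  let ?Y = "restrict X V"
  have Y: "?Y \<in> stacked n" by (auto simp: stacked_def)
  have 1: "qform n (mat_scale c (centering n)) ?Y = c * sq_norm n (deviation n X)"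
  proof -
    have "qform n (mat_scale c (centering n)) ?Y = c * qform n (centering n) X"
      by (simp add: qform_def kron_id_def mat_scale_def sum_distrib_left inner_sum_right mult.assoc)
    then show ?thesis by (simp add: qform_centering)
  qed
  have 2: "qform n (gram p w) ?Y = dirichlet p w X X"
    using edge_ends by (simp add: qform_gram dirichlet_def edge_diff_def)
  show "loewner_le TYPE('a) n (mat_scale c (centering n)) (gram p w)
      \<Longrightarrow> c * sq_norm n (deviation n X) \<le> dirichlet p w X X"
    "loewner_le TYPE('a) n (gram p w) (mat_scale c (centering n))
      \<Longrightarrow> dirichlet p w X X \<le> c * sq_norm n (deviation n X)"
    using Y unfolding loewner_le_def 1[symmetric] 2[symmetric] by auto
qed

lemma dirichlet_mean_ge: "\<rho>min * sq_norm n (deviation n X) \<le> dirichlet p (mean_diag p) X X"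
  and dirichlet_mean_le: "dirichlet p (mean_diag p) X X \<le> \<rho>max * sq_norm n (deviation n X)"
  and dirichlet_full_le: "dirichlet p (\<lambda>_. 1) X X \<le> \<rho>tmax * sq_norm n (deviation n X)"
  using spectral loewner_scale_centering unfolding spectral_assm_def Let_def by blast+

text \<open>
  Edge activation probabilities are at most one, so the mean Laplacian is dominated by the full one.
  The constants can be compared only if some vector is not in consensus, hence two agents are needed:
  for a single agent all Loewner bounds are vacuous.
\<close>

lemma rho_min_le_rho_tmax: assumes "2 \<le> n" shows "\<rho>min \<le> \<rho>tmax"
proof -
  obtain b :: 'a where b: "b \<in> Basis" using nonempty_Basis by blast
  define X :: "nat \<Rightarrow> 'a" where "X i = (if i = 1 then b else 0)" for i
  have "sq_norm n (deviation n X) \<noteq> 0"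
  proof
    assume "sq_norm n (deviation n X) = 0"
    then have "\<forall>i\<in>V. deviation n X i = 0" by (auto simp: sq_norm_def sum_nonneg_eq_0_iff)
    then have "deviation n X 1 = deviation n X 2" using assms by simp
    then show False using b by (simp add: deviation_def X_def)
  qed
  then have pos: "0 < sq_norm n (deviation n X)" by (simp add: less_le)
  have "\<rho>min * sq_norm n (deviation n X) \<le> dirichlet p (mean_diag p) X X" by (rule dirichlet_mean_ge)
  also have "\<dots> \<le> dirichlet p (\<lambda>_. 1) X X"
    unfolding dirichlet_def by (intro sum_mono mult_right_mono mean_diag_le_1) simp
  also have "\<dots> \<le> \<rho>tmax * sq_norm n (deviation n X)" by (rule dirichlet_full_le)
  finally show ?thesis using pos by simp
qed

text \<open>For the mean Laplacian \<open>L_R\<close>, the bound \<open>L_R\<^sup>2 \<le> \<rho>max\<^sup>2 K\<close> follows from \<open>L_R \<le> \<rho>max K\<close> without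
  diagonalising: pair \<open>L_R Y\<close> with \<open>Y\<close> in the
  Dirichlet form and use Young's inequality with the weight \<open>1 / \<rho>max\<close>.\<close>

lemma laplacian_mean_sq_le: "sq_norm n (laplacian p (mean_diag p) Y) \<le> \<rho>max\<^sup>2 * sq_norm n (deviation n Y)"
proof -
  let ?W = "laplacian p (mean_diag p) Y"
  have "2 * sq_norm n ?W = 2 * dirichlet p (mean_diag p) ?W Y"
    by (simp add: sq_norm_def power2_norm_eq_inner inner_laplacian)
  also have "\<dots> \<le> (1 / \<rho>max) * dirichlet p (mean_diag p) ?W ?W + (1 / (1 / \<rho>max)) * dirichlet p (mean_diag p) Y Y"
    by (rule dirichlet_young) (use rho_pos mean_diag_nonneg in auto)
  also have "\<dots> \<le> (1 / \<rho>max) * (\<rho>max * sq_norm n (deviation n ?W)) + (1 / (1 / \<rho>max)) * (\<rho>max * sq_norm n (deviation n Y))"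
    using rho_pos by (intro add_mono mult_left_mono dirichlet_mean_le) auto
  also have "\<dots> \<le> sq_norm n ?W + \<rho>max\<^sup>2 * sq_norm n (deviation n Y)"
    using rho_pos sq_norm_deviation_le[of n ?W] by (simp add: power2_eq_square)
  finally show ?thesis by simp
qed

end

section \<open>The random quantities of one iteration\<close>

locale ticopd_setting =
  fixes p :: "('a::euclidean_space, 's, 'z, 'q, 'w) inst"
    and L fstar \<delta> r :: real and \<sigma> :: "nat \<Rightarrow> real" and \<rho>min \<rho>max \<rho>tmin \<rho>tmax \<sigma>A :: real
  assumes graph_setup: "graph_setup p"
    and objective_setup: "objective_setup p"
    and randomness: "randomness_setup p"
    and init: "init_setup p"
    and compressor: "compressor_assm p \<delta> r 0"
    and smoothness: "smoothness_assm p L fstar"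
    and gradient_noise: "gradient_noise_assm p \<sigma>"
    and spectral_bounds: "spectral_assm p \<rho>min \<rho>max \<rho>tmin \<rho>tmax"
    and graph_noise: "graph_noise_assm p \<sigma>A"
begin

abbreviation "M \<equiv> prob p"
abbreviation "disagreement X \<equiv> sq_norm (num_agents p) (deviation (num_agents p) X)"

sublocale M: prob_space "prob p"
  using randomness by (simp add: randomness_setup_def)

lemma data_rv [measurable]: "i \<in> agents (num_agents p) \<Longrightarrow> data_rv p t i \<in> M \<rightarrow>\<^sub>M data_law p i"
  and distr_data_rv: "i \<in> agents (num_agents p) \<Longrightarrow> distr M (data_law p i) (data_rv p t i) = data_law p i"
  and graph_rv [measurable]: "graph_rv p t \<in> M \<rightarrow>\<^sub>M graph_law p"
  and distr_graph_rv: "distr M (graph_law p) (graph_rv p t) = graph_law p"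
  and comp_rv [measurable]: "comp_rv p t \<in> M \<rightarrow>\<^sub>M comp_law p"
  and distr_comp_rv: "distr M (comp_law p) (comp_rv p t) = comp_law p"
  and indep_sample_comp: "indep_rv M (sample_space p) (sample p t) (comp_law p) (comp_rv p t)"
  using randomness by (auto simp: randomness_setup_def)

sublocale spectral_graph p \<rho>min \<rho>max \<rho>tmin \<rho>tmax
proof (intro spectral_graph.intro agent_graph.intro spectral_graph_axioms.intro)
  show "graph_setup p" by (rule graph_setup)
  show "spectral_assm p \<rho>min \<rho>max \<rho>tmin \<rho>tmax" by (rule spectral_bounds)
  show "prob_space (graph_law p)"
    using M.prob_space_distr[OF graph_rv, of undefined] by (simp add: distr_graph_rv)
qed

lemma delta_r: "0 < \<delta>" "\<delta> \<le> 1" "0 < r"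
  using compressor by (auto simp: compressor_assm_def)

abbreviation "grad i \<equiv> gradient (local_obj p i)"
abbreviation "s2 \<equiv> mean_variance n \<sigma>"

definition gap :: "'a \<Rightarrow> real" where "gap x = objective p x - fstar"

lemma gderiv_local: "i \<in> V \<Longrightarrow> GDERIV (local_obj p i) x :> grad i x"
  using objective_setup by (intro gderiv_gradient) (auto simp: objective_setup_def)

lemma grad_lipschitz: "i \<in> V \<Longrightarrow> norm (grad i x - grad i y) \<le> L * norm (x - y)"
  and fstar_le: "i \<in> V \<Longrightarrow> fstar \<le> local_obj p i x"
  using smoothness by (auto simp: smoothness_assm_def)

lemma one_agent: "1 \<in> V" using n_pos by simp

lemma L_nonneg: "0 \<le> L"
proof -
  obtain b :: 'a where b: "b \<in> Basis" using nonempty_Basis by blast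
  have "0 \<le> norm (grad 1 b - grad 1 0)" by simp
  also have "\<dots> \<le> L * norm (b - 0)" by (rule grad_lipschitz[OF one_agent])
  finally show ?thesis using b by simp
qed

lemma gap_eq: "gap x = (1 / real n) * (\<Sum>i\<in>V. local_obj p i x - fstar)"
  using n_pos by (simp add: gap_def objective_def sum_subtractf right_diff_distrib)

lemma gap_nonneg: "0 \<le> gap x"
  unfolding gap_eq by (intro mult_nonneg_nonneg sum_nonneg) (simp_all only: diff_ge_0_iff_ge fstar_le, simp)

lemma gderiv_objective: "GDERIV (objective p) x :> agent_mean n (\<lambda>i. grad i x)"
proof -
  have "((\<lambda>x. (1 / real n) * (\<Sum>i\<in>V. local_obj p i x)) has_derivative
      (\<lambda>h. (1 / real n) * (\<Sum>i\<in>V. h \<bullet> grad i x))) (at x)"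
    using gderiv_local unfolding gderiv_def
    by (intro has_derivative_mult_right has_derivative_sum) auto
  moreover have "objective p = (\<lambda>x. (1 / real n) * (\<Sum>i\<in>V. local_obj p i x))"
    by (simp add: objective_def fun_eq_iff)
  ultimately show ?thesis
    unfolding gderiv_def by (simp add: agent_mean_def inner_sum_right)
qed

lemma objective_continuous: "continuous_on UNIV (objective p)"
  using gderiv_objective unfolding gderiv_def
  by (intro has_derivative_continuous_on[where f' = "\<lambda>x h. h \<bullet> agent_mean n (\<lambda>i. grad i x)"]) auto

lemma gradient_objective: "gradient (objective p) x = agent_mean n (\<lambda>i. grad i x)"
  by (rule gradient_eq[OF gderiv_objective])

lemma agent_mean_grad_diff_sq:
  "(norm (agent_mean n (\<lambda>i. grad i x) - agent_mean n (\<lambda>i. grad i (X i))))\<^sup>2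
    \<le> L\<^sup>2 / n * (\<Sum>i\<in>V. (norm (x - X i))\<^sup>2)"
proof -
  have "real n * (norm (agent_mean n (\<lambda>i. grad i x - grad i (X i))))\<^sup>2
      \<le> sq_norm n (\<lambda>i. grad i x - grad i (X i))" by (rule agent_mean_sq_le)
  also have "\<dots> \<le> (\<Sum>i\<in>V. (L * norm (x - X i))\<^sup>2)"
    unfolding sq_norm_def by (intro sum_mono power_mono grad_lipschitz norm_ge_zero)
  finally show ?thesis using n_pos
    by (simp add: agent_mean_diff power_mult_distrib sum_distrib_left[symmetric] field_simps)
qed

lemma objective_lipschitz:
  "norm (gradient (objective p) x - gradient (objective p) y) \<le> L * norm (x - y)"
proof -
  have "(norm (gradient (objective p) x - gradient (objective p) y))\<^sup>2 \<le> (L * norm (x - y))\<^sup>2"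
    using agent_mean_grad_diff_sq[of x "\<lambda>_. y"] n_pos
    by (simp add: gradient_objective power_mult_distrib)
  then show ?thesis using L_nonneg by (intro power2_le_imp_le[OF _ mult_nonneg_nonneg]) auto
qed

lemma gradient_objective_sq_le: "(norm (gradient (objective p) x))\<^sup>2 \<le> 2 * L * gap x"
  unfolding gap_def
proof (rule gradient_sq_le_gap[where f = "objective p" and g = "gradient (objective p)"])
  show "GDERIV (objective p) y :> gradient (objective p) y" for y
    unfolding gradient_objective by (rule gderiv_objective)
  show "fstar \<le> objective p y" for y using gap_nonneg[of y] by (simp add: gap_def)
qed (rule objective_lipschitz, rule L_nonneg)

text \<open>Gradients at the iterates are compared with gradients at their mean, and those are bounded by the
  optimality gap.\<close>

lemma sq_norm_grad_le:
  "sq_norm n (\<lambda>i. grad i (X i)) \<le> 4 * L * n * gap (agent_mean n X) + 2 * L\<^sup>2 * disagreement X"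
proof -
  let ?x = "agent_mean n X"
  have 1: "sq_norm n (\<lambda>i. grad i (X i)) \<le> 2 * sq_norm n (\<lambda>i. grad i ?x) + 2 * sq_norm n (\<lambda>i. grad i (X i) - grad i ?x)"
    using sq_norm_add2_le[of n "\<lambda>i. grad i ?x" "\<lambda>i. grad i (X i) - grad i ?x"] by simp
  have "sq_norm n (\<lambda>i. grad i ?x) \<le> (\<Sum>i\<in>V. 2 * L * (local_obj p i ?x - fstar))"
    unfolding sq_norm_def
  proof (rule sum_mono)
    fix i assume i: "i \<in> V"
    show "(norm (grad i ?x))\<^sup>2 \<le> 2 * L * (local_obj p i ?x - fstar)"
      by (rule gradient_sq_le_gap[where f = "local_obj p i" and g = "grad i"])
         (rule gderiv_local grad_lipschitz fstar_le L_nonneg i)+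
  qed
  also have "\<dots> = 2 * L * n * gap ?x"
    using n_pos by (simp add: gap_eq sum_distrib_left mult.assoc)
  finally have 2: "sq_norm n (\<lambda>i. grad i ?x) \<le> 2 * L * n * gap ?x" .
  have "sq_norm n (\<lambda>i. grad i (X i) - grad i ?x) \<le> (\<Sum>i\<in>V. (L * norm (X i - ?x))\<^sup>2)"
    unfolding sq_norm_def by (intro sum_mono power_mono grad_lipschitz norm_ge_zero)
  also have "\<dots> = L\<^sup>2 * disagreement X"
    by (simp add: sq_norm_def deviation_def power_mult_distrib sum_distrib_left)
  finally show ?thesis using 1 2 by simp
qed

definition sgrad :: "nat \<Rightarrow> (nat \<Rightarrow> 'a) \<Rightarrow> 'w \<Rightarrow> nat \<Rightarrow> 'a" where
  "sgrad t X w i = stoch_grad p i (X i) (data_rv p t i w)"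

lemma stoch_grad_measurable:
  "i \<in> V \<Longrightarrow> (\<lambda>(x, s). stoch_grad p i x s) \<in> borel \<Otimes>\<^sub>M data_law p i \<rightarrow>\<^sub>M borel"
  using objective_setup by (auto simp: objective_setup_def)

lemma stoch_grad_measurable1 [measurable]: "i \<in> V \<Longrightarrow> stoch_grad p i x \<in> data_law p i \<rightarrow>\<^sub>M borel"
  using measurable_compose[OF measurable_Pair1' stoch_grad_measurable, of x] by simp

lemma sgrad_measurable [measurable]: "i \<in> V \<Longrightarrow> (\<lambda>w. sgrad t X w i) \<in> borel_measurable M"
  unfolding sgrad_def by measurable

lemma sgrad_mean: "i \<in> V \<Longrightarrow> integrable M (\<lambda>w. sgrad t X w i)"
    "i \<in> V \<Longrightarrow> (LINT w|M. sgrad t X w i) = grad i (X i)"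
proof -
  assume i: "i \<in> V"
  have 1: "integrable (data_law p i) (stoch_grad p i (X i))"
    "(LINT s|data_law p i. stoch_grad p i (X i) s) = grad i (X i)"
    using i objective_setup by (auto simp: objective_setup_def)
  then show "integrable M (\<lambda>w. sgrad t X w i)" "(LINT w|M. sgrad t X w i) = grad i (X i)"
    using i by (subst (asm) (1 2) distr_data_rv[symmetric, of i t],
        simp_all add: integrable_distr_eq integral_distr sgrad_def)+
qed

lemma sgrad_variance:
  assumes i: "i \<in> V"
  shows "expect_le M (\<lambda>w. (norm (sgrad t X w i - grad i (X i)))\<^sup>2) ((\<sigma> i)\<^sup>2)"
proof -
  have "expect_le (data_law p i) (\<lambda>s. (norm (stoch_grad p i (X i) s - grad i (X i)))\<^sup>2) ((\<sigma> i)\<^sup>2)"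
    using i gradient_noise by (auto simp: gradient_noise_assm_def)
  then have "expect_le (distr M (data_law p i) (data_rv p t i)) (\<lambda>s. (norm (stoch_grad p i (X i) s - grad i (X i)))\<^sup>2) ((\<sigma> i)\<^sup>2)"
    using i by (simp add: distr_data_rv)
  then show ?thesis using i by (subst (asm) expect_le_distr) (auto simp: sgrad_def)
qed

lemma n_s2: "real n * s2 = (\<Sum>i\<in>V. (\<sigma> i)\<^sup>2)"
  using n_pos by (simp add: mean_variance_def)

lemma s2_pos: "0 < s2"
  using gradient_noise by (simp add: gradient_noise_assm_def)

text \<open>The sample is split into mean and noise; the resulting factor \<open>2\<close> is harmless, because this bound
  enters the consensus error only, where it is multiplied by \<open>\<alpha>\<^sup>2\<close>.\<close>

lemma sgrad_sq_norm:
  "expect_le M (\<lambda>w. sq_norm n (sgrad t X w)) (2 * n * s2 + 2 * sq_norm n (\<lambda>i. grad i (X i)))"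
proof (rule expect_le_mono)
  show "expect_le M (\<lambda>w. 2 * (\<Sum>i\<in>V. (norm (sgrad t X w i - grad i (X i)))\<^sup>2) + 2 * sq_norm n (\<lambda>i. grad i (X i)))
     (2 * n * s2 + 2 * sq_norm n (\<lambda>i. grad i (X i)))"
  proof -
    have "expect_le M (\<lambda>w. \<Sum>i\<in>V. (norm (sgrad t X w i - grad i (X i)))\<^sup>2) (n * s2)"
      unfolding n_s2 by (intro expect_le_sum sgrad_variance)
    from expect_le_add[OF expect_le_cmult[OF _ this, of 2] M.expect_le_const[OF order_refl]]
    show ?thesis by (simp add: mult.assoc)
  qed
  show "(\<lambda>w. sq_norm n (sgrad t X w)) \<in> borel_measurable M"
    unfolding sq_norm_def by measurable
  show "sq_norm n (sgrad t X w) \<le>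
      2 * (\<Sum>i\<in>V. (norm (sgrad t X w i - grad i (X i)))\<^sup>2) + 2 * sq_norm n (\<lambda>i. grad i (X i))" for w
    using sq_norm_add2_le[of n "\<lambda>i. sgrad t X w i - grad i (X i)" "\<lambda>i. grad i (X i)"]
    by (simp add: sq_norm_def)
qed simp

lemma sgrad_mean_variance:
  "expect_le M (\<lambda>w. (norm (agent_mean n (sgrad t X w) - agent_mean n (\<lambda>i. grad i (X i))))\<^sup>2) (s2 / n)"
proof -
  have "expect_le M (\<lambda>w. (norm (\<Sum>i\<in>V. sgrad t X w i - grad i (X i)))\<^sup>2) (\<Sum>i\<in>V. (\<sigma> i)\<^sup>2)"
  proof (rule M.indep_vars_sum_sq_norm)
    have "M.indep_vars (data_law p) (data_rv p t) V"
      using gradient_noise by (auto simp: gradient_noise_assm_def)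
    then show "M.indep_vars (\<lambda>_. borel) (\<lambda>i w. sgrad t X w i - grad i (X i)) V"
      unfolding sgrad_def by (rule M.indep_vars_compose2) measurable
  qed (auto simp: sgrad_mean sgrad_variance M.prob_space)
  then have "expect_le M (\<lambda>w. (1 / n)\<^sup>2 * (norm (\<Sum>i\<in>V. sgrad t X w i - grad i (X i)))\<^sup>2) ((1 / n)\<^sup>2 * (n * s2))"
    unfolding n_s2 by (rule expect_le_cmult[rotated]) simp
  moreover have "(1 / real n)\<^sup>2 * (n * s2) = s2 / n" using n_pos by (simp add: power2_eq_square)
  moreover have "(norm (agent_mean n (sgrad t X w) - agent_mean n (\<lambda>i. grad i (X i))))\<^sup>2
      = (1 / n)\<^sup>2 * (norm (\<Sum>i\<in>V. sgrad t X w i - grad i (X i)))\<^sup>2" for w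
    unfolding agent_mean_diff[symmetric]
    by (simp add: agent_mean_def power_divide power_mult_distrib)
  ultimately show ?thesis by simp
qed

definition lap :: "nat \<Rightarrow> (nat \<Rightarrow> 'a) \<Rightarrow> 'w \<Rightarrow> nat \<Rightarrow> 'a" where
  "lap t Y w = laplacian p (active_diag p (graph_rv p t w)) Y"

lemma active_measurable [measurable]:
  "e \<in> edges p \<Longrightarrow> (\<lambda>z. active_diag p z e) \<in> borel_measurable (graph_law p)"
  using graph_setup unfolding graph_setup_def active_diag_def of_bool_def by (auto intro!: measurable_If)

lemma active_mean:
  assumes "e \<in> edges p"
  shows "integrable M (\<lambda>w. active_diag p (graph_rv p t w) e)"
    "(LINT w|M. active_diag p (graph_rv p t w) e) = mean_diag p e"
proof -
  note [measurable] = active_measurable[OF assms]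
  show "integrable M (\<lambda>w. active_diag p (graph_rv p t w) e)"
    by (rule M.integrable_const_bound[where B = 1]) (auto simp: active_diag_def[abs_def] intro!: measurable_compose[OF graph_rv active_measurable[OF assms], unfolded active_diag_def])
  show "(LINT w|M. active_diag p (graph_rv p t w) e) = mean_diag p e"
    unfolding mean_diag_def by (subst distr_graph_rv[symmetric, of t]) (simp add: integral_distr)
qed

lemma laplacian_active_measurable:
  assumes "i \<in> V" shows "(\<lambda>z. laplacian p (active_diag p z) Y i) \<in> borel_measurable (graph_law p)"
  using assms by (simp add: laplacian_eq)

lemma lap_measurable [measurable]: "i \<in> V \<Longrightarrow> (\<lambda>w. lap t Y w i) \<in> borel_measurable M"
  unfolding lap_def by (rule measurable_compose[OF graph_rv laplacian_active_measurable])

lemma lap_inner_mean: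
  "integrable M (\<lambda>w. \<Sum>i\<in>V. X i \<bullet> lap t Y w i)"
  "(LINT w|M. (\<Sum>i\<in>V. X i \<bullet> lap t Y w i)) = dirichlet p (mean_diag p) X Y"
  unfolding lap_def inner_laplacian dirichlet_def by (simp_all add: active_mean)

lemma lap_sq_norm:
  assumes "Y \<in> stacked n"
  shows "expect_le M (\<lambda>w. sq_norm n (lap t Y w)) (2 * (\<rho>max\<^sup>2 + \<sigma>A\<^sup>2 * \<rho>max) * disagreement Y)"
proof -
  let ?R = "laplacian p (mean_diag p) Y"
  have "expect_le (graph_law p) (\<lambda>z. sq_norm n (\<lambda>i. laplacian p (active_diag p z) Y i - ?R i))
      (\<sigma>A\<^sup>2 * dirichlet p (mean_diag p) Y Y)"
    using graph_noise assms unfolding graph_noise_assm_def Let_def laplacian_def[symmetric] qform_gram by auto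
  moreover have "(\<lambda>z. sq_norm n (\<lambda>i. laplacian p (active_diag p z) Y i - ?R i)) \<in> borel_measurable (graph_law p)"
    unfolding sq_norm_def using laplacian_active_measurable[measurable] by measurable
  ultimately have 1: "expect_le M (\<lambda>w. sq_norm n (\<lambda>i. lap t Y w i - ?R i)) (\<sigma>A\<^sup>2 * dirichlet p (mean_diag p) Y Y)"
    using expect_le_distr[OF graph_rv[of t]] by (simp add: lap_def distr_graph_rv)
  have 2: "expect_le M (\<lambda>w. 2 * sq_norm n (\<lambda>i. lap t Y w i - ?R i) + 2 * sq_norm n ?R)
      (2 * (\<sigma>A\<^sup>2 * dirichlet p (mean_diag p) Y Y) + 2 * sq_norm n ?R)"
    by (intro expect_le_add expect_le_cmult 1 M.expect_le_const) auto
  show ?thesis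
  proof (rule expect_le_weaken[OF expect_le_mono[OF 2]])
    show "(\<lambda>w. sq_norm n (lap t Y w)) \<in> borel_measurable M" unfolding sq_norm_def by measurable
    show "sq_norm n (lap t Y w) \<le> 2 * sq_norm n (\<lambda>i. lap t Y w i - ?R i) + 2 * sq_norm n ?R" for w
      using sq_norm_add2_le[of n "\<lambda>i. lap t Y w i - ?R i" ?R] by simp
    have "\<sigma>A\<^sup>2 * dirichlet p (mean_diag p) Y Y \<le> \<sigma>A\<^sup>2 * (\<rho>max * disagreement Y)"
      by (intro mult_left_mono dirichlet_mean_le) simp
    then show "2 * (\<sigma>A\<^sup>2 * dirichlet p (mean_diag p) Y Y) + 2 * sq_norm n ?R
        \<le> 2 * (\<rho>max\<^sup>2 + \<sigma>A\<^sup>2 * \<rho>max) * disagreement Y"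
      using laplacian_mean_sq_le[of Y] by (simp add: algebra_simps)
  qed simp
qed

lemma compress_measurable [measurable]:
  "(\<lambda>(X, s). compress p X s) \<in> stacked_borel n \<Otimes>\<^sub>M comp_law p \<rightarrow>\<^sub>M stacked_borel n"
  using compressor by (simp add: compressor_assm_def)

lemma space_stacked_borel: "space (stacked_borel n) = stacked n"
  by (simp add: stacked_borel_def stacked_def space_PiM)

lemma component_measurable: "i \<in> agents k \<Longrightarrow> (\<lambda>X. X i) \<in> stacked_borel k \<rightarrow>\<^sub>M borel"
  unfolding stacked_borel_def by (rule measurable_component_singleton)

text \<open>
  The compressor is contractive only after division by \<open>r\<close>.  With \<open>\<gamma> = 1\<close> the residual is the convex
  combination \<open>(1 - r) X + r (X - Q / r)\<close>, which still contracts by \<open>1 - r \<delta>\<close>, because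
  \<open>(1 - \<delta>)\<^sup>2 \<le> 1 - \<delta>\<close>.  The channel noise \<open>W\<close> has vanishing second moment, so it is zero almost surely.
\<close>

lemma compress_contraction:
  assumes X: "X \<in> stacked n" and r: "r \<le> 1"
  shows "expect_le (comp_law p) (\<lambda>s. sq_norm n (\<lambda>i. X i - compress p X s i)) ((1 - r * \<delta>) * sq_norm n X)"
proof -
  obtain Qh W where
    split: "\<forall>s\<in>space (comp_law p). \<forall>i\<in>V. compress p X s i = Qh X s i + W X s i"
    and W: "expect_le (comp_law p) (\<lambda>s. sq_norm n (W X s)) (0\<^sup>2)"
    and Qh: "expect_le (comp_law p) (\<lambda>s. sq_norm n (\<lambda>i. X i - (1 / r) *\<^sub>R Qh X s i)) ((1 - \<delta>)\<^sup>2 * sq_norm n X)"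
    using compressor X unfolding compressor_assm_def by blast
  interpret C: prob_space "comp_law p"
    using M.prob_space_distr[OF comp_rv, of undefined] by (simp add: distr_comp_rv)
  have "(LINT s|comp_law p. sq_norm n (W X s)) = 0"
    using W by (intro antisym Bochner_Integration.integral_nonneg) (auto simp: expect_le_def)
  then have "AE s in comp_law p. sq_norm n (W X s) = 0"
    using W by (subst (asm) integral_nonneg_eq_0_iff_AE) (auto simp: expect_le_def)
  then have ae: "AE s in comp_law p. \<forall>i\<in>V. compress p X s i = Qh X s i"
    using AE_space
  proof eventually_elim
    case (elim s)
    then have "\<forall>i\<in>V. W X s i = 0" by (auto simp: sq_norm_def sum_nonneg_eq_0_iff)
    then show ?case using split elim by simp
  qed
  have meas: "(\<lambda>s. compress p X s i) \<in> borel_measurable (comp_law p)" if "i \<in> V" for i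
  proof -
    have "(\<lambda>s. (X, s)) \<in> comp_law p \<rightarrow>\<^sub>M stacked_borel n \<Otimes>\<^sub>M comp_law p"
      using X by (intro measurable_Pair1') (simp add: space_stacked_borel)
    from measurable_compose[OF measurable_compose[OF this compress_measurable] component_measurable[OF that]]
    show ?thesis by simp
  qed
  have 1: "expect_le (comp_law p) (\<lambda>s. (1 - r) * sq_norm n X + r * sq_norm n (\<lambda>i. X i - (1 / r) *\<^sub>R Qh X s i))
      ((1 - r) * sq_norm n X + r * ((1 - \<delta>)\<^sup>2 * sq_norm n X))"
    using delta_r by (intro expect_le_add expect_le_cmult Qh C.expect_le_const) auto
  show ?thesis
  proof (rule expect_le_weaken[OF expect_le_mono_AE[OF 1]])
    show "(\<lambda>s. sq_norm n (\<lambda>i. X i - compress p X s i)) \<in> borel_measurable (comp_law p)"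
      unfolding sq_norm_def using meas by (intro borel_measurable_sum borel_measurable_power borel_measurable_norm borel_measurable_diff) auto
    show "AE s in comp_law p. sq_norm n (\<lambda>i. X i - compress p X s i)
        \<le> (1 - r) * sq_norm n X + r * sq_norm n (\<lambda>i. X i - (1 / r) *\<^sub>R Qh X s i)"
      using ae
    proof eventually_elim
      case (elim s)
      have "sq_norm n (\<lambda>i. X i - compress p X s i)
          = sq_norm n (\<lambda>i. (1 - r) *\<^sub>R X i + r *\<^sub>R (X i - (1 / r) *\<^sub>R Qh X s i))"
        using elim delta_r by (intro sq_norm_cong) (simp add: algebra_simps)
      also have "\<dots> \<le> (1 - r) * sq_norm n X + r * sq_norm n (\<lambda>i. X i - (1 / r) *\<^sub>R Qh X s i)"
        using delta_r r by (intro sq_norm_convex) auto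
      finally show ?case .
    qed
    have "(1 - \<delta>)\<^sup>2 \<le> 1 - \<delta>"
      using delta_r by (simp add: power2_eq_square mult_left_le_one_le)
    then have "r * (1 - \<delta>)\<^sup>2 \<le> r * (1 - \<delta>)" using delta_r by (intro mult_left_mono) auto
    then have "((1 - r) + r * (1 - \<delta>)\<^sup>2) * sq_norm n X \<le> (1 - r * \<delta>) * sq_norm n X"
      by (intro mult_right_mono) (auto simp: algebra_simps)
    then show "(1 - r) * sq_norm n X + r * ((1 - \<delta>)\<^sup>2 * sq_norm n X) \<le> (1 - r * \<delta>) * sq_norm n X"
      by (simp add: algebra_simps)
  qed (use r in auto)
qed

end

section \<open>One-step estimates\<close>

locale ticopd_run = ticopd_setting p L fstar \<delta> r \<sigma> \<rho>min \<rho>max \<rho>tmin \<rho>tmax \<sigma>A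
  for p :: "('a::euclidean_space, 's, 'z, 'q, 'w) inst"
    and L fstar \<delta> r \<sigma> \<rho>min \<rho>max \<rho>tmin \<rho>tmax \<sigma>A +
  fixes \<alpha> \<theta> \<eta> :: real
  assumes step_pos: "0 < \<alpha>" "0 < \<theta>" "0 < \<eta>"
    and r_le: "r \<le> 1" and alpha_L: "\<alpha> * L \<le> 1"
begin

text \<open>\<open>\<beta>\<close> is the effective gain of the consensus term, \<open>\<epsilon>\<close> the rate of the dual variable, \<open>q\<close> the
  contraction gap of the compressor and \<open>x\<close> that of the averaged consensus step.\<close>

definition \<beta> :: real where "\<beta> = \<alpha> * \<theta>"
definition \<kappa> :: real where "\<kappa> = \<eta> / \<beta>"
definition \<epsilon> :: real where "\<epsilon> = \<eta> / \<theta>"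
definition q :: real where "q = r * \<delta>"
definition x :: real where "x = \<beta> * \<rho>min"

lemma param_pos: "0 < \<beta>" "0 < \<kappa>" "0 < \<epsilon>" "0 < q" "q \<le> 1" "0 < x"
  using step_pos delta_r r_le rho_pos
  by (auto simp: \<beta>_def \<kappa>_def \<epsilon>_def q_def x_def mult_le_one)

lemma param_eq: "\<kappa> * \<beta> = \<eta>" "\<kappa> * \<alpha> = \<epsilon>" "\<alpha> * \<theta> = \<beta>"
  using step_pos by (auto simp: \<beta>_def \<kappa>_def \<epsilon>_def)

abbreviation "weak_noise \<equiv> 128 * \<beta> * (\<rho>max\<^sup>2 + \<sigma>A\<^sup>2 * \<rho>max) \<le> q * \<rho>min"
abbreviation "weak_gain \<equiv> 256 * (\<beta> * \<rho>max) \<le> q"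

definition primal_next :: "nat \<Rightarrow> (nat \<Rightarrow> 'a) \<Rightarrow> (nat \<Rightarrow> 'a) \<Rightarrow> (nat \<Rightarrow> 'a) \<Rightarrow> 'w \<Rightarrow> nat \<Rightarrow> 'a" where
  "primal_next t X lam Xh w i = X i - \<alpha> *\<^sub>R (sgrad t X w i + lam i + \<theta> *\<^sub>R lap t Xh w i)"

text \<open>The slow variable \<open>z\<close> in which the Laplacian terms of the primal and the dual update cancel.\<close>

definition corrected_dual :: "(nat \<Rightarrow> 'a) \<Rightarrow> (nat \<Rightarrow> 'a) \<Rightarrow> nat \<Rightarrow> 'a" where
  "corrected_dual X lam i = lam i + \<kappa> *\<^sub>R deviation n X i"

definition grad_bound :: "(nat \<Rightarrow> 'a) \<Rightarrow> real" where
  "grad_bound X = 2 * n * s2 + 2 * sq_norm n (\<lambda>i. grad i (X i))"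

text \<open>Up to the factor \<open>3 \<alpha>\<^sup>2\<close> this bounds the second moment of the part of a primal step that is not
  due to the Laplacian: there \<open>lam = z - \<kappa> (X - mean)\<close>, and the gradient sample is added.\<close>

definition forcing :: "(nat \<Rightarrow> 'a) \<Rightarrow> (nat \<Rightarrow> 'a) \<Rightarrow> real" where
  "forcing X lam = sq_norm n (corrected_dual X lam) + \<kappa>\<^sup>2 * disagreement X + grad_bound X"

lemma forcing_nonneg: "0 \<le> forcing X lam"
  using s2_pos n_pos by (auto simp: grad_bound_def forcing_def intro!: add_nonneg_nonneg mult_nonneg_nonneg)

lemma deviation_eq_self: "(\<Sum>i\<in>V. Y i) = 0 \<Longrightarrow> deviation n Y = Y"
  by (simp add: deviation_def agent_mean_def fun_eq_iff)

lemma sum_lap: "(\<Sum>i\<in>V. lap t Y w i) = 0"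
  unfolding lap_def by (rule sum_laplacian)

lemma deviation_primal_next:
  assumes "(\<Sum>i\<in>V. lam i) = 0"
  shows "deviation n (primal_next t X lam Xh w) i = deviation n X i
      - \<alpha> *\<^sub>R (deviation n (sgrad t X w) i + lam i + \<theta> *\<^sub>R lap t Xh w i)"
proof -
  have "primal_next t X lam Xh w = (\<lambda>i. X i - \<alpha> *\<^sub>R (sgrad t X w i + lam i + \<theta> *\<^sub>R lap t Xh w i))"
    by (simp add: primal_next_def fun_eq_iff)
  then show ?thesis
    by (simp add: deviation_diff deviation_add deviation_scale deviation_eq_self[OF assms]
        deviation_eq_self[OF sum_lap])
qed

lemma primal_next_measurable [measurable]:
  "i \<in> V \<Longrightarrow> (\<lambda>w. primal_next t X lam Xh w i) \<in> borel_measurable M"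
  unfolding primal_next_def by measurable

lemma agent_mean_measurable:
  assumes "\<And>i. i \<in> V \<Longrightarrow> (\<lambda>w. Y w i) \<in> borel_measurable N"
  shows "(\<lambda>w. agent_mean n (Y w)) \<in> borel_measurable N"
  unfolding agent_mean_def using assms by measurable

lemma deviation_measurable:
  assumes "\<And>i. i \<in> V \<Longrightarrow> (\<lambda>w. Y w i) \<in> borel_measurable N" "i \<in> V"
  shows "(\<lambda>w. deviation n (Y w) i) \<in> borel_measurable N"
  unfolding deviation_def using assms agent_mean_measurable[of Y N] by simp

lemma sq_norm_measurable:
  assumes "\<And>i. i \<in> V \<Longrightarrow> (\<lambda>w. Y w i) \<in> borel_measurable N"
  shows "(\<lambda>w. sq_norm n (Y w)) \<in> borel_measurable N"
  unfolding sq_norm_def using assms by measurable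

lemma expect_sgrad: "expect_le M (\<lambda>w. sq_norm n (sgrad t X w)) (grad_bound X)"
  unfolding grad_bound_def by (rule sgrad_sq_norm)

text \<open>
  The new slow variable is exactly a convex combination with weight \<open>\<epsilon>\<close>, so convexity of the squared
  norm gives the estimate, whatever the joint law of the graph and gradient samples.
\<close>

lemma corrected_dual_step:
  assumes eta: "\<eta> \<le> \<theta>" and lam: "(\<Sum>i\<in>V. lam i) = 0"
  shows "expect_le M
    (\<lambda>w. sq_norm n (corrected_dual (primal_next t X lam Xh w) (\<lambda>i. lam i + \<eta> *\<^sub>R lap t Xh w i)))
    ((1 - \<epsilon>) * sq_norm n (corrected_dual X lam)
      + \<epsilon> * (2 * \<kappa>\<^sup>2 * disagreement X + 2 * grad_bound X))"
proof (rule expect_le_mono)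
  have eps: "\<epsilon> \<le> 1" using eta step_pos by (simp add: \<epsilon>_def)
  show "expect_le M (\<lambda>w. (1 - \<epsilon>) * sq_norm n (corrected_dual X lam)
        + \<epsilon> * (2 * \<kappa>\<^sup>2 * disagreement X + 2 * sq_norm n (sgrad t X w)))
    ((1 - \<epsilon>) * sq_norm n (corrected_dual X lam)
      + \<epsilon> * (2 * \<kappa>\<^sup>2 * disagreement X + 2 * grad_bound X))"
    using param_pos eps by (intro expect_le_add expect_le_cmult expect_sgrad M.expect_le_const) auto
  show "(\<lambda>w. sq_norm n (corrected_dual (primal_next t X lam Xh w) (\<lambda>i. lam i + \<eta> *\<^sub>R lap t Xh w i)))
      \<in> borel_measurable M"
    unfolding corrected_dual_def
    by (intro sq_norm_measurable borel_measurable_add borel_measurable_scaleR borel_measurable_const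
        deviation_measurable lap_measurable primal_next_measurable)
  fix w
  let ?z = "corrected_dual X lam"
  let ?y = "\<lambda>i. \<kappa> *\<^sub>R deviation n X i - deviation n (sgrad t X w) i"
  have id: "corrected_dual (primal_next t X lam Xh w) (\<lambda>i. lam i + \<eta> *\<^sub>R lap t Xh w i)
      = (\<lambda>i. (1 - \<epsilon>) *\<^sub>R ?z i + \<epsilon> *\<^sub>R ?y i)"
    unfolding corrected_dual_def deviation_primal_next[OF lam]
    by (rule ext) (simp add: algebra_simps param_eq param_eq(1)[unfolded mult.commute[of \<kappa>]] flip: param_eq(2))
  have "sq_norm n ?y \<le> 2 * (\<kappa>\<^sup>2 * disagreement X) + 2 * disagreement (sgrad t X w)"
    using sq_norm_diff2_le[of n "\<lambda>i. \<kappa> *\<^sub>R deviation n X i" "deviation n (sgrad t X w)"]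
    by (simp add: sq_norm_scale)
  also have "\<dots> \<le> 2 * \<kappa>\<^sup>2 * disagreement X + 2 * sq_norm n (sgrad t X w)"
    using sq_norm_deviation_le[of n "sgrad t X w"] by simp
  finally have "\<epsilon> * sq_norm n ?y \<le> \<epsilon> * (2 * \<kappa>\<^sup>2 * disagreement X + 2 * sq_norm n (sgrad t X w))"
    using param_pos eps by (intro mult_left_mono) auto
  moreover have "sq_norm n (\<lambda>i. (1 - \<epsilon>) *\<^sub>R ?z i + \<epsilon> *\<^sub>R ?y i) \<le> (1 - \<epsilon>) * sq_norm n ?z + \<epsilon> * sq_norm n ?y"
    using param_pos eps by (intro sq_norm_convex) auto
  ultimately show "sq_norm n (corrected_dual (primal_next t X lam Xh w) (\<lambda>i. lam i + \<eta> *\<^sub>R lap t Xh w i))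
     \<le> (1 - \<epsilon>) * sq_norm n ?z + \<epsilon> * (2 * \<kappa>\<^sup>2 * disagreement X + 2 * sq_norm n (sgrad t X w))"
    unfolding id by linarith
qed simp

abbreviation "residual X lam e \<equiv>
  (\<lambda>i. \<alpha> *\<^sub>R (corrected_dual X lam i + (- \<kappa>) *\<^sub>R deviation n X i + e i))"

text \<open>Stated for any \<open>e\<close> dominated by the gradient sample, because it is used both for the sample
  itself and for its deviation from the mean.\<close>

lemma expect_residual:
  assumes d: "\<And>w i. i \<in> V \<Longrightarrow> (\<lambda>w. e w i) \<in> borel_measurable M"
    and le: "\<And>w. sq_norm n (e w) \<le> sq_norm n (sgrad t X w)"
  shows "expect_le M (\<lambda>w. sq_norm n (residual X lam (e w)))
    (3 * \<alpha>\<^sup>2 * forcing X lam)"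
proof (rule expect_le_mono)
  let ?z = "sq_norm n (corrected_dual X lam)" and ?c = "\<kappa>\<^sup>2 * disagreement X"
  show "expect_le M (\<lambda>w. 3 * \<alpha>\<^sup>2 * (?z + ?c + sq_norm n (sgrad t X w))) (3 * \<alpha>\<^sup>2 * forcing X lam)"
    unfolding forcing_def
    by (intro expect_le_add expect_le_cmult expect_sgrad M.expect_le_const) auto
  show "(\<lambda>w. sq_norm n (residual X lam (e w))) \<in> borel_measurable M"
    by (intro sq_norm_measurable borel_measurable_add borel_measurable_scaleR borel_measurable_const d)
  fix w
  have "sq_norm n (\<lambda>i. corrected_dual X lam i + (- \<kappa>) *\<^sub>R deviation n X i + e w i)
      \<le> 3 * ?z + 3 * ?c + 3 * sq_norm n (sgrad t X w)"
    using sq_norm_add3_le[of n "corrected_dual X lam" "\<lambda>i. (- \<kappa>) *\<^sub>R deviation n X i" "e w"] le[of w]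
    by (simp add: sq_norm_scale[of n "- \<kappa>", simplified])
  then have "\<alpha>\<^sup>2 * sq_norm n (\<lambda>i. corrected_dual X lam i + (- \<kappa>) *\<^sub>R deviation n X i + e w i)
      \<le> \<alpha>\<^sup>2 * (3 * ?z + 3 * ?c + 3 * sq_norm n (sgrad t X w))"
    by (intro mult_left_mono) auto
  then show "sq_norm n (residual X lam (e w))
      \<le> 3 * \<alpha>\<^sup>2 * (?z + ?c + sq_norm n (sgrad t X w))"
    unfolding sq_norm_scale by (simp add: algebra_simps)
qed simp

text \<open>
  The mean iterate performs a gradient step with the averaged sample, since the dual and the Laplacian
  terms have mean zero.  The part of the descent inequality that is linear in the centred noise \<open>\<nu>\<close>
  vanishes in expectation, and the polarisation identity turns the inner product of the true and the
  averaged gradient into a decrease plus the consensus error.  The term in \<open>|m|\<^sup>2\<close> is absorbed by \<open>\<alpha> L \<le> 1\<close>.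
\<close>

lemma objective_step:
  assumes lam: "(\<Sum>i\<in>V. lam i) = 0"
  shows "expect_le M (\<lambda>w. gap (agent_mean n (primal_next t X lam Xh w)))
    (gap (agent_mean n X) - \<alpha> / 2 * (norm (gradient (objective p) (agent_mean n X)))\<^sup>2
      + \<alpha> * L\<^sup>2 / (2 * n) * disagreement X + L * \<alpha>\<^sup>2 * s2 / (2 * n))"
proof -
  let ?x = "agent_mean n X" and ?m = "agent_mean n (\<lambda>i. grad i (X i))"
  let ?g = "gradient (objective p) ?x"
  define \<nu> where "\<nu> w = agent_mean n (sgrad t X w) - ?m" for w
  define c where "c = (L * \<alpha>\<^sup>2) *\<^sub>R ?m - \<alpha> *\<^sub>R ?g"
  have mean_next: "agent_mean n (primal_next t X lam Xh w) = ?x + (- \<alpha>) *\<^sub>R (?m + \<nu> w)" for w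
  proof -
    have "primal_next t X lam Xh w = (\<lambda>i. X i - \<alpha> *\<^sub>R (sgrad t X w i + lam i + \<theta> *\<^sub>R lap t Xh w i))"
      by (simp add: primal_next_def fun_eq_iff)
    moreover have "agent_mean n lam = 0" "agent_mean n (lap t Xh w) = 0"
      using lam sum_lap by (auto simp: agent_mean_def)
    ultimately show ?thesis
      by (simp add: agent_mean_diff agent_mean_add agent_mean_scale \<nu>_def)
  qed
  have int: "integrable M \<nu>" "(LINT w|M. \<nu> w) = 0"
  proof -
    have "integrable M (\<lambda>w. agent_mean n (sgrad t X w))"
      unfolding agent_mean_def
      by (intro integrable_scaleR_right Bochner_Integration.integrable_sum sgrad_mean)
    moreover have "(LINT w|M. agent_mean n (sgrad t X w)) = ?m"
      unfolding agent_mean_def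
      by (simp only: integral_scaleR_right, subst Bochner_Integration.integral_sum)
         (auto simp: sgrad_mean)
    ultimately show "integrable M \<nu>" "(LINT w|M. \<nu> w) = 0"
      unfolding \<nu>_def by (auto simp: M.prob_space)
  qed
  then have lin: "expect_le M (\<lambda>w. c \<bullet> \<nu> w) 0" by (simp add: expect_le_def)
  have var: "expect_le M (\<lambda>w. (norm (\<nu> w))\<^sup>2) (s2 / n)"
    unfolding \<nu>_def by (rule sgrad_mean_variance)
  let ?base = "gap ?x - \<alpha> * (?g \<bullet> ?m) + L * \<alpha>\<^sup>2 / 2 * (norm ?m)\<^sup>2"
  have "expect_le M (\<lambda>w. gap (agent_mean n (primal_next t X lam Xh w))) (?base + 0 + L * \<alpha>\<^sup>2 / 2 * (s2 / n))"
  proof (rule expect_le_mono)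
    show "expect_le M (\<lambda>w. ?base + c \<bullet> \<nu> w + L * \<alpha>\<^sup>2 / 2 * (norm (\<nu> w))\<^sup>2) (?base + 0 + L * \<alpha>\<^sup>2 / 2 * (s2 / n))"
      using L_nonneg by (intro expect_le_add expect_le_cmult lin var M.expect_le_const) auto
    have [measurable]: "objective p \<in> borel_measurable borel"
      by (rule borel_measurable_continuous_onI[OF objective_continuous])
    show "(\<lambda>w. gap (agent_mean n (primal_next t X lam Xh w))) \<in> borel_measurable M"
      unfolding gap_def using agent_mean_measurable[of "primal_next t X lam Xh" M] by measurable
    show "gap (agent_mean n (primal_next t X lam Xh w)) \<le> ?base + c \<bullet> \<nu> w + L * \<alpha>\<^sup>2 / 2 * (norm (\<nu> w))\<^sup>2" for w
    proof -
      have "objective p (?x + (- \<alpha>) *\<^sub>R (?m + \<nu> w)) \<le> objective p ?x + ?g \<bullet> ((- \<alpha>) *\<^sub>R (?m + \<nu> w))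
          + L / 2 * (norm ((- \<alpha>) *\<^sub>R (?m + \<nu> w)))\<^sup>2"
        by (rule descent_lemma[where f = "objective p" and g = "gradient (objective p)"])
           (unfold gradient_objective, rule gderiv_objective,
            rule objective_lipschitz[unfolded gradient_objective])
      moreover have "(norm ((- \<alpha>) *\<^sub>R (?m + \<nu> w)))\<^sup>2 = \<alpha>\<^sup>2 * ((norm ?m)\<^sup>2 + 2 * (?m \<bullet> \<nu> w) + (norm (\<nu> w))\<^sup>2)"
        unfolding norm_scaleR power_mult_distrib power2_norm_eq_inner
        by (simp add: inner_add_left inner_add_right inner_commute)
      ultimately have "objective p (?x + (- \<alpha>) *\<^sub>R (?m + \<nu> w)) \<le> objective p ?x + ?g \<bullet> ((- \<alpha>) *\<^sub>R (?m + \<nu> w))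
          + L / 2 * (\<alpha>\<^sup>2 * ((norm ?m)\<^sup>2 + 2 * (?m \<bullet> \<nu> w) + (norm (\<nu> w))\<^sup>2))" by simp
      moreover have "?g \<bullet> ((- \<alpha>) *\<^sub>R (?m + \<nu> w)) = - \<alpha> * (?g \<bullet> ?m) - \<alpha> * (?g \<bullet> \<nu> w)"
        by (simp add: inner_add_right algebra_simps)
      moreover have "c \<bullet> \<nu> w = L * \<alpha>\<^sup>2 * (?m \<bullet> \<nu> w) - \<alpha> * (?g \<bullet> \<nu> w)"
        by (simp add: c_def inner_diff_left)
      ultimately show ?thesis
        unfolding mean_next gap_def by (simp add: distrib_left)
    qed
  qed (rule gap_nonneg)
  then show ?thesis
  proof (rule expect_le_weaken)
    have "(norm (?g - ?m))\<^sup>2 \<le> L\<^sup>2 / n * disagreement X"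
      using agent_mean_grad_diff_sq[of ?x X]
      by (simp add: gradient_objective sq_norm_def deviation_def norm_minus_commute)
    moreover have "2 * (?g \<bullet> ?m) = (norm ?g)\<^sup>2 + (norm ?m)\<^sup>2 - (norm (?g - ?m))\<^sup>2"
      by (simp add: power2_norm_eq_inner inner_diff_left inner_diff_right inner_commute)
    ultimately have "\<alpha> * ((norm ?g)\<^sup>2 + (norm ?m)\<^sup>2) \<le> \<alpha> * (2 * (?g \<bullet> ?m) + L\<^sup>2 / n * disagreement X)"
      using step_pos by (intro mult_left_mono) auto
    moreover have "(\<alpha> * L) * (\<alpha> * (norm ?m)\<^sup>2) \<le> 1 * (\<alpha> * (norm ?m)\<^sup>2)"
      using alpha_L step_pos by (intro mult_right_mono) auto
    ultimately show "?base + 0 + L * \<alpha>\<^sup>2 / 2 * (s2 / n) \<le> gap ?x - \<alpha> / 2 * (norm ?g)\<^sup>2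
      + \<alpha> * L\<^sup>2 / (2 * n) * disagreement X + L * \<alpha>\<^sup>2 * s2 / (2 * n)"
      by (simp add: algebra_simps power2_eq_square)
  qed
qed

text \<open>The first use of the upper bound on \<open>\<alpha> \<theta>\<close>: the quadratic term of the Laplacian step is a small
  fraction of the linear gain \<open>x\<close>.\<close>

lemma scaled_lap_sq_norm:
  assumes small: weak_noise
    and Xh: "Xh \<in> stacked n"
  shows "expect_le M (\<lambda>w. \<beta>\<^sup>2 * sq_norm n (lap t Xh w))
    (x * q / 32 * (disagreement X + sq_norm n (\<lambda>i. X i - Xh i)))"
proof (rule expect_le_weaken[OF expect_le_cmult[OF _ lap_sq_norm[OF Xh]]])
  let ?C = "disagreement X" and ?E = "sq_norm n (\<lambda>i. X i - Xh i)"
  have dev: "deviation n Xh = (\<lambda>i. deviation n X i - deviation n (\<lambda>i. X i - Xh i) i)"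
    by (simp add: deviation_diff)
  have "disagreement Xh \<le> 2 * ?C + 2 * disagreement (\<lambda>i. X i - Xh i)"
    by (subst dev) (rule sq_norm_diff2_le)
  also have "\<dots> \<le> 2 * (?C + ?E)" using sq_norm_deviation_le[of n "\<lambda>i. X i - Xh i"] by simp
  finally have 1: "disagreement Xh \<le> 2 * (?C + ?E)" .
  have 2: "\<beta> / 64 * (128 * \<beta> * (\<rho>max\<^sup>2 + \<sigma>A\<^sup>2 * \<rho>max)) \<le> \<beta> / 64 * (q * \<rho>min)"
    using small param_pos by (intro mult_left_mono) auto
  have 3: "0 \<le> \<beta> / 64 * (q * \<rho>min)" using param_pos rho_pos by simp
  note mult_mono[OF 2 1 3 sq_norm_nonneg]
  then show "\<beta>\<^sup>2 * (2 * (\<rho>max\<^sup>2 + \<sigma>A\<^sup>2 * \<rho>max) * disagreement Xh) \<le> x * q / 32 * (?C + ?E)"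
    by (simp add: x_def power2_eq_square algebra_simps)
qed simp

text \<open>
  The Laplacian is evaluated at \<open>Xh = X - (X - Xh)\<close>.  In expectation its drift, for the mean Laplacian
  \<open>L_R\<close>, is \<open>- 2 \<beta> X\<^sup>T L_R X\<close> plus a mixed term, and Young's inequality in the Dirichlet
  form spends half of the drift on the mixed term.  The other half yields the contraction.  The remaining part of the step may depend on the same
  sample, so it is split off by Young's inequality with weight \<open>x / 4\<close> and not by orthogonality.
\<close>

lemma consensus_step:
  assumes small: weak_noise weak_gain
    and Xh: "Xh \<in> stacked n" and lam: "(\<Sum>i\<in>V. lam i) = 0"
  shows "expect_le M (\<lambda>w. disagreement (primal_next t X lam Xh w))
    ((1 - 23 / 32 * x) * disagreement X + 3 * (\<beta> * \<rho>max) * sq_norm n (\<lambda>i. X i - Xh i)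
      + 15 / x * \<alpha>\<^sup>2 * forcing X lam)"
proof -
  let ?C = "disagreement X" and ?e = "\<lambda>i. X i - Xh i"
  let ?E = "sq_norm n ?e" and ?D = "dirichlet p (mean_diag p)"
  let ?drift = "\<lambda>w. \<Sum>i\<in>V. deviation n X i \<bullet> lap t Xh w i"
  let ?b = "\<lambda>w. residual X lam (deviation n (sgrad t X w))"
  have x_le: "x \<le> \<beta> * \<rho>max" using rho_pos param_pos by (auto simp: x_def intro: mult_left_mono)
  then have x_small: "x \<le> 1 / 256" using small(2) param_pos by linarith
  have drift: "expect_le M (\<lambda>w. - 2 * \<beta> * ?drift w) (- 2 * \<beta> * ?D X Xh)"
    using lap_inner_mean[of "deviation n X" t Xh]
    by (auto simp: expect_le_def dirichlet_deviation)
  have res: "expect_le M (\<lambda>w. sq_norm n (?b w)) (3 * \<alpha>\<^sup>2 * forcing X lam)"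
    by (rule expect_residual) (auto intro!: deviation_measurable sq_norm_deviation_le)
  let ?rhs = "(1 + x / 4) * (?C + - 2 * \<beta> * ?D X Xh + x * q / 32 * (?C + ?E)) + (1 + 1 / (x / 4)) * (3 * \<alpha>\<^sup>2 * forcing X lam)"
  have "expect_le M (\<lambda>w. disagreement (primal_next t X lam Xh w)) ?rhs"
  proof (rule expect_le_mono)
    show "expect_le M (\<lambda>w. (1 + x / 4) * (?C + - 2 * \<beta> * ?drift w + \<beta>\<^sup>2 * sq_norm n (lap t Xh w))
        + (1 + 1 / (x / 4)) * sq_norm n (?b w)) ?rhs"
      using param_pos
      by (intro expect_le_add expect_le_cmult drift res scaled_lap_sq_norm small Xh M.expect_le_const) auto
    show "(\<lambda>w. disagreement (primal_next t X lam Xh w)) \<in> borel_measurable M"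
      by (intro sq_norm_measurable deviation_measurable primal_next_measurable)
    fix w
    have id: "deviation n (primal_next t X lam Xh w)
        = (\<lambda>i. (deviation n X i - \<beta> *\<^sub>R lap t Xh w i) + - ?b w i)"
      by (rule ext, unfold deviation_primal_next[OF lam] corrected_dual_def)
         (simp add: scaleR_add_right scaleR_diff_right param_eq param_eq(2)[unfolded mult.commute[of \<kappa>]])
    have neg: "sq_norm n (\<lambda>i. - ?b w i) = sq_norm n (?b w)"
      by (simp only: sq_norm_def norm_minus_cancel)
    have "(norm (deviation n X i - \<beta> *\<^sub>R lap t Xh w i))\<^sup>2
        = (norm (deviation n X i))\<^sup>2 + - 2 * \<beta> * (deviation n X i \<bullet> lap t Xh w i) + \<beta>\<^sup>2 * (norm (lap t Xh w i))\<^sup>2" for i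
      unfolding power2_norm_eq_inner
      by (simp add: inner_diff_left inner_diff_right inner_commute power2_eq_square algebra_simps)
    then have sq: "sq_norm n (\<lambda>i. deviation n X i - \<beta> *\<^sub>R lap t Xh w i)
        = ?C + - 2 * \<beta> * ?drift w + \<beta>\<^sup>2 * sq_norm n (lap t Xh w)"
      unfolding sq_norm_def by (simp only: sum.distrib sum_distrib_left)
    show "disagreement (primal_next t X lam Xh w)
        \<le> (1 + x / 4) * (?C + - 2 * \<beta> * ?drift w + \<beta>\<^sup>2 * sq_norm n (lap t Xh w))
          + (1 + 1 / (x / 4)) * sq_norm n (?b w)"
      unfolding id sq[symmetric] neg[symmetric] by (rule sq_norm_add_le) (use param_pos in simp)
  qed simp
  then show ?thesis
  proof (rule expect_le_weaken)
    have "?D X (\<lambda>i. X i - ?e i) = ?D X X - ?D X ?e" by (rule dirichlet_diff)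
    then have "?D X Xh = ?D X X - ?D X ?e" by simp
    moreover have "2 * ?D X ?e \<le> 1 * ?D X X + 1 / 1 * ?D ?e ?e"
      by (rule dirichlet_young) (auto simp: mean_diag_nonneg)
    moreover have "?D ?e ?e \<le> \<rho>max * ?E"
      using dirichlet_mean_le[of ?e] mult_left_mono[OF sq_norm_deviation_le[of n ?e], of \<rho>max] rho_pos by linarith
    ultimately have "- 2 * ?D X Xh \<le> \<rho>max * ?E - \<rho>min * ?C"
      using dirichlet_mean_ge[of X] by linarith
    then have "\<beta> * (- 2 * ?D X Xh) \<le> \<beta> * (\<rho>max * ?E - \<rho>min * ?C)"
      using param_pos by (intro mult_left_mono) auto
    then have d: "- 2 * \<beta> * ?D X Xh \<le> (\<beta> * \<rho>max) * ?E - x * ?C" by (simp add: x_def algebra_simps)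
    have xq: "x * q / 32 * (?C + ?E) \<le> x / 32 * (?C + ?E)"
      using param_pos by (intro mult_right_mono) (auto simp: mult_left_le)
    have "?C + - 2 * \<beta> * ?D X Xh + x * q / 32 * (?C + ?E)
        \<le> (1 - 31 / 32 * x) * ?C + (33 / 32 * (\<beta> * \<rho>max)) * ?E"
      using d xq mult_right_mono[OF x_le, of ?E] by (simp add: algebra_simps)
    then have "(1 + x / 4) * (?C + - 2 * \<beta> * ?D X Xh + x * q / 32 * (?C + ?E))
        \<le> (1 + x / 4) * ((1 - 31 / 32 * x) * ?C + (33 / 32 * (\<beta> * \<rho>max)) * ?E)"
      using param_pos by (intro mult_left_mono) auto
    also have "\<dots> = ((1 + x / 4) * (1 - 31 / 32 * x)) * ?C + ((1 + x / 4) * (33 / 32 * (\<beta> * \<rho>max))) * ?E"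
      by (simp add: algebra_simps)
    also have "\<dots> \<le> (1 - 23 / 32 * x) * ?C + (3 * (\<beta> * \<rho>max)) * ?E"
    proof (intro add_mono mult_right_mono)
      have "(1 + x / 4) * (1 - 31 / 32 * x) = 1 - 23 / 32 * x - 31 / 128 * (x * x)"
        by (simp add: algebra_simps)
      then show "(1 + x / 4) * (1 - 31 / 32 * x) \<le> 1 - 23 / 32 * x" by simp
      have "(1 + x / 4) * (33 / 32 * (\<beta> * \<rho>max)) \<le> 2 * (33 / 32 * (\<beta> * \<rho>max))"
        using x_small param_pos rho_pos by (intro mult_right_mono) auto
      also have "\<dots> \<le> 3 * (\<beta> * \<rho>max)" using param_pos rho_pos by simp
      finally show "(1 + x / 4) * (33 / 32 * (\<beta> * \<rho>max)) \<le> 3 * (\<beta> * \<rho>max)" .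
    qed auto
    finally have main: "(1 + x / 4) * (?C + - 2 * \<beta> * ?D X Xh + x * q / 32 * (?C + ?E))
        \<le> (1 - 23 / 32 * x) * ?C + (3 * (\<beta> * \<rho>max)) * ?E" .
    have "1 \<le> 1 / x" using param_pos x_small by simp
    then have "(1 + 1 / (x / 4)) \<le> 5 / x" by simp
    then have "(1 + 1 / (x / 4)) * (3 * \<alpha>\<^sup>2 * forcing X lam) \<le> 5 / x * (3 * \<alpha>\<^sup>2 * forcing X lam)"
      using forcing_nonneg by (intro mult_right_mono) auto
    with main show "?rhs \<le> (1 - 23 / 32 * x) * ?C + 3 * (\<beta> * \<rho>max) * ?E + 15 / x * \<alpha>\<^sup>2 * forcing X lam"
      by simp
  qed
qed

text \<open>The weight \<open>q / 2\<close> in Young's inequality spends half of the contraction of the compressor on the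
  movement of the primal iterate.\<close>

lemma tracking_step:
  assumes small: weak_noise
    and Xh: "Xh \<in> stacked n"
  shows "expect_le M (\<lambda>w. (1 - q) * sq_norm n (\<lambda>i. primal_next t X lam Xh w i - Xh i))
    ((1 - q / 2) * sq_norm n (\<lambda>i. X i - Xh i) + x / 8 * (disagreement X + sq_norm n (\<lambda>i. X i - Xh i))
      + 12 / q * \<alpha>\<^sup>2 * forcing X lam)"
proof -
  let ?C = "disagreement X" and ?E = "sq_norm n (\<lambda>i. X i - Xh i)"
  let ?b = "\<lambda>w. residual X lam (sgrad t X w)"
  have res: "expect_le M (\<lambda>w. sq_norm n (?b w)) (3 * \<alpha>\<^sup>2 * forcing X lam)"
    by (rule expect_residual) auto
  have lap: "expect_le M (\<lambda>w. \<beta>\<^sup>2 * sq_norm n (lap t Xh w)) (x * q / 32 * (?C + ?E))"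
    by (rule scaled_lap_sq_norm[OF small Xh])
  have "(1 - q) * (1 + q / 2) = 1 - q / 2 - q * q / 2" by (simp add: field_simps)
  moreover have "(1 - q) * ((1 + 1 / (q / 2)) * 2) = 4 / q - 2 - 2 * q"
  proof -
    have "q * (1 / q) = 1" using param_pos by simp
    moreover have "1 / (q / 2) = 2 * (1 / q)" "4 / q = 4 * (1 / q)" by simp_all
    ultimately show ?thesis by algebra
  qed
  ultimately have coeff: "(1 - q) * (1 + q / 2) \<le> 1 - q / 2" "(1 - q) * ((1 + 1 / (q / 2)) * 2) \<le> 4 / q"
    using param_pos by simp_all
  let ?rhs = "(1 - q / 2) * ?E + 4 / q * (x * q / 32 * (?C + ?E) + 3 * \<alpha>\<^sup>2 * forcing X lam)"
  have "expect_le M (\<lambda>w. (1 - q) * sq_norm n (\<lambda>i. primal_next t X lam Xh w i - Xh i)) ?rhs"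
  proof (rule expect_le_mono)
    show "expect_le M (\<lambda>w. (1 - q / 2) * ?E + 4 / q * (\<beta>\<^sup>2 * sq_norm n (lap t Xh w) + sq_norm n (?b w))) ?rhs"
      using param_pos by (intro expect_le_add expect_le_cmult lap res M.expect_le_const) auto
    show "(\<lambda>w. (1 - q) * sq_norm n (\<lambda>i. primal_next t X lam Xh w i - Xh i)) \<in> borel_measurable M"
      by (intro borel_measurable_times borel_measurable_const sq_norm_measurable borel_measurable_diff
          primal_next_measurable)
    fix w
    show "0 \<le> (1 - q) * sq_norm n (\<lambda>i. primal_next t X lam Xh w i - Xh i)"
      using param_pos by simp
    let ?d = "\<lambda>i. \<beta> *\<^sub>R lap t Xh w i + ?b w i"
    have id: "(\<lambda>i. primal_next t X lam Xh w i - Xh i) = (\<lambda>i. (X i - Xh i) + - ?d i)"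
      by (rule ext, unfold primal_next_def corrected_dual_def)
         (simp add: scaleR_add_right scaleR_diff_right param_eq param_eq(2)[unfolded mult.commute[of \<kappa>]])
    have neg: "sq_norm n (\<lambda>i. - ?d i) = sq_norm n ?d"
      by (simp only: sq_norm_def norm_minus_cancel)
    have "sq_norm n (\<lambda>i. primal_next t X lam Xh w i - Xh i)
        \<le> (1 + q / 2) * ?E + (1 + 1 / (q / 2)) * sq_norm n ?d"
      unfolding id neg[symmetric] by (rule sq_norm_add_le) (use param_pos in simp)
    also have "\<dots> \<le> (1 + q / 2) * ?E + (1 + 1 / (q / 2)) * (2 * (\<beta>\<^sup>2 * sq_norm n (lap t Xh w) + sq_norm n (?b w)))"
      using sq_norm_add2_le[of n "\<lambda>i. \<beta> *\<^sub>R lap t Xh w i" "?b w"] param_pos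
      by (intro add_left_mono mult_left_mono) (auto simp: sq_norm_scale)
    finally have "(1 - q) * sq_norm n (\<lambda>i. primal_next t X lam Xh w i - Xh i)
        \<le> (1 - q) * ((1 + q / 2) * ?E + (1 + 1 / (q / 2)) * (2 * (\<beta>\<^sup>2 * sq_norm n (lap t Xh w) + sq_norm n (?b w))))"
      using param_pos by (intro mult_left_mono) auto
    also have "\<dots> = ((1 - q) * (1 + q / 2)) * ?E + ((1 - q) * ((1 + 1 / (q / 2)) * 2)) * (\<beta>\<^sup>2 * sq_norm n (lap t Xh w) + sq_norm n (?b w))"
      by (simp add: algebra_simps)
    also have "\<dots> \<le> (1 - q / 2) * ?E + 4 / q * (\<beta>\<^sup>2 * sq_norm n (lap t Xh w) + sq_norm n (?b w))"
      by (intro add_mono mult_right_mono coeff) auto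
    finally show "(1 - q) * sq_norm n (\<lambda>i. primal_next t X lam Xh w i - Xh i)
        \<le> (1 - q / 2) * ?E + 4 / q * (\<beta>\<^sup>2 * sq_norm n (lap t Xh w) + sq_norm n (?b w))" .
  qed
  moreover have "4 / q * (x * q / 32 * a + 3 * \<alpha>\<^sup>2 * b) = x / 8 * a + 12 / q * \<alpha>\<^sup>2 * b" for a b
    using param_pos by (simp add: distrib_left mult_ac)
  ultimately show ?thesis by (simp only: add.assoc)
qed

end

section \<open>The random trajectory\<close>

type_synonym 'a iterates = "(nat \<Rightarrow> 'a) \<times> (nat \<Rightarrow> 'a) \<times> (nat \<Rightarrow> 'a)"

context ticopd_run
begin

text \<open>One iteration as a function of the state and of the sample, so that measurability and independence
  can be discussed separately.\<close>

definition next_state :: "'a iterates \<Rightarrow> ((nat \<Rightarrow> 's) \<times> 'z) \<times> 'q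
    \<Rightarrow> 'a iterates" where
  "next_state s \<xi> =
    (let X = fst s; lam = fst (snd s); Xh = snd (snd s);
         D = laplacian p (active_diag p (snd (fst \<xi>))) Xh;
         X' = (\<lambda>i\<in>V. X i - \<alpha> *\<^sub>R (stoch_grad p i (X i) (fst (fst \<xi>) i) + lam i + \<theta> *\<^sub>R D i))
     in (X', (\<lambda>i\<in>V. lam i + \<eta> *\<^sub>R D i), (\<lambda>i\<in>V. Xh i + compress p (\<lambda>i\<in>V. X' i - Xh i) (snd \<xi>) i)))"

definition start :: "'a iterates" where
  "start = (x_init p, kron_id V (edges p) (\<lambda>i e. incidence p e i) (dual_init p), xhat_init p)"

text \<open>The trajectory as a function of the whole noise sequence, of which the state at time \<open>t\<close> uses only
  the first \<open>t\<close> entries.\<close>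

primrec trajectory :: "(nat \<Rightarrow> ((nat \<Rightarrow> 's) \<times> 'z) \<times> 'q) \<Rightarrow> nat \<Rightarrow> 'a iterates" where
  "trajectory \<xi> 0 = start"
| "trajectory \<xi> (Suc t) = next_state (trajectory \<xi> t) (\<xi> t)"

definition noise :: "nat \<Rightarrow> 'w \<Rightarrow> ((nat \<Rightarrow> 's) \<times> 'z) \<times> 'q" where
  "noise t w = (sample p t w, comp_rv p t w)"

definition state :: "nat \<Rightarrow> 'w \<Rightarrow> 'a iterates" where
  "state t w = trajectory (\<lambda>t. noise t w) t"

lemma state_0: "state 0 w = start" and state_Suc: "state (Suc t) w = next_state (state t w) (noise t w)"
  by (simp_all add: state_def)

lemma ticopd_eq_state: "ticopd p \<alpha> \<theta> \<eta> 1 w t = state t w"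
proof (induction t)
  case 0
  show ?case by (simp add: state_0 start_def)
next
  case (Suc t)
  obtain X lam Xh where s: "state t w = (X, lam, Xh)" by (cases "state t w") auto
  then show ?case
    using Suc unfolding state_Suc
    by (simp add: Let_def next_state_def noise_def sample_def laplacian_def cong: restrict_cong)
qed

lemma next_state_simps:
  "fst (next_state (X, lam, Xh) (noise t w)) = restrict (primal_next t X lam Xh w) V"
  "fst (snd (next_state (X, lam, Xh) (noise t w))) = (\<lambda>i\<in>V. lam i + \<eta> *\<^sub>R lap t Xh w i)"
  "snd (snd (next_state (X, lam, Xh) (noise t w))) = (\<lambda>i\<in>V. Xh i + compress p (\<lambda>i\<in>V. primal_next t X lam Xh w i - Xh i) (comp_rv p t w) i)"
  by (simp_all add: next_state_def Let_def noise_def sample_def primal_next_def sgrad_def lap_def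
      cong: restrict_cong)

text \<open>The dual iterate stays in the range of \<open>A\<^sup>T\<close>, hence has mean zero.  Membership of the
  surrogate in \<open>stacked n\<close> is carried along because the graph noise is bounded on stacked vectors.\<close>

definition admissible :: "'a iterates \<Rightarrow> bool" where
  "admissible s \<longleftrightarrow> (\<Sum>i\<in>V. fst (snd s) i) = 0 \<and> snd (snd s) \<in> stacked n"

lemma admissible_start: "admissible start"
proof -
  have "(\<Sum>i\<in>V. \<Sum>e\<in>edges p. incidence p e i *\<^sub>R dual_init p e)
      = (\<Sum>e\<in>edges p. (\<Sum>i\<in>V. incidence p e i) *\<^sub>R dual_init p e)"
    by (simp add: scaleR_sum_left) (rule sum.swap)
  then have "(\<Sum>i\<in>V. kron_id V (edges p) (\<lambda>i e. incidence p e i) (dual_init p) i) = 0"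
    by (simp add: kron_id_def incidence_sum_zero)
  then show ?thesis using init by (simp add: admissible_def start_def init_setup_def)
qed

lemma admissible_state: "admissible (state t w)"
proof (induction t)
  case 0
  show ?case by (simp add: state_0 admissible_start)
next
  case (Suc t)
  obtain X lam Xh where s: "state t w = (X, lam, Xh)" by (cases "state t w") auto
  have "(\<Sum>i\<in>V. lam i + \<eta> *\<^sub>R lap t Xh w i) = (\<Sum>i\<in>V. lam i) + \<eta> *\<^sub>R (\<Sum>i\<in>V. lap t Xh w i)"
    by (simp add: sum.distrib scaleR_sum_right)
  then show ?case using Suc
    unfolding state_Suc s admissible_def next_state_simps by (simp add: sum_lap stacked_def)
qed

abbreviation "SM \<equiv> stacked_borel n \<Otimes>\<^sub>M stacked_borel n \<Otimes>\<^sub>M (stacked_borel n :: (nat \<Rightarrow> 'a) measure)"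
abbreviation "NM \<equiv> sample_space p \<Otimes>\<^sub>M comp_law p"

lemma component_measurable' [measurable (raw)]:
  "f \<in> N \<rightarrow>\<^sub>M stacked_borel n \<Longrightarrow> i \<in> V \<Longrightarrow> (\<lambda>x. f x i) \<in> borel_measurable N"
  by (rule measurable_compose[OF _ component_measurable])

lemma stacked_measurable:
  "(\<And>i. i \<in> V \<Longrightarrow> (\<lambda>x. f x i) \<in> borel_measurable N) \<Longrightarrow> (\<lambda>x. \<lambda>i\<in>V. f x i) \<in> N \<rightarrow>\<^sub>M stacked_borel n"
  unfolding stacked_borel_def by (rule measurable_restrict)

lemma laplacian_measurable:
  assumes z: "z \<in> N \<rightarrow>\<^sub>M graph_law p" and Y[measurable]: "Y \<in> N \<rightarrow>\<^sub>M stacked_borel n" and i: "i \<in> V"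
  shows "(\<lambda>x. laplacian p (active_diag p (z x)) (Y x) i) \<in> borel_measurable N"
proof -
  have [measurable]: "(\<lambda>x. active_diag p (z x) e) \<in> borel_measurable N" if "e \<in> edges p" for e
    by (rule measurable_compose[OF z active_measurable[OF that]])
  have [measurable]: "(\<lambda>x. edge_diff p (Y x) e) \<in> borel_measurable N" if "e \<in> edges p" for e
    unfolding edge_diff_def using edge_ends[OF that] by measurable
  show ?thesis using i by (simp add: laplacian_eq)
qed

lemma next_state_measurable: "(\<lambda>(s, \<xi>). next_state s \<xi>) \<in> SM \<Otimes>\<^sub>M NM \<rightarrow>\<^sub>M SM"
proof -
  let ?N = "SM \<Otimes>\<^sub>M NM"
  have X: "(\<lambda>y. fst (fst y)) \<in> ?N \<rightarrow>\<^sub>M stacked_borel n"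
    and l: "(\<lambda>y. fst (snd (fst y))) \<in> ?N \<rightarrow>\<^sub>M stacked_borel n"
    and h: "(\<lambda>y. snd (snd (fst y))) \<in> ?N \<rightarrow>\<^sub>M stacked_borel n" by measurable
  have z: "(\<lambda>y. snd (fst (snd y))) \<in> ?N \<rightarrow>\<^sub>M graph_law p"
    and d: "(\<lambda>y. fst (fst (snd y))) \<in> ?N \<rightarrow>\<^sub>M PiM V (data_law p)"
    and c: "(\<lambda>y. snd (snd y)) \<in> ?N \<rightarrow>\<^sub>M comp_law p" unfolding sample_space_def by measurable
  have g: "(\<lambda>y. stoch_grad p i (fst (fst y) i) (fst (fst (snd y)) i)) \<in> borel_measurable ?N" if i: "i \<in> V" for i
    using measurable_compose[OF measurable_Pair[OF component_measurable'[OF X i]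
          measurable_compose[OF d measurable_component_singleton[OF i]]] stoch_grad_measurable[OF i]]
    by simp
  note D = laplacian_measurable[OF z h]
  define P where "P y = (\<lambda>i\<in>V. fst (fst y) i - \<alpha> *\<^sub>R (stoch_grad p i (fst (fst y) i) (fst (fst (snd y)) i)
      + fst (snd (fst y)) i + \<theta> *\<^sub>R laplacian p (active_diag p (snd (fst (snd y)))) (snd (snd (fst y))) i))"
    for y :: "'a iterates \<times> (((nat \<Rightarrow> 's) \<times> 'z) \<times> 'q)"
  have P: "P \<in> ?N \<rightarrow>\<^sub>M stacked_borel n"
    unfolding P_def
    by (intro stacked_measurable borel_measurable_diff borel_measurable_scaleR borel_measurable_add
        borel_measurable_const g D component_measurable' X l)
  have Lm: "(\<lambda>y. \<lambda>i\<in>V. fst (snd (fst y)) i + \<eta> *\<^sub>R laplacian p (active_diag p (snd (fst (snd y)))) (snd (snd (fst y))) i)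
      \<in> ?N \<rightarrow>\<^sub>M stacked_borel n"
    by (intro stacked_measurable borel_measurable_scaleR borel_measurable_add
        borel_measurable_const D component_measurable' l)
  have Y: "(\<lambda>y. \<lambda>i\<in>V. P y i - snd (snd (fst y)) i) \<in> ?N \<rightarrow>\<^sub>M stacked_borel n"
    by (intro stacked_measurable borel_measurable_diff component_measurable' P h)
  have Q: "(\<lambda>y. compress p (\<lambda>i\<in>V. P y i - snd (snd (fst y)) i) (snd (snd y))) \<in> ?N \<rightarrow>\<^sub>M stacked_borel n"
    using measurable_compose[OF measurable_Pair[OF Y c] compress_measurable] by simp
  have Hm: "(\<lambda>y. \<lambda>i\<in>V. snd (snd (fst y)) i + compress p (\<lambda>i\<in>V. P y i - snd (snd (fst y)) i) (snd (snd y)) i)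
      \<in> ?N \<rightarrow>\<^sub>M stacked_borel n"
    by (intro stacked_measurable borel_measurable_add component_measurable' h Q)
  show ?thesis
    using measurable_Pair[OF P measurable_Pair[OF Lm Hm]]
    by (simp add: next_state_def Let_def P_def case_prod_unfold)
qed

lemma start_space: "start \<in> space SM"
  using init by (auto simp: start_def space_pair_measure space_stacked_borel init_setup_def kron_id_def stacked_def)

lemma trajectory_measurable: "{..<t} \<subseteq> I \<Longrightarrow> (\<lambda>\<xi>. trajectory \<xi> t) \<in> PiM I (\<lambda>_. NM) \<rightarrow>\<^sub>M SM"
proof (induction t)
  case 0
  show ?case using start_space by simp
next
  case (Suc t)
  then have t: "{..<t} \<subseteq> I" "t \<in> I" by auto
  show ?case
    using measurable_compose[OF measurable_Pair[OF Suc.IH[OF t(1)] measurable_component_singleton[OF t(2)]] next_state_measurable]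
    by simp
qed

lemma trajectory_cong: "(\<And>s. s < t \<Longrightarrow> \<xi> s = \<xi>' s) \<Longrightarrow> trajectory \<xi> t = trajectory \<xi>' t"
  by (induction t) auto

lemma indep_noise: "M.indep_vars (\<lambda>_. NM) noise UNIV"
  using randomness unfolding randomness_setup_def noise_def[abs_def] by blast

lemma noise_measurable: "noise t \<in> M \<rightarrow>\<^sub>M NM"
  using indep_noise by (auto simp: M.indep_vars_def)

lemma state_measurable: "state t \<in> M \<rightarrow>\<^sub>M SM"
proof -
  have "(\<lambda>w t. noise t w) \<in> M \<rightarrow>\<^sub>M PiM UNIV (\<lambda>_. NM)"
    using measurable_restrict[of UNIV noise M "\<lambda>_. NM"] noise_measurable by (simp add: restrict_UNIV)
  from measurable_compose[OF this trajectory_measurable[of t UNIV]] show ?thesis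
    by (simp add: state_def[abs_def])
qed

text \<open>
  The state at time \<open>t\<close> is a function of the noise before \<open>t\<close>, which is independent of the noise at
  time \<open>t\<close>; so a bound for a fixed state passes to the expectation.  The noise at time \<open>t\<close> is
  represented as a family indexed by \<open>{t}\<close>, so that past and present are two disjoint subfamilies of
  one independent family.
\<close>

lemma expect_next_state:
  assumes \<phi>: "\<phi> \<in> borel_measurable SM" and nonneg: "\<And>s. 0 \<le> \<phi> s"
    and le: "\<And>w. w \<in> space M \<Longrightarrow> expect_le M (\<lambda>w'. \<phi> (next_state (state t w) (noise t w'))) (b w)"
    and b: "integrable M b"
  shows "expect_le M (\<lambda>w. \<phi> (state (Suc t) w)) (LINT w|M. b w)"
proof -
  let ?S = "\<lambda>w. restrict (\<lambda>s. noise s w) {..<t}" and ?Y = "\<lambda>w. restrict (\<lambda>s. noise s w) {t}"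
  let ?h = "\<lambda>x. \<phi> (next_state (trajectory (fst x) t) (snd x t))"
  have iv: "M.indep_var (PiM {..<t} (\<lambda>_. NM)) ?S (PiM {t} (\<lambda>_. NM)) ?Y"
    by (rule M.indep_var_restrict[OF indep_noise]) auto
  have ind: "indep_rv M (PiM {..<t} (\<lambda>_. NM)) ?S (PiM {t} (\<lambda>_. NM)) ?Y"
  proof -
    have "M.indep_set (sigma_sets (space M) {?S -` A \<inter> space M |A. A \<in> sets (PiM {..<t} (\<lambda>_. NM))})
      (sigma_sets (space M) {?Y -` A \<inter> space M |A. A \<in> sets (PiM {t} (\<lambda>_. NM))})"
      using iv unfolding M.indep_var_eq by blast
    then have "M.indep_set {?S -` A \<inter> space M |A. A \<in> sets (PiM {..<t} (\<lambda>_. NM))}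
      {?Y -` A \<inter> space M |A. A \<in> sets (PiM {t} (\<lambda>_. NM))}"
      unfolding M.indep_set_def by (rule M.indep_sets_mono_sets) (auto split: bool.split)
    then show ?thesis using iv unfolding M.indep_var_eq indep_rv_def by blast
  qed
  have h: "?h \<in> borel_measurable (PiM {..<t} (\<lambda>_. NM) \<Otimes>\<^sub>M PiM {t} (\<lambda>_. NM))"
    using measurable_compose[OF measurable_compose[OF measurable_Pair[OF
        measurable_compose[OF measurable_fst trajectory_measurable[of t "{..<t}"]]
        measurable_compose[OF measurable_snd measurable_component_singleton[of t "{t}"]]] next_state_measurable] \<phi>]
    by simp
  have eq: "trajectory (?S w) t = state t w" for w unfolding state_def by (rule trajectory_cong) simp
  have "expect_le M (\<lambda>w. ?h (?S w, ?Y w)) (LINT w|M. b w)"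
    by (rule indep_rv_expect_le[OF M.prob_space_axioms ind h])
       (use nonneg le b in \<open>simp_all add: eq\<close>)
  then show ?thesis by (simp add: eq state_Suc)
qed

text \<open>Here the frozen variable is the index: for a fixed index the expectation is over the trajectory,
  and the uniform law of the index then averages over \<open>t < T\<close>.\<close>

lemma expect_random_index:
  assumes \<phi>: "\<phi> \<in> borel_measurable SM" and nonneg: "\<And>s. 0 \<le> \<phi> s"
    and int: "\<And>t. integrable M (\<lambda>w. \<phi> (state t w))" and T: "1 \<le> T"
  shows "expect_le M (\<lambda>w. \<phi> (state (index_rv p T w) w)) ((\<Sum>t<T. LINT w|M. \<phi> (state t w)) / T)"
proof -
  let ?R = "index_rv p T" and ?Y = "\<lambda>w t. noise t w" and ?g = "\<lambda>t. LINT w|M. \<phi> (state t w)"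
  let ?h = "\<lambda>x. \<phi> (trajectory (snd x) (fst x))"
  have R: "?R \<in> M \<rightarrow>\<^sub>M count_space UNIV"
    and dR: "distr M (count_space UNIV) ?R = measure_pmf (pmf_of_set {..<T})"
    and ind: "indep_rv M (count_space UNIV) ?R (PiM UNIV (\<lambda>_. NM)) ?Y"
    using randomness T unfolding randomness_setup_def noise_def by auto
  have "(\<lambda>x. ?h (t, x)) \<in> borel_measurable (PiM UNIV (\<lambda>_. NM))" for t
    using measurable_compose[OF trajectory_measurable[of t UNIV] \<phi>] by simp
  then have h: "?h \<in> borel_measurable (count_space UNIV \<Otimes>\<^sub>M PiM UNIV (\<lambda>_. NM))"
    by (intro measurable_pair_measure_countable1) auto
  have ne: "{..<T} \<noteq> {}" "finite {..<T}" using T by (auto simp: lessThan_empty_iff)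
  have "integrable (measure_pmf (pmf_of_set {..<T})) ?g"
    using ne by (intro integrable_measure_pmf_finite) simp
  then have int_g: "integrable M (\<lambda>w. ?g (?R w))"
    unfolding dR[symmetric] by (subst (asm) integrable_distr_eq[OF R]) auto
  have "(LINT w|M. ?g (?R w)) = (LINT t|distr M (count_space UNIV) ?R. ?g t)"
    by (rule integral_distr[OF R, symmetric]) simp
  also have "\<dots> = (\<Sum>t<T. ?g t) / T"
    unfolding dR using ne by (simp add: integral_pmf_of_set)
  finally have val: "(LINT w|M. ?g (?R w)) = (\<Sum>t<T. ?g t) / T" .
  have "expect_le M (\<lambda>w. ?h (?R w, ?Y w)) (LINT w|M. ?g (?R w))"
    by (rule indep_rv_expect_le[OF M.prob_space_axioms ind h])
       (use nonneg int int_g in \<open>simp_all add: expect_le_def state_def\<close>)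
  then show ?thesis unfolding val by (simp add: state_def)
qed

end

section \<open>Recursions for the expectations\<close>

context ticopd_run
begin

definition consensus :: "'a iterates \<Rightarrow> real" where
  "consensus s = disagreement (fst s)"

definition tracking :: "'a iterates \<Rightarrow> real" where
  "tracking s = sq_norm n (\<lambda>i. fst s i - snd (snd s) i)"

definition dual_err :: "'a iterates \<Rightarrow> real" where
  "dual_err s = sq_norm n (corrected_dual (fst s) (fst (snd s)))"

definition opt_gap :: "'a iterates \<Rightarrow> real" where
  "opt_gap s = gap (agent_mean n (fst s))"

definition stationarity :: "'a iterates \<Rightarrow> real" where
  "stationarity s = (norm (gradient (objective p) (agent_mean n (fst s))))\<^sup>2"

definition grad_est :: "'a iterates \<Rightarrow> real" where
  "grad_est s = 2 * n * s2 + 8 * L * n * opt_gap s + 4 * L\<^sup>2 * consensus s"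

definition forcing_est :: "'a iterates \<Rightarrow> real" where
  "forcing_est s = dual_err s + \<kappa>\<^sup>2 * consensus s + grad_est s"

abbreviation E :: "('a iterates \<Rightarrow> real) \<Rightarrow> nat \<Rightarrow> real" where
  "E \<phi> t \<equiv> (LINT w|M. \<phi> (state t w))"

abbreviation "integ \<phi> t \<equiv> integrable M (\<lambda>w. \<phi> (state t w))"

lemma grad_bound_le: "grad_bound (fst s) \<le> grad_est s"
  using sq_norm_grad_le[of "fst s"] by (simp add: grad_bound_def grad_est_def opt_gap_def consensus_def)

lemma forcing_le: "forcing (fst s) (fst (snd s)) \<le> forcing_est s"
  using grad_bound_le[of s] by (simp add: forcing_def forcing_est_def dual_err_def consensus_def)

lemma functionals_nonneg: "0 \<le> consensus s" "0 \<le> tracking s" "0 \<le> dual_err s" "0 \<le> opt_gap s"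
    "0 \<le> stationarity s" "0 \<le> grad_est s"
  using gap_nonneg L_nonneg s2_pos n_pos
  by (auto simp: consensus_def tracking_def dual_err_def opt_gap_def stationarity_def grad_est_def
      intro!: add_nonneg_nonneg mult_nonneg_nonneg)

lemma gradient_objective_continuous: "continuous_on UNIV (gradient (objective p))"
proof -
  have "continuous_on UNIV (grad i)" if "i \<in> V" for i
    using objective_setup that by (auto simp: objective_setup_def)
  then show ?thesis unfolding gradient_objective[abs_def] agent_mean_def
    by (intro continuous_intros)
qed

lemma functionals_measurable:
  "consensus \<in> borel_measurable SM" "tracking \<in> borel_measurable SM" "dual_err \<in> borel_measurable SM"
  "opt_gap \<in> borel_measurable SM" "stationarity \<in> borel_measurable SM"
proof -
  have X: "i \<in> V \<Longrightarrow> (\<lambda>s. fst s i) \<in> borel_measurable SM"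
    and l: "i \<in> V \<Longrightarrow> (\<lambda>s. fst (snd s) i) \<in> borel_measurable SM"
    and h: "i \<in> V \<Longrightarrow> (\<lambda>s. snd (snd s) i) \<in> borel_measurable SM" for i
    by measurable
  show "consensus \<in> borel_measurable SM" unfolding consensus_def
    by (intro sq_norm_measurable deviation_measurable X)
  show "tracking \<in> borel_measurable SM" unfolding tracking_def
    by (intro sq_norm_measurable borel_measurable_diff X h)
  show "dual_err \<in> borel_measurable SM" unfolding dual_err_def corrected_dual_def
    by (intro sq_norm_measurable borel_measurable_add borel_measurable_scaleR borel_measurable_const
        deviation_measurable X l)
  have m: "(\<lambda>s. agent_mean n (fst s)) \<in> borel_measurable SM"
    by (intro agent_mean_measurable X)
  show "opt_gap \<in> borel_measurable SM" unfolding opt_gap_def gap_def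
    using measurable_compose[OF m borel_measurable_continuous_onI[OF objective_continuous]] by measurable
  show "stationarity \<in> borel_measurable SM" unfolding stationarity_def
    using measurable_compose[OF m borel_measurable_continuous_onI[OF gradient_objective_continuous]] by measurable
qed

text \<open>The gradient norm inherits integrability from the optimality gap.\<close>

lemma int_stationarity: assumes "integ opt_gap t" shows "integ stationarity t"
proof (rule Bochner_Integration.integrable_bound[OF integrable_mult_right[OF assms, of "2 * L"]])
  show "(\<lambda>w. stationarity (state t w)) \<in> borel_measurable M"
    by (rule measurable_compose[OF state_measurable functionals_measurable(5)])
  have "norm (stationarity s) \<le> norm (2 * L * opt_gap s)" for s
    using gradient_objective_sq_le[of "agent_mean n (fst s)"] functionals_nonneg(4)[of s] L_nonneg
    by (simp add: stationarity_def opt_gap_def)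
  then show "AE w in M. norm (stationarity (state t w)) \<le> norm (2 * L * opt_gap (state t w))" by simp
qed

abbreviation "primal_from s t \<equiv> primal_next t (fst s) (fst (snd s)) (snd (snd s))"

lemmas next_state_parts =
  next_state_simps[of "fst s" "fst (snd s)" "snd (snd s)" for s, simplified]

lemma consensus_next_state: "consensus (next_state s (noise t w')) =
    disagreement (primal_from s t w')"
  unfolding consensus_def
  by (intro sq_norm_cong deviation_cong) (simp_all add: next_state_parts)

lemma opt_gap_next_state: "opt_gap (next_state s (noise t w')) =
    gap (agent_mean n (primal_from s t w'))"
  unfolding opt_gap_def
  by (intro arg_cong[where f = gap] agent_mean_cong) (simp add: next_state_parts)

lemma dual_err_next_state: "dual_err (next_state s (noise t w')) =
    sq_norm n (corrected_dual (primal_from s t w')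
      (\<lambda>i. fst (snd s) i + \<eta> *\<^sub>R lap t (snd (snd s)) w' i))"
proof -
  have "deviation n (fst (next_state s (noise t w'))) i
      = deviation n (primal_from s t w') i" if "i \<in> V" for i
    using that by (intro deviation_cong) (simp_all add: next_state_parts)
  then show ?thesis unfolding dual_err_def
    by (intro sq_norm_cong) (simp add: corrected_dual_def next_state_parts)
qed

lemma opt_gap_next:
  assumes "integ opt_gap t" "integ consensus t"
  shows "expect_le M (\<lambda>w. opt_gap (state (Suc t) w))
    (E opt_gap t - \<alpha> / 2 * E stationarity t + \<alpha> * L\<^sup>2 / (2 * n) * E consensus t + L * \<alpha>\<^sup>2 * s2 / (2 * n))"
proof -
  let ?b = "\<lambda>s. opt_gap s - \<alpha> / 2 * stationarity s + \<alpha> * L\<^sup>2 / (2 * n) * consensus s + L * \<alpha>\<^sup>2 * s2 / (2 * n)"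
  note i = assms int_stationarity[OF assms(1)]
  have "expect_le M (\<lambda>w. opt_gap (state (Suc t) w)) (LINT w|M. ?b (state t w))"
  proof (rule expect_next_state)
    show "expect_le M (\<lambda>w'. opt_gap (next_state (state t w) (noise t w'))) (?b (state t w))" for w
      unfolding opt_gap_next_state unfolding opt_gap_def stationarity_def consensus_def
      by (rule objective_step) (use admissible_state[of t w] in \<open>simp add: admissible_def\<close>)
    show "integrable M (\<lambda>w. ?b (state t w))" using i by simp
  qed (use functionals_measurable functionals_nonneg in auto)
  moreover have "(LINT w|M. ?b (state t w)) = E opt_gap t - \<alpha> / 2 * E stationarity t
      + \<alpha> * L\<^sup>2 / (2 * n) * E consensus t + L * \<alpha>\<^sup>2 * s2 / (2 * n)"
    using i by (simp add: M.prob_space)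
  ultimately show ?thesis by simp
qed

lemma dual_err_next:
  assumes eta: "\<eta> \<le> \<theta>" and i: "integ opt_gap t" "integ consensus t" "integ dual_err t"
  shows "expect_le M (\<lambda>w. dual_err (state (Suc t) w))
    ((1 - \<epsilon>) * E dual_err t + \<epsilon> * (2 * \<kappa>\<^sup>2 * E consensus t + 2 * E grad_est t))"
proof -
  let ?b = "\<lambda>s. (1 - \<epsilon>) * dual_err s + \<epsilon> * (2 * \<kappa>\<^sup>2 * consensus s + 2 * grad_est s)"
  have g: "integ grad_est t" using i unfolding grad_est_def by simp
  have "expect_le M (\<lambda>w. dual_err (state (Suc t) w)) (LINT w|M. ?b (state t w))"
  proof (rule expect_next_state)
    show "expect_le M (\<lambda>w'. dual_err (next_state (state t w) (noise t w'))) (?b (state t w))" for w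
      unfolding dual_err_next_state
    proof (rule expect_le_weaken[OF corrected_dual_step[OF eta]])
      show "(\<Sum>i\<in>V. fst (snd (state t w)) i) = 0"
        using admissible_state[of t w] by (simp add: admissible_def)
      show "(1 - \<epsilon>) * sq_norm n (corrected_dual (fst (state t w)) (fst (snd (state t w))))
          + \<epsilon> * (2 * \<kappa>\<^sup>2 * disagreement (fst (state t w)) + 2 * grad_bound (fst (state t w)))
        \<le> ?b (state t w)"
        unfolding dual_err_def consensus_def using grad_bound_le[of "state t w"] param_pos
        by (intro add_left_mono mult_left_mono) auto
    qed
    show "integrable M (\<lambda>w. ?b (state t w))" using i g by simp
  qed (use functionals_measurable functionals_nonneg in auto)
  moreover have "(LINT w|M. ?b (state t w))
      = (1 - \<epsilon>) * E dual_err t + \<epsilon> * (2 * \<kappa>\<^sup>2 * E consensus t + 2 * E grad_est t)"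
    using i g by simp
  ultimately show ?thesis by simp
qed

lemma E_grad_est:
  assumes "integ opt_gap t" "integ consensus t"
  shows "E grad_est t = 2 * n * s2 + 8 * L * n * E opt_gap t + 4 * L\<^sup>2 * E consensus t"
  using assms unfolding grad_est_def by (simp add: M.prob_space)

lemma consensus_next:
  assumes small: weak_noise weak_gain
    and i: "integ opt_gap t" "integ consensus t" "integ dual_err t" "integ tracking t"
  shows "expect_le M (\<lambda>w. consensus (state (Suc t) w))
    ((1 - 23 / 32 * x) * E consensus t + 3 * (\<beta> * \<rho>max) * E tracking t + 15 / x * \<alpha>\<^sup>2 * E forcing_est t)"
proof -
  let ?b = "\<lambda>s. (1 - 23 / 32 * x) * consensus s + 3 * (\<beta> * \<rho>max) * tracking s + 15 / x * \<alpha>\<^sup>2 * forcing_est s"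
  have f: "integ forcing_est t" using i unfolding forcing_est_def grad_est_def by simp
  have "expect_le M (\<lambda>w. consensus (state (Suc t) w)) (LINT w|M. ?b (state t w))"
  proof (rule expect_next_state)
    show "expect_le M (\<lambda>w'. consensus (next_state (state t w) (noise t w'))) (?b (state t w))" for w
      unfolding consensus_next_state
    proof (rule expect_le_weaken[OF consensus_step[OF small]])
      show "snd (snd (state t w)) \<in> stacked n" "(\<Sum>i\<in>V. fst (snd (state t w)) i) = 0"
        using admissible_state[of t w] by (simp_all add: admissible_def)
      show "(1 - 23 / 32 * x) * disagreement (fst (state t w))
          + 3 * (\<beta> * \<rho>max) * sq_norm n (\<lambda>i. fst (state t w) i - snd (snd (state t w)) i)
          + 15 / x * \<alpha>\<^sup>2 * forcing (fst (state t w)) (fst (snd (state t w))) \<le> ?b (state t w)"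
        unfolding consensus_def tracking_def using forcing_le[of "state t w"] param_pos
        by (intro add_left_mono mult_left_mono) auto
    qed
    show "integrable M (\<lambda>w. ?b (state t w))" using i f by simp
  qed (use functionals_measurable functionals_nonneg in auto)
  moreover have "(LINT w|M. ?b (state t w)) = (1 - 23 / 32 * x) * E consensus t
      + 3 * (\<beta> * \<rho>max) * E tracking t + 15 / x * \<alpha>\<^sup>2 * E forcing_est t"
    using i f by simp
  ultimately show ?thesis by simp
qed

text \<open>
  The compressor acts on \<open>X' - Xh\<close>, which depends on the sample of the same iteration but is
  independent of the compressor randomness.  The contraction is therefore applied for a frozen
  sample.  \<open>D\<close> is this difference as a function of the sample alone; the compressor argument of
  \<open>next_state\<close> does not influence the primal part and is left \<open>undefined\<close>.
\<close>

lemma tracking_compression: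
  assumes Xh: "snd (snd s) \<in> stacked n"
    and Y: "expect_le M (\<lambda>w. (1 - q) * sq_norm n (\<lambda>i. primal_from s t w i - snd (snd s) i)) b"
  shows "expect_le M (\<lambda>w. tracking (next_state s (noise t w))) b"
proof -
  let ?X = "fst s" and ?l = "fst (snd s)" and ?h = "snd (snd s)"
  define D where "D d = (\<lambda>i\<in>V. fst (next_state s (d, undefined)) i - ?h i)" for d :: "(nat \<Rightarrow> 's) \<times> 'z"
  define h where "h = (\<lambda>y. sq_norm n (\<lambda>i. D (fst y) i - compress p (D (fst y)) (snd y) i))"
  have eqD: "D (sample p t w) i = primal_next t ?X ?l ?h w i - ?h i" if "i \<in> V" for w i
    using next_state_simps(1)[of ?X ?l ?h t w] that
    by (simp add: D_def next_state_def noise_def Let_def)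
  have DY: "sq_norm n (D (sample p t w)) = sq_norm n (\<lambda>i. primal_next t ?X ?l ?h w i - ?h i)" for w
    by (rule sq_norm_cong) (rule eqD)
  have Dst: "D d \<in> stacked n" for d by (auto simp: D_def stacked_def)
  have "D (sample p t w) = (\<lambda>i\<in>V. primal_next t ?X ?l ?h w i - ?h i)" for w
    using eqD[of _ w] by (auto simp: fun_eq_iff D_def)
  then have eq: "tracking (next_state s (noise t w)) = h (sample p t w, comp_rv p t w)" for w
    unfolding tracking_def h_def
    by (intro sq_norm_cong) (simp add: next_state_simps[of ?X ?l ?h, simplified] eqD)
  have sm: "sample p t \<in> M \<rightarrow>\<^sub>M sample_space p"
    using indep_sample_comp[of t] by (simp add: indep_rv_def)
  have Dm: "D \<in> sample_space p \<rightarrow>\<^sub>M stacked_borel n"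
    unfolding D_def
  proof (rule stacked_measurable)
    fix i assume i: "i \<in> V"
    have 1: "(\<lambda>d. stoch_grad p i (?X i) (fst d i)) \<in> borel_measurable (sample_space p)"
      unfolding sample_space_def
      by (rule measurable_compose[OF measurable_compose[OF measurable_fst measurable_component_singleton[OF i, of "data_law p"]]
            stoch_grad_measurable1[OF i]])
    have 2: "(\<lambda>d. laplacian p (active_diag p (snd d)) ?h i) \<in> borel_measurable (sample_space p)"
      unfolding sample_space_def
      by (rule measurable_compose[OF measurable_snd laplacian_active_measurable[OF i]])
    show "(\<lambda>d. fst (next_state s (d, undefined)) i - ?h i) \<in> borel_measurable (sample_space p)"
      using i 1 2 by (simp add: next_state_def Let_def)
  qed
  have hm: "h \<in> borel_measurable (sample_space p \<Otimes>\<^sub>M comp_law p)"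
  proof -
    have 1: "(\<lambda>y. D (fst y)) \<in> sample_space p \<Otimes>\<^sub>M comp_law p \<rightarrow>\<^sub>M stacked_borel n"
      by (rule measurable_compose[OF measurable_fst Dm])
    have 2: "(\<lambda>y. compress p (D (fst y)) (snd y)) \<in> sample_space p \<Otimes>\<^sub>M comp_law p \<rightarrow>\<^sub>M stacked_borel n"
      using measurable_compose[OF measurable_Pair[OF 1 measurable_snd] compress_measurable] by simp
    show ?thesis unfolding h_def
      by (intro sq_norm_measurable borel_measurable_diff component_measurable' 1 2)
  qed
  have "expect_le M (\<lambda>w. h (sample p t w, comp_rv p t w)) (LINT w|M. (1 - q) * sq_norm n (D (sample p t w)))"
  proof (rule indep_rv_expect_le[OF M.prob_space_axioms indep_sample_comp hm])
    fix w
    have "expect_le (distr M (comp_law p) (comp_rv p t))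
        (\<lambda>c. sq_norm n (\<lambda>i. D (sample p t w) i - compress p (D (sample p t w)) c i)) ((1 - q) * sq_norm n (D (sample p t w)))"
      unfolding distr_comp_rv q_def by (rule compress_contraction[OF Dst r_le])
    moreover have "(\<lambda>c. sq_norm n (\<lambda>i. D (sample p t w) i - compress p (D (sample p t w)) c i)) \<in> borel_measurable (comp_law p)"
    proof -
      have "(\<lambda>c. compress p (D (sample p t w)) c) \<in> comp_law p \<rightarrow>\<^sub>M stacked_borel n"
        using measurable_compose[OF measurable_Pair1'[of "D (sample p t w)"] compress_measurable] Dst
        by (simp add: space_stacked_borel)
      then show ?thesis
        by (intro sq_norm_measurable borel_measurable_diff component_measurable' borel_measurable_const)
    qed
    ultimately show "expect_le M (\<lambda>w'. h (sample p t w, comp_rv p t w')) ((1 - q) * sq_norm n (D (sample p t w)))"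
      using expect_le_distr[OF comp_rv] by (simp add: h_def)
  next
    show "integrable M (\<lambda>w. (1 - q) * sq_norm n (D (sample p t w)))"
      unfolding DY using Y by (simp only: expect_le_def)
  qed (simp add: h_def)
  then show ?thesis unfolding eq DY using Y by (auto simp: expect_le_def)
qed

lemma tracking_next:
  assumes small: weak_noise
    and i: "integ opt_gap t" "integ consensus t" "integ dual_err t" "integ tracking t"
  shows "expect_le M (\<lambda>w. tracking (state (Suc t) w))
    ((1 - q / 2) * E tracking t + x / 8 * (E consensus t + E tracking t) + 12 / q * \<alpha>\<^sup>2 * E forcing_est t)"
proof -
  let ?b = "\<lambda>s. (1 - q / 2) * tracking s + x / 8 * (consensus s + tracking s) + 12 / q * \<alpha>\<^sup>2 * forcing_est s"
  have f: "integ forcing_est t" using i unfolding forcing_est_def grad_est_def by simp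
  have "expect_le M (\<lambda>w. tracking (state (Suc t) w)) (LINT w|M. ?b (state t w))"
  proof (rule expect_next_state)
    show "expect_le M (\<lambda>w'. tracking (next_state (state t w) (noise t w'))) (?b (state t w))" for w
    proof (rule tracking_compression[OF _ expect_le_weaken[OF tracking_step[OF small]]])
      show "snd (snd (state t w)) \<in> stacked n" "snd (snd (state t w)) \<in> stacked n"
        using admissible_state[of t w] by (simp_all add: admissible_def)
      show "(1 - q / 2) * sq_norm n (\<lambda>i. fst (state t w) i - snd (snd (state t w)) i)
          + x / 8 * (disagreement (fst (state t w))
              + sq_norm n (\<lambda>i. fst (state t w) i - snd (snd (state t w)) i))
          + 12 / q * \<alpha>\<^sup>2 * forcing (fst (state t w)) (fst (snd (state t w))) \<le> ?b (state t w)"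
        unfolding consensus_def tracking_def using forcing_le[of "state t w"] param_pos
        by (intro add_left_mono mult_left_mono) auto
    qed
    show "integrable M (\<lambda>w. ?b (state t w))" using i f by simp
  qed (use functionals_measurable functionals_nonneg in auto)
  moreover have "(LINT w|M. ?b (state t w)) = (1 - q / 2) * E tracking t
      + x / 8 * (E consensus t + E tracking t) + 12 / q * \<alpha>\<^sup>2 * E forcing_est t"
    using i f by simp
  ultimately show ?thesis by simp
qed

end

section \<open>Summing the recursions\<close>

lemma telescoped_contraction:
  fixes a b :: "nat \<Rightarrow> real"
  assumes "\<And>t. a (Suc t) \<le> (1 - c) * a t + b t" "0 \<le> a T"
  shows "c * (\<Sum>t<T. a t) \<le> a 0 + (\<Sum>t<T. b t)"
proof -
  have "c * (\<Sum>t<T. a t) + a T \<le> a 0 + (\<Sum>t<T. b t)"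
  proof (induction T)
    case (Suc T)
    then show ?case using assms(1)[of T] by (simp add: algebra_simps)
  qed simp
  then show ?thesis using assms(2) by linarith
qed

context ticopd_run
begin

lemma E_nonneg: "(\<And>s. 0 \<le> \<phi> s) \<Longrightarrow> 0 \<le> E \<phi> t"
  by (rule Bochner_Integration.integral_nonneg)

lemma integ_start: "integ \<phi> 0" "E \<phi> 0 = \<phi> start"
  by (simp_all add: state_0 M.prob_space)

lemma descent_sum:
  assumes i: "\<And>t. integ consensus t"
  shows "integ opt_gap t"
    and "E opt_gap T + \<alpha> / 2 * (\<Sum>t<T. E stationarity t) \<le> opt_gap start
      + \<alpha> * L\<^sup>2 / (2 * n) * (\<Sum>t<T. E consensus t) + T * (L * \<alpha>\<^sup>2 * s2 / (2 * n))"
proof -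
  show io: "integ opt_gap t" for t
  proof (induction t)
    case 0
    show ?case by (rule integ_start)
  next
    case (Suc t)
    then show ?case using opt_gap_next[OF Suc i] by (simp add: expect_le_def)
  qed
  show "E opt_gap T + \<alpha> / 2 * (\<Sum>t<T. E stationarity t) \<le> opt_gap start
      + \<alpha> * L\<^sup>2 / (2 * n) * (\<Sum>t<T. E consensus t) + T * (L * \<alpha>\<^sup>2 * s2 / (2 * n))"
  proof (induction T)
    case 0
    show ?case by (simp add: integ_start)
  next
    case (Suc T)
    have "E opt_gap (Suc T) \<le> E opt_gap T - \<alpha> / 2 * E stationarity T + \<alpha> * L\<^sup>2 / (2 * n) * E consensus T
        + L * \<alpha>\<^sup>2 * s2 / (2 * n)"
      using opt_gap_next[OF io i] by (simp add: expect_le_def)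
    moreover have "real (Suc T) * (L * \<alpha>\<^sup>2 * s2 / (2 * n)) = T * (L * \<alpha>\<^sup>2 * s2 / (2 * n)) + L * \<alpha>\<^sup>2 * s2 / (2 * n)"
      by (simp only: of_nat_Suc distrib_right mult_1)
    ultimately show ?case using Suc unfolding sum.lessThan_Suc distrib_left by linarith
  qed
qed

lemma stationarity_average:
  assumes i: "\<And>t. integ consensus t" and T: "1 \<le> T"
  shows "(\<Sum>t<T. E stationarity t) / T
    \<le> 2 * opt_gap start / (\<alpha> * T) + L\<^sup>2 / (n * T) * (\<Sum>t<T. E consensus t) + L * \<alpha> * s2 / n"
proof -
  let ?H = "\<Sum>t<T. E stationarity t" and ?S = "\<Sum>t<T. E consensus t"
  have "0 \<le> E opt_gap T" by (rule E_nonneg) (rule functionals_nonneg)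
  then have "\<alpha> / 2 * ?H \<le> opt_gap start + \<alpha> * L\<^sup>2 / (2 * n) * ?S + T * (L * \<alpha>\<^sup>2 * s2 / (2 * n))"
    using descent_sum(2)[OF i, of T] by linarith
  then have "2 / (\<alpha> * T) * (\<alpha> / 2 * ?H) \<le> 2 / (\<alpha> * T) * (opt_gap start + \<alpha> * L\<^sup>2 / (2 * n) * ?S + T * (L * \<alpha>\<^sup>2 * s2 / (2 * n)))"
    using step_pos by (intro mult_left_mono) auto
  also have "2 / (\<alpha> * T) * (\<alpha> / 2 * ?H) = ?H / T" using step_pos by simp
  also have "2 / (\<alpha> * T) * (opt_gap start + \<alpha> * L\<^sup>2 / (2 * n) * ?S + T * (L * \<alpha>\<^sup>2 * s2 / (2 * n)))
      = 2 / (\<alpha> * T) * opt_gap start + 2 / (\<alpha> * T) * (\<alpha> * L\<^sup>2 / (2 * n) * ?S) + 2 / (\<alpha> * T) * (T * (L * \<alpha>\<^sup>2 * s2 / (2 * n)))"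
    by (simp only: distrib_left)
  also have "2 / (\<alpha> * T) * (\<alpha> * L\<^sup>2 / (2 * n) * ?S) = L\<^sup>2 / (n * T) * ?S" using step_pos T n_pos by simp
  also have "2 / (\<alpha> * T) * (T * (L * \<alpha>\<^sup>2 * s2 / (2 * n))) = L * \<alpha> * s2 / n"
    using step_pos T n_pos by (simp add: power2_eq_square)
  finally show ?thesis by simp
qed

lemma integ_all:
  assumes small: weak_noise weak_gain
    and eta: "\<eta> \<le> \<theta>"
  shows "integ consensus t \<and> integ tracking t \<and> integ dual_err t \<and> integ opt_gap t"
proof (induction t)
  case 0
  show ?case by (simp add: integ_start)
next
  case (Suc t)
  then show ?case
    using consensus_next[OF small, of t] tracking_next[OF small(1), of t] dual_err_next[OF eta, of t] opt_gap_next[of t]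
    by (simp add: expect_le_def)
qed

definition "lyap_const = 15 / x + 48 / q"

text \<open>
  The weight \<open>4\<close> makes \<open>u + 4 e\<close> a Lyapunov function: it turns the gain \<open>x / 8\<close> of \<open>u\<close> in the recursion of
  \<open>e\<close> into \<open>x / 2\<close>, which leaves \<open>23/32 - 1/2 = 7/32 > 1/5\<close> of the contraction of \<open>u\<close>.  The forcing is
  summed as well: the slow variable costs \<open>dual_err start / \<epsilon>\<close> plus multiples of the other sums, and
  the gradients cost the optimality gap, which depends on the consensus sum again.  All these multiples
  of the consensus sum carry a factor \<open>\<alpha>\<^sup>2\<close>, and \<open>absorb\<close> says that half of the contraction pays for them.
\<close>

lemma consensus_sum_bound:
  assumes small: weak_noise weak_gain
    and eta: "\<eta> \<le> \<theta>"
    and B: "opt_gap start + T * (L * \<alpha>\<^sup>2 * s2 / (2 * n)) \<le> B"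
    and absorb: "\<alpha>\<^sup>2 * lyap_const * (3 * \<kappa>\<^sup>2 + 12 * \<alpha> * L^3 * T + 12 * L\<^sup>2) \<le> x / 10"
  shows "x / 10 * (\<Sum>t<T. E consensus t) \<le> consensus start + 4 * tracking start
    + \<alpha>\<^sup>2 * lyap_const * (dual_err start / \<epsilon> + 3 * (T * (2 * n * s2 + 8 * L * n * B)))"
proof -
  note i = integ_all[OF small eta]
  let ?S = "\<Sum>t<T. E consensus t" and ?Z = "\<Sum>t<T. E dual_err t" and ?G = "\<Sum>t<T. E grad_est t"
  have nn: "0 \<le> E consensus t" "0 \<le> E tracking t" "0 \<le> E dual_err t" "0 \<le> E stationarity t"
    "0 \<le> E opt_gap t" "0 \<le> E grad_est t" for t
    by (auto intro: E_nonneg functionals_nonneg)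
  have fe: "E forcing_est t = E dual_err t + \<kappa>\<^sup>2 * E consensus t + E grad_est t" for t
    using i[of t] unfolding forcing_est_def grad_est_def by simp
  have K0: "0 \<le> lyap_const" using param_pos by (simp add: lyap_const_def)
  have xle: "x \<le> \<beta> * \<rho>max" using rho_pos param_pos by (auto simp: x_def intro: mult_left_mono)
  have ly: "x / 5 * (\<Sum>t<T. E consensus t + 4 * E tracking t)
      \<le> (E consensus 0 + 4 * E tracking 0) + (\<Sum>t<T. \<alpha>\<^sup>2 * lyap_const * E forcing_est t)"
  proof (rule telescoped_contraction)
    fix t
    let ?c = "E consensus t" and ?e = "E tracking t"
    have "E consensus (Suc t) \<le> (1 - 23 / 32 * x) * ?c + 3 * (\<beta> * \<rho>max) * ?e + 15 / x * \<alpha>\<^sup>2 * E forcing_est t"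
      using consensus_next[OF small, of t] i[of t] by (simp add: expect_le_def)
    moreover have "E tracking (Suc t) \<le> (1 - q / 2) * ?e + x / 8 * (?c + ?e) + 12 / q * \<alpha>\<^sup>2 * E forcing_est t"
      using tracking_next[OF small(1), of t] i[of t] by (simp add: expect_le_def)
    ultimately have "E consensus (Suc t) + 4 * E tracking (Suc t)
        \<le> (1 - 7 / 32 * x) * ?c + (4 - 2 * q + x / 2 + 3 * (\<beta> * \<rho>max)) * ?e
          + (15 / x + 48 / q) * (\<alpha>\<^sup>2 * E forcing_est t)"
      by (simp add: algebra_simps)
    also have "\<dots> \<le> (1 - x / 5) * ?c + (1 - x / 5) * 4 * ?e + (15 / x + 48 / q) * (\<alpha>\<^sup>2 * E forcing_est t)"
      using nn param_pos small(2) xle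
      by (intro add_right_mono add_mono mult_right_mono) auto
    finally show "E consensus (Suc t) + 4 * E tracking (Suc t)
        \<le> (1 - x / 5) * (?c + 4 * ?e) + \<alpha>\<^sup>2 * lyap_const * E forcing_est t"
      by (simp add: lyap_const_def algebra_simps)
  qed (use nn in simp)
  have "\<epsilon> * ?Z \<le> E dual_err 0 + (\<Sum>t<T. \<epsilon> * (2 * \<kappa>\<^sup>2 * E consensus t + 2 * E grad_est t))"
    using dual_err_next[OF eta] i nn by (intro telescoped_contraction) (auto simp: expect_le_def)
  also have "\<dots> = dual_err start + \<epsilon> * (2 * \<kappa>\<^sup>2 * ?S + 2 * ?G)"
    by (simp only: integ_start sum.distrib sum_distrib_left distrib_left)
  finally have "?Z \<le> (dual_err start + \<epsilon> * (2 * \<kappa>\<^sup>2 * ?S + 2 * ?G)) / \<epsilon>"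
    using param_pos by (simp add: le_divide_eq mult.commute)
  also have "\<dots> = dual_err start / \<epsilon> + 2 * \<kappa>\<^sup>2 * ?S + 2 * ?G"
    using param_pos by (simp add: add_divide_distrib)
  finally have Z: "?Z \<le> dual_err start / \<epsilon> + 2 * \<kappa>\<^sup>2 * ?S + 2 * ?G" .
  have gap: "E opt_gap t \<le> B + \<alpha> * L\<^sup>2 / (2 * n) * ?S" if t: "t < T" for t
  proof -
    have c0: "0 \<le> L * \<alpha>\<^sup>2 * s2 / (2 * n)" using L_nonneg s2_pos by simp
    have "0 \<le> \<alpha> / 2 * (\<Sum>t<t. E stationarity t)" using step_pos nn by (simp add: sum_nonneg)
    then have "E opt_gap t \<le> opt_gap start + \<alpha> * L\<^sup>2 / (2 * n) * (\<Sum>t<t. E consensus t) + t * (L * \<alpha>\<^sup>2 * s2 / (2 * n))"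
      using descent_sum(2)[of t] i by (smt (verit))
    moreover have "(\<Sum>t<t. E consensus t) \<le> ?S" using t nn by (intro sum_mono2) auto
    then have "\<alpha> * L\<^sup>2 / (2 * n) * (\<Sum>t<t. E consensus t) \<le> \<alpha> * L\<^sup>2 / (2 * n) * ?S"
      using step_pos by (intro mult_left_mono) auto
    moreover have "t * (L * \<alpha>\<^sup>2 * s2 / (2 * n)) \<le> T * (L * \<alpha>\<^sup>2 * s2 / (2 * n))"
      using t c0 by (intro mult_right_mono) auto
    ultimately show ?thesis using B by linarith
  qed
  have "?G = (\<Sum>t<T. 2 * n * s2 + 8 * L * n * E opt_gap t + 4 * L\<^sup>2 * E consensus t)"
    using i by (intro sum.cong refl E_grad_est) auto
  also have "\<dots> \<le> (\<Sum>t<T. 2 * n * s2 + 8 * L * n * (B + \<alpha> * L\<^sup>2 / (2 * n) * ?S) + 4 * L\<^sup>2 * E consensus t)"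
    using gap L_nonneg by (intro sum_mono add_mono mult_left_mono order_refl) auto
  also have "\<dots> = T * (2 * n * s2 + 8 * L * n * (B + \<alpha> * L\<^sup>2 / (2 * n) * ?S)) + 4 * L\<^sup>2 * ?S"
    by (simp add: sum.distrib sum_distrib_left)
  also have "8 * L * n * (B + \<alpha> * L\<^sup>2 / (2 * n) * ?S) = 8 * L * n * B + 4 * \<alpha> * L^3 * ?S"
    using n_pos by (simp add: distrib_left power2_eq_square power3_eq_cube)
  finally have G: "?G \<le> T * (2 * n * s2 + 8 * L * n * B) + (4 * \<alpha> * L^3 * T + 4 * L\<^sup>2) * ?S"
    by (simp add: algebra_simps)
  have dist: "a + k * (b + c * d) = a + k * b + (k * c) * d" for a b c d k :: real
    by (simp add: algebra_simps)
  have "x / 5 * ?S \<le> x / 5 * (\<Sum>t<T. E consensus t + 4 * E tracking t)"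
    using nn param_pos by (intro mult_left_mono sum_mono) auto
  also have "\<dots> \<le> (consensus start + 4 * tracking start) + \<alpha>\<^sup>2 * lyap_const * (?Z + \<kappa>\<^sup>2 * ?S + ?G)"
    using ly by (simp add: integ_start fe sum.distrib sum_distrib_left[symmetric])
  also have "\<dots> \<le> (consensus start + 4 * tracking start) + \<alpha>\<^sup>2 * lyap_const *
      ((dual_err start / \<epsilon> + 3 * (T * (2 * n * s2 + 8 * L * n * B))) + (3 * \<kappa>\<^sup>2 + 12 * \<alpha> * L^3 * T + 12 * L\<^sup>2) * ?S)"
    using Z G K0 by (intro add_left_mono mult_left_mono) (auto simp: algebra_simps)
  also have "\<dots> = (consensus start + 4 * tracking start) + \<alpha>\<^sup>2 * lyap_const *
      (dual_err start / \<epsilon> + 3 * (T * (2 * n * s2 + 8 * L * n * B)))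
      + (\<alpha>\<^sup>2 * lyap_const * (3 * \<kappa>\<^sup>2 + 12 * \<alpha> * L^3 * T + 12 * L\<^sup>2)) * ?S"
    by (rule dist)
  also have "\<dots> \<le> (consensus start + 4 * tracking start) + \<alpha>\<^sup>2 * lyap_const *
      (dual_err start / \<epsilon> + 3 * (T * (2 * n * s2 + 8 * L * n * B))) + x / 10 * ?S"
    using absorb nn by (intro add_left_mono mult_right_mono sum_nonneg) auto
  finally have "x / 5 * ?S \<le> (consensus start + 4 * tracking start) + \<alpha>\<^sup>2 * lyap_const *
      (dual_err start / \<epsilon> + 3 * (T * (2 * n * s2 + 8 * L * n * B))) + x / 10 * ?S" .
  moreover have "x / 5 * ?S = x / 10 * ?S + x / 10 * ?S" by simp
  ultimately show ?thesis by linarith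
qed

text \<open>
  All step-size dependent quantities are replaced by bounds that do not change with \<open>T\<close>: \<open>b\<close> is a lower
  bound of \<open>\<beta>\<close>, and \<open>a2\<close> an upper bound of \<open>\<alpha>\<^sup>2 T\<close>.  The large factor \<open>1 / \<epsilon>\<close> of the initial dual error is
  harmless, because \<open>\<alpha>\<^sup>2 / \<epsilon> = \<alpha> \<beta> / \<eta>\<close>.
\<close>

lemma consensus_sum_const:
  assumes small: weak_noise weak_gain
    and eta: "\<eta> \<le> \<theta>"
    and b: "0 < b" "b \<le> \<beta>" and alpha: "\<alpha> \<le> 1" "\<alpha>\<^sup>2 * T \<le> a2"
    and start: "opt_gap start \<le> \<Delta>"
    and K: "K = 15 / (b * \<rho>min) + 48 / q"
    and absorb: "\<alpha> * (K * (3 * (\<eta> / b)\<^sup>2 + 12 * L^3 * a2 + 12 * L\<^sup>2)) \<le> b * \<rho>min / 10"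
  shows "(\<Sum>t<T. E consensus t) \<le> 10 / (b * \<rho>min) * (consensus start + 4 * tracking start
    + K * ((2 * sq_norm n (fst (snd start)) + 2 * (\<eta> / b)\<^sup>2 * consensus start) / (\<eta> * \<rho>max)
      + 3 * (a2 * (2 * n * s2 + 8 * L * n * (\<Delta> + L * a2 * s2 / (2 * n))))))"
proof -
  let ?x = "b * \<rho>min" and ?S = "\<Sum>t<T. E consensus t" and ?B = "\<Delta> + L * a2 * s2 / (2 * n)"
  have x: "0 < ?x" "?x \<le> x" using b rho_pos by (auto simp: x_def intro: mult_right_mono)
  have S: "0 \<le> ?S" by (intro sum_nonneg E_nonneg functionals_nonneg)
  have lc: "0 \<le> lyap_const" "lyap_const \<le> K" "0 \<le> K"
    using param_pos x by (auto simp: lyap_const_def K intro!: divide_left_mono)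
  have kap: "0 \<le> \<kappa>" "\<kappa> \<le> \<eta> / b" using param_pos b step_pos by (auto simp: \<kappa>_def intro!: divide_left_mono)
  then have kap2: "\<kappa>\<^sup>2 \<le> (\<eta> / b)\<^sup>2" by (intro power_mono)
  have a2: "\<alpha>\<^sup>2 \<le> \<alpha>" using alpha step_pos by (simp add: power2_eq_square)
  have a2_nonneg: "0 \<le> a2" using alpha(2) by (rule order_trans[rotated]) simp
  have D0: "0 \<le> opt_gap start" by (rule functionals_nonneg)
  have B: "opt_gap start + T * (L * \<alpha>\<^sup>2 * s2 / (2 * n)) \<le> ?B"
  proof -
    have "T * (L * \<alpha>\<^sup>2 * s2 / (2 * n)) = L * s2 / (2 * n) * (\<alpha>\<^sup>2 * T)" by simp
    also have "\<dots> \<le> L * s2 / (2 * n) * a2" using alpha L_nonneg s2_pos by (intro mult_left_mono) auto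
    finally show ?thesis using start by (simp add: mult.commute mult.left_commute)
  qed
  have B0: "0 \<le> ?B"
    by (rule order_trans[OF _ B]) (use D0 L_nonneg s2_pos in simp)
  have ab: "\<alpha>\<^sup>2 * lyap_const * (3 * \<kappa>\<^sup>2 + 12 * \<alpha> * L^3 * T + 12 * L\<^sup>2) \<le> x / 10"
  proof -
    have 1: "\<alpha>\<^sup>2 * (3 * \<kappa>\<^sup>2 + 12 * \<alpha> * L^3 * T + 12 * L\<^sup>2)
        \<le> \<alpha> * (3 * (\<eta> / b)\<^sup>2 + 12 * L^3 * a2 + 12 * L\<^sup>2)"
    proof -
      have "\<alpha>\<^sup>2 * (3 * \<kappa>\<^sup>2) \<le> \<alpha> * (3 * (\<eta> / b)\<^sup>2)" using a2 kap2 step_pos by (intro mult_mono) auto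
      moreover have "\<alpha>\<^sup>2 * (12 * L\<^sup>2) \<le> \<alpha> * (12 * L\<^sup>2)" using a2 by (intro mult_right_mono) auto
      moreover have "\<alpha>\<^sup>2 * (12 * \<alpha> * L^3 * T) \<le> \<alpha> * (12 * L^3 * a2)"
      proof -
        have "\<alpha>\<^sup>2 * (12 * \<alpha> * L^3 * T) = (\<alpha> * (12 * L^3)) * (\<alpha>\<^sup>2 * T)" by simp
        also have "\<dots> \<le> (\<alpha> * (12 * L^3)) * a2" using alpha L_nonneg step_pos by (intro mult_left_mono) auto
        finally show ?thesis by (simp add: mult.assoc)
      qed
      ultimately show ?thesis by (simp add: distrib_left)
    qed
    have "\<alpha>\<^sup>2 * lyap_const * (3 * \<kappa>\<^sup>2 + 12 * \<alpha> * L^3 * T + 12 * L\<^sup>2)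
        = lyap_const * (\<alpha>\<^sup>2 * (3 * \<kappa>\<^sup>2 + 12 * \<alpha> * L^3 * T + 12 * L\<^sup>2))" by (simp add: mult_ac)
    also have "\<dots> \<le> K * (\<alpha> * (3 * (\<eta> / b)\<^sup>2 + 12 * L^3 * a2 + 12 * L\<^sup>2))"
    proof (rule mult_mono[OF lc(2) 1 lc(3)])
      show "0 \<le> \<alpha>\<^sup>2 * (3 * \<kappa>\<^sup>2 + 12 * \<alpha> * L^3 * T + 12 * L\<^sup>2)"
        using step_pos L_nonneg by (intro mult_nonneg_nonneg add_nonneg_nonneg) auto
    qed
    also have "\<dots> \<le> ?x / 10" using absorb by (simp add: mult_ac)
    finally show ?thesis using x by simp
  qed
  have dual: "\<alpha>\<^sup>2 * (dual_err start / \<epsilon>)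
      \<le> (2 * sq_norm n (fst (snd start)) + 2 * (\<eta> / b)\<^sup>2 * consensus start) / (\<eta> * \<rho>max)"
  proof -
    have "dual_err start \<le> 2 * sq_norm n (fst (snd start)) + 2 * (\<kappa>\<^sup>2 * consensus start)"
      unfolding dual_err_def corrected_dual_def consensus_def
      using sq_norm_add2_le[of n "fst (snd start)" "\<lambda>i. \<kappa> *\<^sub>R deviation n (fst start) i"]
      by (simp add: sq_norm_scale)
    also have "\<dots> \<le> 2 * sq_norm n (fst (snd start)) + 2 * ((\<eta> / b)\<^sup>2 * consensus start)"
      using kap2 functionals_nonneg(1) by (intro add_left_mono mult_left_mono mult_right_mono) auto
    finally have d: "dual_err start \<le> 2 * sq_norm n (fst (snd start)) + 2 * (\<eta> / b)\<^sup>2 * consensus start"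
      by (simp add: mult.assoc)
    have "\<alpha>\<^sup>2 / \<epsilon> = \<alpha> * \<beta> / \<eta>" using step_pos by (simp add: \<epsilon>_def \<beta>_def power2_eq_square)
    also have "\<dots> \<le> 1 * \<beta> / \<eta>" using alpha param_pos step_pos by (intro divide_right_mono mult_right_mono) auto
    also have "\<dots> \<le> (1 / \<rho>max) / \<eta>"
    proof -
      have "q \<le> 1" by (rule param_pos)
      then have "\<beta> * \<rho>max \<le> 1" using small(2) by linarith
      then show ?thesis using rho_pos step_pos by (intro divide_right_mono) (auto simp: field_simps)
    qed
    finally have "\<alpha>\<^sup>2 / \<epsilon> \<le> 1 / (\<eta> * \<rho>max)" by (simp add: mult.commute)
    then have "\<alpha>\<^sup>2 / \<epsilon> * dual_err start \<le> 1 / (\<eta> * \<rho>max) * (2 * sq_norm n (fst (snd start)) + 2 * (\<eta> / b)\<^sup>2 * consensus start)"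
      using d functionals_nonneg(3)[of start] step_pos rho_pos by (intro mult_mono) auto
    then show ?thesis by simp
  qed
  have noise: "\<alpha>\<^sup>2 * (3 * (T * (2 * n * s2 + 8 * L * n * ?B))) \<le> 3 * (a2 * (2 * n * s2 + 8 * L * n * ?B))"
  proof -
    have "0 \<le> 2 * n * s2 + 8 * L * n * ?B" using L_nonneg s2_pos B0 by simp
    then have "(\<alpha>\<^sup>2 * T) * (2 * n * s2 + 8 * L * n * ?B) \<le> a2 * (2 * n * s2 + 8 * L * n * ?B)"
      using alpha by (intro mult_right_mono) auto
    moreover have "\<alpha>\<^sup>2 * (3 * (T * N)) = 3 * ((\<alpha>\<^sup>2 * T) * N)" for N :: real by simp
    ultimately show ?thesis by (simp only: mult_le_cancel_left_pos[of 3] zero_less_numeral)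
  qed
  have "?x / 10 * ?S \<le> x / 10 * ?S" using x S by (intro mult_right_mono) auto
  also have "\<dots> \<le> consensus start + 4 * tracking start
      + \<alpha>\<^sup>2 * lyap_const * (dual_err start / \<epsilon> + 3 * (T * (2 * n * s2 + 8 * L * n * ?B)))"
    by (rule consensus_sum_bound[OF small eta B ab])
  also have "\<dots> = consensus start + 4 * tracking start
      + lyap_const * (\<alpha>\<^sup>2 * (dual_err start / \<epsilon>) + \<alpha>\<^sup>2 * (3 * (T * (2 * n * s2 + 8 * L * n * ?B))))"
    by (simp add: algebra_simps)
  also have "\<dots> \<le> consensus start + 4 * tracking start
      + K * ((2 * sq_norm n (fst (snd start)) + 2 * (\<eta> / b)\<^sup>2 * consensus start) / (\<eta> * \<rho>max)
        + 3 * (a2 * (2 * n * s2 + 8 * L * n * ?B)))"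
  proof (rule add_left_mono, rule mult_mono[OF lc(2) add_mono[OF dual noise] lc(3)])
    have "0 \<le> dual_err start / \<epsilon>" using functionals_nonneg(3)[of start] param_pos by simp
    then have 1: "0 \<le> \<alpha>\<^sup>2 * (dual_err start / \<epsilon>)" by (intro mult_nonneg_nonneg) auto
    have "0 \<le> 2 * n * s2 + 8 * L * n * ?B" using L_nonneg s2_pos B0 by simp
    then have "0 \<le> \<alpha>\<^sup>2 * (3 * (T * (2 * n * s2 + 8 * L * n * ?B)))"
      by (intro mult_nonneg_nonneg zero_le_power2) simp_all
    with 1 show "0 \<le> \<alpha>\<^sup>2 * (dual_err start / \<epsilon>) + \<alpha>\<^sup>2 * (3 * (T * (2 * n * s2 + 8 * L * n * ?B)))"
      by (rule add_nonneg_nonneg)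
  qed
  finally have "10 / ?x * (?x / 10 * ?S) \<le> 10 / ?x * (consensus start + 4 * tracking start
      + K * ((2 * sq_norm n (fst (snd start)) + 2 * (\<eta> / b)\<^sup>2 * consensus start) / (\<eta> * \<rho>max)
        + 3 * (a2 * (2 * n * s2 + 8 * L * n * ?B))))"
    using x by (intro mult_left_mono) auto
  then show ?thesis using b rho_pos by simp
qed

lemma primal_eq: "primal p \<alpha> \<theta> \<eta> 1 w t = fst (state t w)"
  by (simp add: primal_def ticopd_eq_state)

lemma E_consensus_eq: "E consensus t = (LINT w|M. disagreement (primal p \<alpha> \<theta> \<eta> 1 w t))"
  by (simp add: primal_eq consensus_def)

lemma output_stationarity:
  assumes i: "\<And>t. integ consensus t" and T: "1 \<le> T"
  shows "expect_le M (\<lambda>w. (norm (gradient (objective p) (agent_mean n (primal p \<alpha> \<theta> \<eta> 1 w (index_rv p T w)))))\<^sup>2)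
    (2 * opt_gap start / (\<alpha> * T) + L\<^sup>2 / (n * T) * (\<Sum>t<T. E consensus t) + L * \<alpha> * s2 / n)"
proof (rule expect_le_weaken[OF _ stationarity_average[OF i T]])
  show "expect_le M (\<lambda>w. (norm (gradient (objective p) (agent_mean n (primal p \<alpha> \<theta> \<eta> 1 w (index_rv p T w)))))\<^sup>2)
      ((\<Sum>t<T. E stationarity t) / T)"
    unfolding primal_eq stationarity_def[symmetric]
    by (rule expect_random_index[OF functionals_measurable(5) functionals_nonneg(5)
          int_stationarity[OF descent_sum(1)[OF i]] T])
qed

lemma output_consensus:
  assumes i: "\<And>t. integ consensus t" and T: "1 \<le> T"
  shows "expect_le M (\<lambda>w. qform n (centering n) (primal p \<alpha> \<theta> \<eta> 1 w (index_rv p T w)))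
    ((\<Sum>t<T. E consensus t) / T)"
  unfolding primal_eq qform_centering consensus_def[symmetric]
  by (rule expect_random_index[OF functionals_measurable(1) functionals_nonneg(1) i T])

end

section \<open>Step sizes\<close>

text \<open>The bounds on the product \<open>\<alpha> \<theta>\<close> are the smallness conditions of the one-step estimates.  They use
  \<open>\<rho>min \<le> \<rho>tmax\<close> to trade one factor \<open>\<rho>min / \<rho>tmax\<close>.\<close>

lemma step_size_consequences:
  assumes st: "step_size_conditions n L \<delta> r \<rho>min \<rho>max \<rho>tmax \<sigma>A a \<alpha> \<theta> \<eta> 1"
    and \<delta>: "0 < \<delta>" "\<delta> \<le> 1" "0 < r" and \<rho>: "0 < \<rho>min" "\<rho>min \<le> \<rho>max" "0 < \<rho>tmax"
  shows "0 < a" "0 < \<alpha>" "0 < \<theta>" "0 < \<eta>" "r \<le> 1" "\<eta> = r * \<delta> / (8 * \<rho>tmax)"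
    and "8 * L\<^sup>2 / (real n * a * \<rho>min) \<le> \<theta>"
    and "\<rho>min \<le> \<rho>tmax \<Longrightarrow> \<eta> \<le> \<theta>"
    and "\<rho>min \<le> \<rho>tmax \<Longrightarrow> 128 * (\<alpha> * \<theta>) * (\<rho>max\<^sup>2 + \<sigma>A\<^sup>2 * \<rho>max) \<le> r * \<delta> * \<rho>min"
    and "\<rho>min \<le> \<rho>tmax \<Longrightarrow> 256 * ((\<alpha> * \<theta>) * \<rho>max) \<le> r * \<delta>"
proof -
  show pos: "0 < a" "0 < \<alpha>" "0 < \<theta>" "0 < \<eta>" and eta: "\<eta> = r * \<delta> / (8 * \<rho>tmax)"
    using st by (auto simp: step_size_conditions_def)
  have "1 \<le> 1 / r" using st by (simp add: step_size_conditions_def)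
  then show r: "r \<le> 1" using \<delta> by (simp add: field_simps)
  have th: "4 / \<rho>min * Max {2 * L\<^sup>2 / (real n * a), 2048 * \<rho>tmax / (r * \<delta> * \<rho>min), L\<^sup>2} \<le> \<theta>"
    using st by (simp add: step_size_conditions_def)
  have thM: "4 / \<rho>min * m \<le> \<theta>" if "m \<in> {2 * L\<^sup>2 / (real n * a), 2048 * \<rho>tmax / (r * \<delta> * \<rho>min), L\<^sup>2}" for m
    using \<rho> that by (intro order_trans[OF mult_left_mono th] Max_ge) auto
  show "8 * L\<^sup>2 / (real n * a * \<rho>min) \<le> \<theta>"
    using thM[of "2 * L\<^sup>2 / (real n * a)"] by (simp add: mult.commute)
  define F where "F = {\<rho>min\<^sup>2 / (\<rho>max\<^sup>2 * \<rho>tmax), 1 / (72 * real n * a * \<rho>tmax), \<rho>min / (2 * \<rho>tmax * a)}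
            \<union> (if \<sigma>A = 0 then {} else {\<rho>min\<^sup>2 / (\<sigma>A\<^sup>2 * \<rho>max * \<rho>tmax)})"
  have al: "\<alpha> \<le> r * \<delta> / (256 * \<theta>) * Min F"
    using st by (simp add: step_size_conditions_def F_def)
  have alM: "256 * (\<alpha> * \<theta>) \<le> r * \<delta> * m" if "m \<in> F" for m
  proof -
    have "finite F" by (simp add: F_def)
    then have "\<alpha> \<le> r * \<delta> / (256 * \<theta>) * m"
      using \<delta> pos that by (intro order_trans[OF al] mult_left_mono Min_le) auto
    then show ?thesis using pos by (simp add: field_simps)
  qed
  assume le: "\<rho>min \<le> \<rho>tmax"
  have rd: "r * \<delta> \<le> 1" using \<delta> r by (simp add: mult_le_one)
  have sq: "\<rho>min\<^sup>2 / \<rho>tmax \<le> \<rho>min"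
    using le \<rho> by (simp add: power2_eq_square field_simps)
  have "256 * (\<alpha> * \<theta>) \<le> r * \<delta> * (\<rho>min\<^sup>2 / (\<rho>max\<^sup>2 * \<rho>tmax))" by (rule alM) (simp add: F_def)
  then have "256 * (\<alpha> * \<theta>) * \<rho>max\<^sup>2 \<le> r * \<delta> * (\<rho>min\<^sup>2 / (\<rho>max\<^sup>2 * \<rho>tmax)) * \<rho>max\<^sup>2"
    by (rule mult_right_mono) simp
  also have "\<dots> = r * \<delta> * (\<rho>min\<^sup>2 / \<rho>tmax)" using \<rho> by simp
  also have "\<dots> \<le> r * \<delta> * \<rho>min" using sq \<delta> by (intro mult_left_mono) auto
  finally have b1: "256 * (\<alpha> * \<theta>) * \<rho>max\<^sup>2 \<le> r * \<delta> * \<rho>min" .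
  have b2: "256 * (\<alpha> * \<theta>) * (\<sigma>A\<^sup>2 * \<rho>max) \<le> r * \<delta> * \<rho>min"
  proof (cases "\<sigma>A = 0")
    case False
    then have "256 * (\<alpha> * \<theta>) \<le> r * \<delta> * (\<rho>min\<^sup>2 / (\<sigma>A\<^sup>2 * \<rho>max * \<rho>tmax))" by (intro alM) (simp add: F_def)
    then have "256 * (\<alpha> * \<theta>) * (\<sigma>A\<^sup>2 * \<rho>max) \<le> r * \<delta> * (\<rho>min\<^sup>2 / (\<sigma>A\<^sup>2 * \<rho>max * \<rho>tmax)) * (\<sigma>A\<^sup>2 * \<rho>max)"
      using \<rho> by (intro mult_right_mono) auto
    also have "\<dots> = r * \<delta> * (\<rho>min\<^sup>2 / \<rho>tmax)" using \<rho> False by simp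
    also have "\<dots> \<le> r * \<delta> * \<rho>min" using sq \<delta> by (intro mult_left_mono) auto
    finally show ?thesis .
  qed (use \<delta> \<rho> in simp)
  show "128 * (\<alpha> * \<theta>) * (\<rho>max\<^sup>2 + \<sigma>A\<^sup>2 * \<rho>max) \<le> r * \<delta> * \<rho>min"
    using b1 b2 by (simp add: distrib_left)
  have "(256 * (\<alpha> * \<theta>) * \<rho>max) * \<rho>max \<le> (r * \<delta>) * \<rho>min" using b1 by (simp add: power2_eq_square mult.assoc)
  also have "\<dots> \<le> (r * \<delta>) * \<rho>max" using \<rho> \<delta> by (intro mult_left_mono) auto
  finally show "256 * ((\<alpha> * \<theta>) * \<rho>max) \<le> r * \<delta>"
    using \<rho> by (simp add: mult.assoc)
  have "\<eta> \<le> 1 / (8 * \<rho>tmax)" using eta rd \<rho> by (simp add: divide_right_mono)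
  also have "\<dots> \<le> 4 / \<rho>min * (2048 * \<rho>tmax / (r * \<delta> * \<rho>min))"
  proof -
    have "\<rho>min * (r * \<delta> * \<rho>min) \<le> \<rho>tmax * (1 * \<rho>tmax)"
      using le \<rho> rd \<delta> by (intro mult_mono) auto
    also have "\<dots> \<le> 65536 * (\<rho>tmax * \<rho>tmax)" using \<rho> by simp
    finally show ?thesis using \<rho> \<delta> by (simp add: field_simps)
  qed
  also have "\<dots> \<le> \<theta>" by (rule thM) simp
  finally show "\<eta> \<le> \<theta>" .
qed

text \<open>The minimum in the condition on \<open>\<alpha>\<close> for \<open>a = 1\<close>.  It is a lower bound of that minimum for every
  \<open>a \<le> 1\<close>, so the same choice of \<open>\<alpha>\<close> and \<open>\<theta>\<close> serves both regimes of \<open>a\<close>.\<close>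

definition alpha_cap :: "nat \<Rightarrow> real \<Rightarrow> real \<Rightarrow> real \<Rightarrow> real \<Rightarrow> real" where
  "alpha_cap n \<rho>min \<rho>max \<rho>tmax \<sigma>A =
    Min ({\<rho>min\<^sup>2 / (\<rho>max\<^sup>2 * \<rho>tmax), 1 / (72 * real n * \<rho>tmax), \<rho>min / (2 * \<rho>tmax)}
      \<union> (if \<sigma>A = 0 then {} else {\<rho>min\<^sup>2 / (\<sigma>A\<^sup>2 * \<rho>max * \<rho>tmax)}))"

lemma alpha_cap_pos:
  assumes "1 \<le> n" "0 < \<rho>min" "\<rho>min \<le> \<rho>max" "0 < \<rho>tmax"
  shows "0 < alpha_cap n \<rho>min \<rho>max \<rho>tmax \<sigma>A"
  using assms unfolding alpha_cap_def by (subst Min_gr_iff) auto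

lemma step_size_conditionsI:
  assumes n: "1 \<le> n" and \<delta>: "0 < \<delta>" "0 < r" "r \<le> 1" and \<rho>: "0 < \<rho>min" "\<rho>min \<le> \<rho>max" "0 < \<rho>tmax"
    and a: "0 < a" "a \<le> 1" and pos: "0 < \<alpha>" "0 < \<theta>"
    and prod: "\<alpha> * \<theta> \<le> r * \<delta> * alpha_cap n \<rho>min \<rho>max \<rho>tmax \<sigma>A / 256"
    and th: "4 / \<rho>min * (2 * L\<^sup>2 / (real n * a)) \<le> \<theta>"
      "4 / \<rho>min * (2048 * \<rho>tmax / (r * \<delta> * \<rho>min)) \<le> \<theta>" "4 / \<rho>min * L\<^sup>2 \<le> \<theta>"
  shows "step_size_conditions n L \<delta> r \<rho>min \<rho>max \<rho>tmax \<sigma>A a \<alpha> \<theta> (r * \<delta> / (8 * \<rho>tmax)) 1"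
proof -
  let ?N = "if \<sigma>A = 0 then {} else {\<rho>min\<^sup>2 / (\<sigma>A\<^sup>2 * \<rho>max * \<rho>tmax)}"
  let ?F = "{\<rho>min\<^sup>2 / (\<rho>max\<^sup>2 * \<rho>tmax), 1 / (72 * real n * a * \<rho>tmax), \<rho>min / (2 * \<rho>tmax * a)} \<union> ?N"
  let ?G = "{\<rho>min\<^sup>2 / (\<rho>max\<^sup>2 * \<rho>tmax), 1 / (72 * real n * \<rho>tmax), \<rho>min / (2 * \<rho>tmax)} \<union> ?N"
  let ?M = "{2 * L\<^sup>2 / (real n * a), 2048 * \<rho>tmax / (r * \<delta> * \<rho>min), L\<^sup>2}"
  have G: "alpha_cap n \<rho>min \<rho>max \<rho>tmax \<sigma>A \<le> g" if "g \<in> ?G" for g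
    unfolding alpha_cap_def using that by (intro Min_le) auto
  have "1 / (72 * real n * \<rho>tmax) \<le> 1 / (72 * real n * a * \<rho>tmax)"
    using a n \<rho> by (intro divide_left_mono mult_right_mono) (auto simp: mult_le_cancel_left1)
  moreover have "\<rho>min / (2 * \<rho>tmax) \<le> \<rho>min / (2 * \<rho>tmax * a)"
    using a \<rho> by (intro divide_left_mono) (auto simp: mult_le_cancel_left1)
  ultimately have F: "alpha_cap n \<rho>min \<rho>max \<rho>tmax \<sigma>A \<le> Min ?F"
    using G by (subst Min_ge_iff) (auto intro: order_trans)
  have "\<alpha> = \<alpha> * \<theta> / \<theta>" using pos by simp
  also have "\<dots> \<le> r * \<delta> * alpha_cap n \<rho>min \<rho>max \<rho>tmax \<sigma>A / 256 / \<theta>"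
    using prod pos by (intro divide_right_mono) auto
  also have "\<dots> = r * \<delta> / (256 * \<theta>) * alpha_cap n \<rho>min \<rho>max \<rho>tmax \<sigma>A" by simp
  also have "\<dots> \<le> r * \<delta> / (256 * \<theta>) * Min ?F" using F \<delta> pos by (intro mult_left_mono) auto
  finally have al: "\<alpha> \<le> r * \<delta> / (256 * \<theta>) * Min ?F" .
  have "Max ?M \<in> ?M" by (rule Max_in) auto
  moreover have "\<forall>m\<in>?M. 4 / \<rho>min * m \<le> \<theta>" using th by blast
  ultimately have "4 / \<rho>min * Max ?M \<le> \<theta>" by blast
  then show ?thesis
    using a pos \<delta> \<rho> al by (simp add: step_size_conditions_def)
qed

lemma inverse_sqrt_tendsto: "(\<lambda>T. c / sqrt (real T)) \<longlonglongrightarrow> 0"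
  by (intro tendsto_divide_0[OF tendsto_const] filterlim_at_top_imp_at_infinity
      filterlim_compose[OF sqrt_at_top filterlim_real_sequentially])

lemma sqrt_eventually_ge: "0 < \<tau> \<Longrightarrow> \<forall>\<^sub>F T in sequentially. c \<le> \<tau> * sqrt (real T)"
proof -
  assume "0 < \<tau>"
  have "\<forall>\<^sub>F T in sequentially. c / \<tau> \<le> sqrt (real T)"
    using filterlim_compose[OF sqrt_at_top filterlim_real_sequentially] by (simp add: filterlim_at_top)
  then show ?thesis by eventually_elim (use \<open>0 < \<tau>\<close> in \<open>simp add: field_simps\<close>)
qed

text \<open>
  With \<open>\<alpha> = k / sqrt T\<close> and \<open>\<theta> = \<tau> sqrt T\<close> the product \<open>\<alpha> \<theta> = k \<tau>\<close> is constant, and a small \<open>\<tau>\<close> meets its upper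
  bound.  All lower bounds on \<open>\<theta>\<close> but one are constants.  The exception \<open>8 L\<^sup>2 / (n a \<rho>min)\<close> grows like
  \<open>sqrt T\<close> when \<open>a = A / sqrt T\<close>, and is met by a large \<open>A\<close>.
\<close>

lemma step_sizes_exist:
  fixes c1 c2 :: real and n :: nat
  assumes c: "0 < c1" "c1 \<le> c2" and n: "1 \<le> n" and s2: "0 < s2" and \<delta>: "0 < \<delta>" "0 < r" "r \<le> 1"
    and \<rho>: "0 < \<rho>min" "\<rho>min \<le> \<rho>max" "0 < \<rho>tmax"
  shows "\<exists>\<alpha> \<theta> \<eta> a. alpha_order c1 c2 n s2 \<alpha> \<and> \<theta> \<in> \<Theta>(\<lambda>T. sqrt (real T)) \<and>
      a \<in> \<Theta>(\<lambda>T. 1 / sqrt (real T)) \<and>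
      (\<forall>\<^sub>F T in sequentially. step_size_conditions n L \<delta> r \<rho>min \<rho>max \<rho>tmax \<sigma>A (a T) (\<alpha> T) (\<theta> T) (\<eta> T) 1)"
    and "\<exists>\<alpha> \<theta> \<eta>. alpha_order c1 c2 n s2 \<alpha> \<and> \<theta> \<in> \<Theta>(\<lambda>T. sqrt (real T)) \<and>
      (\<forall>\<^sub>F T in sequentially. step_size_conditions n L \<delta> r \<rho>min \<rho>max \<rho>tmax \<sigma>A 1 (\<alpha> T) (\<theta> T) (\<eta> T) 1)"
proof -
  define cap where "cap = alpha_cap n \<rho>min \<rho>max \<rho>tmax \<sigma>A"
  define k where "k = c1 * sqrt (real n / s2)"
  define \<tau> where "\<tau> = r * \<delta> * cap / (256 * k)"
  define A where "A = 8 * L\<^sup>2 / (real n * \<rho>min * \<tau>) + 1"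
  define \<alpha> where "\<alpha> T = k / sqrt (real T)" for T :: nat
  define \<theta> where "\<theta> T = \<tau> * sqrt (real T)" for T :: nat
  define \<eta> where "\<eta> T = r * \<delta> / (8 * \<rho>tmax)" for T :: nat
  define a where "a T = A / sqrt (real T)" for T :: nat
  have cap: "0 < cap" unfolding cap_def by (rule alpha_cap_pos) fact+
  have k: "0 < k" using c n s2 by (simp add: k_def)
  have \<tau>: "0 < \<tau>" using k cap \<delta> by (simp add: \<tau>_def)
  have A: "1 \<le> A" "8 * L\<^sup>2 / (real n * \<rho>min * \<tau>) \<le> A" using n \<rho> \<tau> by (auto simp: A_def)
  have eq: "\<alpha> T = c1 * sqrt (real n / (s2 * real T))" for T
    by (simp add: \<alpha>_def k_def real_sqrt_divide real_sqrt_mult)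
  have order: "alpha_order c1 c2 n s2 \<alpha>"
    unfolding alpha_order_def eq using c s2 by (intro always_eventually allI conjI mult_right_mono) auto
  have th: "\<theta> \<in> \<Theta>(\<lambda>T. sqrt (real T))" using \<tau> unfolding \<theta>_def[abs_def] by simp
  have at: "a \<in> \<Theta>(\<lambda>T. 1 / sqrt (real T))"
  proof -
    have "a = (\<lambda>T. A * (1 / sqrt (real T)))" by (simp add: a_def fun_eq_iff)
    then show ?thesis using A by (simp only: landau_theta.cmult_in_iff) simp
  qed
  have ev: "\<forall>\<^sub>F T in sequentially. step_size_conditions n L \<delta> r \<rho>min \<rho>max \<rho>tmax \<sigma>A (b T) (\<alpha> T) (\<theta> T) (\<eta> T) 1"
    if b: "\<forall>\<^sub>F T in sequentially. 0 < b T \<and> b T \<le> 1 \<and> 4 / \<rho>min * (2 * L\<^sup>2 / (real n * b T)) \<le> \<theta> T" for b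
    using b eventually_gt_at_top[of 0]
      sqrt_eventually_ge[OF \<tau>, of "4 / \<rho>min * (2048 * \<rho>tmax / (r * \<delta> * \<rho>min))"]
      sqrt_eventually_ge[OF \<tau>, of "4 / \<rho>min * L\<^sup>2"]
  proof eventually_elim
    case (elim T)
    have "\<alpha> T * \<theta> T = k * \<tau>" using elim by (simp add: \<alpha>_def \<theta>_def)
    also have "\<dots> = r * \<delta> * cap / 256" using k by (simp add: \<tau>_def)
    finally have prod: "\<alpha> T * \<theta> T = r * \<delta> * cap / 256" .
    have pos: "0 < \<alpha> T" "0 < \<theta> T" using elim k \<tau> by (auto simp: \<alpha>_def \<theta>_def)
    show ?case unfolding \<eta>_def
      by (rule step_size_conditionsI) (use n \<delta> \<rho> pos elim prod in \<open>auto simp: cap_def \<theta>_def\<close>)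
  qed
  have "\<forall>\<^sub>F T in sequentially. 0 < a T \<and> a T \<le> 1 \<and> 4 / \<rho>min * (2 * L\<^sup>2 / (real n * a T)) \<le> \<theta> T"
    using eventually_gt_at_top[of 0] sqrt_eventually_ge[OF zero_less_one, of A]
  proof eventually_elim
    case (elim T)
    have "4 / \<rho>min * (2 * L\<^sup>2 / (real n * a T)) = (8 * L\<^sup>2 / (real n * \<rho>min * \<tau>)) / A * (\<tau> * sqrt (real T))"
      using A \<tau> by (simp add: a_def)
    also have "\<dots> \<le> A / A * (\<tau> * sqrt (real T))"
      using A \<tau> by (intro mult_right_mono divide_right_mono) auto
    also have "\<dots> = \<theta> T" using A by (simp add: \<theta>_def)
    finally show ?case using A elim by (simp add: a_def)
  qed
  from ev[OF this] order th at
  show "\<exists>\<alpha> \<theta> \<eta> a. alpha_order c1 c2 n s2 \<alpha> \<and> \<theta> \<in> \<Theta>(\<lambda>T. sqrt (real T)) \<and>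
      a \<in> \<Theta>(\<lambda>T. 1 / sqrt (real T)) \<and>
      (\<forall>\<^sub>F T in sequentially. step_size_conditions n L \<delta> r \<rho>min \<rho>max \<rho>tmax \<sigma>A (a T) (\<alpha> T) (\<theta> T) (\<eta> T) 1)"
    by blast
  have "\<forall>\<^sub>F T in sequentially. 0 < (1::real) \<and> (1::real) \<le> 1 \<and> 4 / \<rho>min * (2 * L\<^sup>2 / (real n * 1)) \<le> \<theta> T"
    using sqrt_eventually_ge[OF \<tau>, of "4 / \<rho>min * (2 * L\<^sup>2 / (real n * 1))"] by (simp add: \<theta>_def)
  from ev[OF this] order th
  show "\<exists>\<alpha> \<theta> \<eta>. alpha_order c1 c2 n s2 \<alpha> \<and> \<theta> \<in> \<Theta>(\<lambda>T. sqrt (real T)) \<and>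
      (\<forall>\<^sub>F T in sequentially. step_size_conditions n L \<delta> r \<rho>min \<rho>max \<rho>tmax \<sigma>A 1 (\<alpha> T) (\<theta> T) (\<eta> T) 1)"
    by blast
qed

lemma alpha_order_facts:
  fixes \<alpha> :: "nat \<Rightarrow> real"
  assumes al: "alpha_order c1 c2 n s2 \<alpha>" and c: "0 < c1" "c1 \<le> c2" and n: "1 \<le> n" and s2: "0 < s2"
  shows "\<alpha> \<longlonglongrightarrow> 0" and "\<forall>\<^sub>F T in sequentially. (\<alpha> T)\<^sup>2 * T \<le> c2\<^sup>2 * n / s2"
    and "\<forall>\<^sub>F T in sequentially. c1 * sqrt (n / s2) \<le> \<alpha> T * sqrt T"
proof -
  have eq: "sqrt (real n / (s2 * real T)) = sqrt (n / s2) / sqrt T" for T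
    by (simp add: real_sqrt_divide real_sqrt_mult)
  have ev: "\<forall>\<^sub>F T in sequentially. c1 * (sqrt (n / s2) / sqrt T) \<le> \<alpha> T \<and> \<alpha> T \<le> c2 * (sqrt (n / s2) / sqrt T)"
    using al unfolding alpha_order_def eq .
  have lim: "(\<lambda>T. c * (sqrt (n / s2) / sqrt (real T))) \<longlonglongrightarrow> 0" for c
    by (intro tendsto_mult_right_zero inverse_sqrt_tendsto)
  have "\<forall>\<^sub>F T in sequentially. c1 * (sqrt (n / s2) / sqrt T) \<le> \<alpha> T"
    "\<forall>\<^sub>F T in sequentially. \<alpha> T \<le> c2 * (sqrt (n / s2) / sqrt T)"
    using ev by (auto elim: eventually_mono)
  then show "\<alpha> \<longlonglongrightarrow> 0" by (rule tendsto_sandwich) (rule lim)+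
  show "\<forall>\<^sub>F T in sequentially. (\<alpha> T)\<^sup>2 * T \<le> c2\<^sup>2 * n / s2"
    using ev eventually_gt_at_top[of 0]
  proof eventually_elim
    case (elim T)
    have "0 \<le> c1 * (sqrt (n / s2) / sqrt T)" using c s2 by simp
    then have "0 \<le> \<alpha> T" using elim by linarith
    then have "(\<alpha> T)\<^sup>2 * T \<le> (c2 * (sqrt (n / s2) / sqrt T))\<^sup>2 * T"
      using elim by (intro mult_right_mono power_mono) auto
    also have "\<dots> = c2\<^sup>2 * n / s2"
      using elim s2 by (simp add: power_mult_distrib power_divide)
    finally show ?case .
  qed
  show "\<forall>\<^sub>F T in sequentially. c1 * sqrt (n / s2) \<le> \<alpha> T * sqrt T"
    using ev eventually_gt_at_top[of 0]
    by eventually_elim (simp add: pos_divide_le_eq)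
qed

section \<open>The rates\<close>

context ticopd_setting
begin

abbreviation "steps \<equiv> step_size_conditions n L \<delta> r \<rho>min \<rho>max \<rho>tmax \<sigma>A"

lemmas steps_facts = step_size_consequences[OF _ delta_r rho_pos(1,2,4)]

lemma runI:
  assumes st: "steps a \<alpha> \<theta> \<eta> 1" and al: "\<alpha> * L \<le> 1"
  shows "ticopd_run p L fstar \<delta> r \<sigma> \<rho>min \<rho>max \<rho>tmin \<rho>tmax \<sigma>A \<alpha> \<theta> \<eta>"
  using steps_facts(2-5)[OF st] al
  by (intro ticopd_run.intro ticopd_setting_axioms ticopd_run_axioms.intro) auto

definition avg_consensus :: "real \<Rightarrow> real \<Rightarrow> real \<Rightarrow> nat \<Rightarrow> real" where
  "avg_consensus \<alpha> \<theta> \<eta> t = (LINT w|M. disagreement (primal p \<alpha> \<theta> \<eta> 1 w t))"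

text \<open>The conditions under which \<open>consensus_sum_const\<close> applies hold for large \<open>T\<close>, since \<open>\<alpha>\<close> tends to zero;
  \<open>\<eta>\<close> does not depend on \<open>T\<close> because \<open>\<gamma> = 1\<close>.\<close>

lemma consensus_sum_eventually:
  fixes \<alpha> \<theta> \<eta> a :: "nat \<Rightarrow> real"
  assumes n2: "2 \<le> n" and gap: "objective p (agent_mean n (x_init p)) - fstar \<le> \<Delta>"
    and al0: "\<alpha> \<longlonglongrightarrow> 0" and al2: "\<forall>\<^sub>F T in sequentially. (\<alpha> T)\<^sup>2 * T \<le> a2"
    and b: "0 < b" "\<forall>\<^sub>F T in sequentially. b \<le> \<alpha> T * \<theta> T"
    and st: "\<forall>\<^sub>F T in sequentially. steps (a T) (\<alpha> T) (\<theta> T) (\<eta> T) 1"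
  shows "\<exists>C. \<forall>\<^sub>F T in sequentially. (\<Sum>t<T. avg_consensus (\<alpha> T) (\<theta> T) (\<eta> T) t) \<le> C"
proof -
  define \<eta>0 where "\<eta>0 = r * \<delta> / (8 * \<rho>tmax)"
  define K where "K = 15 / (b * \<rho>min) + 48 / (r * \<delta>)"
  define lam0 where "lam0 = kron_id V (edges p) (\<lambda>i e. incidence p e i) (dual_init p)"
  let ?C0 = "disagreement (x_init p)" and ?E0 = "sq_norm n (\<lambda>i. x_init p i - xhat_init p i)"
  define C where "C = 10 / (b * \<rho>min) * (?C0 + 4 * ?E0
    + K * ((2 * sq_norm n lam0 + 2 * (\<eta>0 / b)\<^sup>2 * ?C0) / (\<eta>0 * \<rho>max)
      + 3 * (a2 * (2 * n * s2 + 8 * L * n * (\<Delta> + L * a2 * s2 / (2 * n))))))"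
  have lim: "(\<lambda>T. \<alpha> T * c) \<longlonglongrightarrow> 0" for c
    using tendsto_mult_left_zero[OF al0, of c] by simp
  have 1: "\<forall>\<^sub>F T in sequentially. \<alpha> T * (K * (3 * (\<eta>0 / b)\<^sup>2 + 12 * L^3 * a2 + 12 * L\<^sup>2)) < b * \<rho>min / 10"
    by (rule order_tendstoD[OF lim]) (use b rho_pos in simp)
  have 2: "\<forall>\<^sub>F T in sequentially. \<alpha> T * L < 1" by (rule order_tendstoD[OF lim]) simp
  have 3: "\<forall>\<^sub>F T in sequentially. \<alpha> T < 1" by (rule order_tendstoD[OF al0]) simp
  have "\<forall>\<^sub>F T in sequentially. (\<Sum>t<T. avg_consensus (\<alpha> T) (\<theta> T) (\<eta> T) t) \<le> C"
    using st b(2) al2 1 2 3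
  proof eventually_elim
    case (elim T)
    interpret run: ticopd_run p L fstar \<delta> r \<sigma> \<rho>min \<rho>max \<rho>tmin \<rho>tmax \<sigma>A "\<alpha> T" "\<theta> T" "\<eta> T"
      by (rule runI[OF elim(1)]) (use elim in simp)
    note rt = rho_min_le_rho_tmax[OF n2]
    have eta: "\<eta> T = \<eta>0" using steps_facts(6)[OF elim(1)] by (simp add: \<eta>0_def)
    have small: run.weak_noise run.weak_gain
      using steps_facts(9,10)[OF elim(1)] rt unfolding run.\<beta>_def run.q_def by auto
    have "(\<Sum>t<T. avg_consensus (\<alpha> T) (\<theta> T) (\<eta> T) t) = (\<Sum>t<T. run.E run.consensus t)"
      by (simp add: avg_consensus_def run.E_consensus_eq)
    also have "\<dots> \<le> 10 / (b * \<rho>min) * (run.consensus run.start + 4 * run.tracking run.start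
      + K * ((2 * sq_norm n (fst (snd run.start)) + 2 * (\<eta> T / b)\<^sup>2 * run.consensus run.start) / (\<eta> T * \<rho>max)
        + 3 * (a2 * (2 * n * s2 + 8 * L * n * (\<Delta> + L * a2 * s2 / (2 * n))))))"
    proof (rule run.consensus_sum_const[OF small])
      show "\<eta> T \<le> \<theta> T" using steps_facts(8)[OF elim(1)] rt by simp
      show "0 < b" "b \<le> run.\<beta>" using b elim by (auto simp: run.\<beta>_def)
      show "\<alpha> T \<le> 1" "(\<alpha> T)\<^sup>2 * T \<le> a2" using elim by auto
      show "run.opt_gap run.start \<le> \<Delta>"
        using gap by (simp add: run.opt_gap_def run.start_def gap_def)
      show "K = 15 / (b * \<rho>min) + 48 / run.q" by (simp add: K_def run.q_def)
      show "\<alpha> T * (K * (3 * (\<eta> T / b)\<^sup>2 + 12 * L^3 * a2 + 12 * L\<^sup>2)) \<le> b * \<rho>min / 10"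
        using elim eta by simp
    qed
    also have "\<dots> = C"
      by (simp add: C_def eta run.consensus_def run.tracking_def run.start_def lam0_def)
    finally show ?case .
  qed
  then show ?thesis by blast
qed

lemma consensus_integrable:
  assumes st: "steps a \<alpha> \<theta> \<eta> 1" and al: "\<alpha> * L \<le> 1"
  shows "integrable M (\<lambda>w. disagreement (primal p \<alpha> \<theta> \<eta> 1 w t))"
proof (cases "2 \<le> n")
  case False
  then have "n \<le> 1" by simp
  then show ?thesis by (simp add: sq_norm_single_agent)
next
  case True
  interpret run: ticopd_run p L fstar \<delta> r \<sigma> \<rho>min \<rho>max \<rho>tmin \<rho>tmax \<sigma>A \<alpha> \<theta> \<eta>
    by (rule runI[OF st al])
  note rt = rho_min_le_rho_tmax[OF True]
  show ?thesis
    using run.integ_all[of t] steps_facts(8,9,10)[OF st] rt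
    by (simp add: run.primal_eq run.consensus_def run.\<beta>_def run.q_def)
qed

text \<open>
  The lower bound on \<open>\<alpha> \<theta>\<close> comes from \<open>\<theta> \<ge> 8 L\<^sup>2 / (n a \<rho>min)\<close> and the upper bound on \<open>a\<close>.  It is lost for
  \<open>L = 0\<close>, but then the consensus error does not enter the descent inequality, and for a single agent
  there is none.
\<close>

lemma stationarity_rate:
  fixes \<alpha> \<theta> \<eta> a :: "nat \<Rightarrow> real"
  assumes gap: "objective p (agent_mean n (x_init p)) - fstar \<le> \<Delta>" and c: "0 < c1" "c1 \<le> c2"
    and al: "alpha_order c1 c2 n s2 \<alpha>" and a: "a \<in> O(\<lambda>T. 1 / sqrt (real T))"
    and st: "\<forall>\<^sub>F T in sequentially. steps (a T) (\<alpha> T) (\<theta> T) (\<eta> T) 1"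
  shows "\<forall>\<^sub>F T in sequentially. expect_le M
    (\<lambda>w. (norm (gradient (objective p) (agent_mean n (primal p (\<alpha> T) (\<theta> T) (\<eta> T) 1 w (index_rv p T w)))))\<^sup>2)
    ((2 * \<Delta> / c1 + L * c2 + 1) * sqrt (s2 / (real n * real T)))"
proof -
  note alf = alpha_order_facts[OF al c n_pos s2_pos]
  obtain C where C: "\<forall>\<^sub>F T in sequentially. L\<^sup>2 * (\<Sum>t<T. avg_consensus (\<alpha> T) (\<theta> T) (\<eta> T) t) \<le> C"
  proof (cases "L = 0 \<or> n \<le> 1")
    case True
    have "L\<^sup>2 * (\<Sum>t<T. avg_consensus (\<alpha> T) (\<theta> T) (\<eta> T) t) \<le> 0" for T
      using True by (auto simp: avg_consensus_def sq_norm_single_agent)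
    then show thesis by (intro that[of 0] always_eventually allI)
  next
    case False
    then have L: "0 < L" and n2: "2 \<le> n" using L_nonneg by auto
    obtain ca where ca: "0 < ca" "\<forall>\<^sub>F T in sequentially. norm (a T) \<le> ca * norm (1 / sqrt (real T))"
      using a by (elim landau_o.bigE)
    define b where "b = c1 * sqrt (n / s2) * (8 * L\<^sup>2 / (n * ca * \<rho>min))"
    have b: "0 < b" using c n_pos s2_pos L ca rho_pos by (simp add: b_def)
    have "\<forall>\<^sub>F T in sequentially. b \<le> \<alpha> T * \<theta> T"
      using ca(2) st alf(3) eventually_gt_at_top[of 0]
    proof eventually_elim
      case (elim T)
      note sf = steps_facts[OF elim(2)]
      have T: "0 < sqrt T" using elim by simp
      have "a T \<le> ca / sqrt T" using elim(1) T by simp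
      then have "8 * L\<^sup>2 / (n * (ca / sqrt T) * \<rho>min) \<le> 8 * L\<^sup>2 / (n * a T * \<rho>min)"
        using sf(1) n_pos rho_pos ca T
        by (intro divide_left_mono mult_right_mono mult_left_mono mult_pos_pos) auto
      also have "\<dots> \<le> \<theta> T" by (rule sf(7))
      finally have th: "8 * L\<^sup>2 / (n * ca * \<rho>min) * sqrt T \<le> \<theta> T"
        using T by (simp add: field_simps)
      have "b = (c1 * sqrt (n / s2)) * (8 * L\<^sup>2 / (n * ca * \<rho>min))" by (simp add: b_def)
      also have "\<dots> \<le> (\<alpha> T * sqrt T) * (8 * L\<^sup>2 / (n * ca * \<rho>min))"
        using elim(3) rho_pos ca by (intro mult_right_mono) auto
      also have "\<dots> = \<alpha> T * (8 * L\<^sup>2 / (n * ca * \<rho>min) * sqrt T)" by simp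
      also have "\<dots> \<le> \<alpha> T * \<theta> T" using th sf(2) by (intro mult_left_mono) auto
      finally show ?case .
    qed
    then obtain C where "\<forall>\<^sub>F T in sequentially. (\<Sum>t<T. avg_consensus (\<alpha> T) (\<theta> T) (\<eta> T) t) \<le> C"
      using consensus_sum_eventually[OF n2 gap alf(1,2) b _ st] by blast
    then have "\<forall>\<^sub>F T in sequentially. L\<^sup>2 * (\<Sum>t<T. avg_consensus (\<alpha> T) (\<theta> T) (\<eta> T) t) \<le> L\<^sup>2 * C"
      by eventually_elim (intro mult_left_mono, auto)
    then show thesis by (rule that)
  qed
  have aL: "\<forall>\<^sub>F T in sequentially. \<alpha> T * L < 1"
    by (rule order_tendstoD[OF tendsto_mult_left_zero[OF alf(1)]]) simp
  have sq: "0 < sqrt (s2 / n)" using s2_pos n_pos by simp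
  show ?thesis
    using st C aL al[unfolded alpha_order_def] eventually_ge_at_top[of 1] sqrt_eventually_ge[OF sq, of "C / n"]
  proof eventually_elim
    case (elim T)
    interpret run: ticopd_run p L fstar \<delta> r \<sigma> \<rho>min \<rho>max \<rho>tmin \<rho>tmax \<sigma>A "\<alpha> T" "\<theta> T" "\<eta> T"
      by (rule runI[OF elim(1)]) (use elim in simp)
    let ?s = "sqrt (s2 / (real n * real T))" and ?S = "\<Sum>t<T. run.E run.consensus t"
    have T: "0 < real T" "0 < real n" using elim n_pos by auto
    have integ: "run.integ run.consensus t" for t
      using consensus_integrable[OF elim(1), of t] elim(3) by (simp add: run.primal_eq run.consensus_def)
    have al_pos: "0 < \<alpha> T" by (rule run.step_pos)
    have inv: "sqrt (n / (s2 * T)) * ?s = 1 / T"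
    proof -
      have "(n / (s2 * T)) * (s2 / (real n * real T)) = (1 / T)\<^sup>2"
        using T s2_pos by (simp add: power2_eq_square)
      then show ?thesis by (simp add: real_sqrt_mult[symmetric])
    qed
    have s: "0 < ?s" using T s2_pos by simp
    have "2 * run.opt_gap run.start / (\<alpha> T * T) \<le> 2 * \<Delta> / c1 * ?s"
    proof -
      have g: "run.opt_gap run.start \<le> \<Delta>" "0 \<le> run.opt_gap run.start"
        using gap run.functionals_nonneg(4) by (auto simp: run.opt_gap_def run.start_def gap_def)
      have "1 / T = sqrt (n / (s2 * T)) * ?s" by (rule inv[symmetric])
      also have "\<dots> \<le> (\<alpha> T / c1) * ?s"
        using elim(4) c s by (intro mult_right_mono) (auto simp: field_simps)
      finally have "1 / (\<alpha> T * T) \<le> ?s / c1"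
        using al_pos c T by (simp add: field_simps)
      then have "2 * run.opt_gap run.start * (1 / (\<alpha> T * T)) \<le> 2 * \<Delta> * (?s / c1)"
        using g s c al_pos T by (intro mult_mono) auto
      then show ?thesis by simp
    qed
    moreover have "L\<^sup>2 / (n * T) * ?S \<le> ?s"
    proof -
      have "L\<^sup>2 * ?S \<le> C" using elim(2) by (simp add: avg_consensus_def run.E_consensus_eq)
      then have "L\<^sup>2 / (n * T) * ?S \<le> C / n / T" using T by (simp add: field_simps)
      also have "\<dots> \<le> sqrt (s2 / n) * sqrt T / T" using elim(6) T by (intro divide_right_mono) auto
      also have "\<dots> = sqrt (s2 / n) * (sqrt T / T)" by simp
      also have "sqrt T / T = 1 / sqrt T" by (simp add: sqrt_divide_self_eq inverse_eq_divide)
      also have "sqrt (s2 / n) * (1 / sqrt T) = ?s" by (simp add: real_sqrt_divide real_sqrt_mult)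
      finally show ?thesis .
    qed
    moreover have "L * \<alpha> T * s2 / n \<le> L * c2 * ?s"
    proof -
      have "(s2 / n) * sqrt (n / (s2 * T)) = ?s"
      proof -
        have "s2 / n = sqrt (s2 / n) * sqrt (s2 / n)" using s2_pos T by simp
        moreover have "sqrt (s2 / n) * sqrt (n / (s2 * T)) = 1 / sqrt T"
        proof -
          have "(s2 / n) * (n / (s2 * T)) = 1 / T" using s2_pos T by simp
          then show ?thesis by (simp only: real_sqrt_mult[symmetric]) (simp add: real_sqrt_divide)
        qed
        moreover have "sqrt (s2 / n) * (1 / sqrt T) = ?s" by (simp add: real_sqrt_divide real_sqrt_mult)
        ultimately show ?thesis by (metis mult.assoc)
      qed
      then have e: "L * (s2 / n) * (c2 * sqrt (n / (s2 * T))) = L * c2 * ?s" by (simp only: mult.assoc mult.left_commute)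
      have "L * \<alpha> T * s2 / n = L * (s2 / n) * \<alpha> T" by simp
      also have "\<dots> \<le> L * (s2 / n) * (c2 * sqrt (n / (s2 * T)))"
        using elim(4) L_nonneg s2_pos by (intro mult_left_mono) auto
      finally show ?thesis unfolding e .
    qed
    ultimately have "2 * run.opt_gap run.start / (\<alpha> T * T) + L\<^sup>2 / (n * T) * ?S + L * \<alpha> T * s2 / n
        \<le> (2 * \<Delta> / c1 + L * c2 + 1) * ?s" by (simp only: distrib_right)
    then show ?case by (rule expect_le_weaken[OF run.output_stationarity[OF integ elim(5)]])
  qed
qed

text \<open>Here \<open>\<alpha> \<theta>\<close> is bounded below because both orders are two-sided.\<close>

lemma consensus_rate:
  fixes \<alpha> \<theta> \<eta> a :: "nat \<Rightarrow> real"
  assumes gap: "objective p (agent_mean n (x_init p)) - fstar \<le> \<Delta>" and c: "0 < c1" "c1 \<le> c2"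
    and al: "alpha_order c1 c2 n s2 \<alpha>" and th: "\<theta> \<in> \<Theta>(\<lambda>T. sqrt (real T))"
    and st: "\<forall>\<^sub>F T in sequentially. steps (a T) (\<alpha> T) (\<theta> T) (\<eta> T) 1"
  shows "\<exists>C. \<forall>\<^sub>F T in sequentially. expect_le M
    (\<lambda>w. qform n (centering n) (primal p (\<alpha> T) (\<theta> T) (\<eta> T) 1 w (index_rv p T w))) (C / T)"
proof (cases "2 \<le> n")
  case False
  then have "n \<le> 1" by simp
  then have "expect_le M (\<lambda>w. qform n (centering n) (primal p (\<alpha> T) (\<theta> T) (\<eta> T) 1 w (index_rv p T w))) (0 / T)" for T
    by (simp add: qform_centering sq_norm_single_agent expect_le_def)
  then show ?thesis by (intro exI[of _ 0] always_eventually allI)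
next
  case True
  note alf = alpha_order_facts[OF al c n_pos s2_pos]
  have "(\<lambda>T. sqrt (real T)) \<in> O(\<theta>)" using th by (simp add: bigtheta_def bigomega_iff_bigo)
  then obtain ct where ct: "0 < ct" "\<forall>\<^sub>F T in sequentially. norm (sqrt (real T)) \<le> ct * norm (\<theta> T)"
    by (elim landau_o.bigE)
  define b where "b = c1 * sqrt (n / s2) / ct"
  have b: "0 < b" using c n_pos s2_pos ct by (simp add: b_def)
  have "\<forall>\<^sub>F T in sequentially. b \<le> \<alpha> T * \<theta> T"
    using ct(2) st alf(3)
  proof eventually_elim
    case (elim T)
    note sf = steps_facts[OF elim(2)]
    have "c1 * sqrt (n / s2) \<le> \<alpha> T * sqrt T" by (rule elim(3))
    also have "\<dots> \<le> \<alpha> T * (ct * \<theta> T)" using elim(1) sf(2,3) by (intro mult_left_mono) auto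
    finally show ?case using ct by (simp add: b_def field_simps)
  qed
  then obtain C where C: "\<forall>\<^sub>F T in sequentially. (\<Sum>t<T. avg_consensus (\<alpha> T) (\<theta> T) (\<eta> T) t) \<le> C"
    using consensus_sum_eventually[OF True gap alf(1,2) b _ st] by blast
  have aL: "\<forall>\<^sub>F T in sequentially. \<alpha> T * L < 1"
    by (rule order_tendstoD[OF tendsto_mult_left_zero[OF alf(1)]]) simp
  have "\<forall>\<^sub>F T in sequentially. expect_le M
    (\<lambda>w. qform n (centering n) (primal p (\<alpha> T) (\<theta> T) (\<eta> T) 1 w (index_rv p T w))) (C / T)"
    using st C aL eventually_ge_at_top[of 1]
  proof eventually_elim
    case (elim T)
    interpret run: ticopd_run p L fstar \<delta> r \<sigma> \<rho>min \<rho>max \<rho>tmin \<rho>tmax \<sigma>A "\<alpha> T" "\<theta> T" "\<eta> T"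
      by (rule runI[OF elim(1)]) (use elim in simp)
    have integ: "run.integ run.consensus t" for t
      using consensus_integrable[OF elim(1), of t] elim(3) by (simp add: run.primal_eq run.consensus_def)
    have "(\<Sum>t<T. run.E run.consensus t) \<le> C"
      using elim(2) by (simp add: avg_consensus_def run.E_consensus_eq)
    then show ?case
      by (intro expect_le_weaken[OF run.output_consensus[OF integ elim(4)]] divide_right_mono) auto
  qed
  then show ?thesis by blast
qed

end

theorem mainTheorem2:
  fixes L \<Delta> c1 c2 :: real
  assumes c: "0 < c1" "c1 \<le> c2"
  shows "\<exists>C. \<forall>(p :: ('a::euclidean_space, 's, 'z, 'q, 'w) inst)
            \<delta> r \<sigma>\<xi> fstar \<sigma> \<rho>min \<rho>max \<rho>tmin \<rho>tmax \<sigma>A.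
     let n = num_agents p; s2 = mean_variance n \<sigma>;
         steps = step_size_conditions n L \<delta> r \<rho>min \<rho>max \<rho>tmax \<sigma>A in
     graph_setup p \<longrightarrow> objective_setup p \<longrightarrow> randomness_setup p \<longrightarrow> init_setup p \<longrightarrow>
     compressor_assm p \<delta> r \<sigma>\<xi> \<longrightarrow> \<sigma>\<xi> = 0 \<longrightarrow>
     smoothness_assm p L fstar \<longrightarrow>
     gradient_noise_assm p \<sigma> \<longrightarrow>
     spectral_assm p \<rho>min \<rho>max \<rho>tmin \<rho>tmax \<longrightarrow>
     graph_noise_assm p \<sigma>A \<longrightarrow>
     objective p (agent_mean n (x_init p)) - fstar \<le> \<Delta> \<longrightarrow>
     (\<forall>\<alpha> \<theta> \<eta> \<gamma> a.
        alpha_order c1 c2 n s2 \<alpha> \<longrightarrow> \<theta> \<in> O(\<lambda>T. sqrt (real T)) \<longrightarrow> \<gamma> = (\<lambda>T. 1) \<longrightarrow>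
        a \<in> O(\<lambda>T. 1 / sqrt (real T)) \<longrightarrow>
        (\<forall>\<^sub>F T in sequentially. steps (a T) (\<alpha> T) (\<theta> T) (\<eta> T) (\<gamma> T)) \<longrightarrow>
        (\<forall>\<^sub>F T in sequentially.
           expect_le (prob p)
             (\<lambda>w. (norm (gradient (objective p)
                (agent_mean n (primal p (\<alpha> T) (\<theta> T) (\<eta> T) (\<gamma> T) w (index_rv p T w)))))\<^sup>2)
             (C * sqrt (s2 / (real n * real T))))) \<and>
     (\<forall>\<alpha> \<theta> \<eta> \<gamma> a.
        alpha_order c1 c2 n s2 \<alpha> \<longrightarrow> \<theta> \<in> \<Theta>(\<lambda>T. sqrt (real T)) \<longrightarrow> \<gamma> = (\<lambda>T. 1) \<longrightarrow>
        a = (\<lambda>T. 1) \<longrightarrow>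
        (\<forall>\<^sub>F T in sequentially. steps (a T) (\<alpha> T) (\<theta> T) (\<eta> T) (\<gamma> T)) \<longrightarrow>
        (\<exists>C'. \<forall>\<^sub>F T in sequentially.
           expect_le (prob p)
             (\<lambda>w. qform n (centering n)
                (primal p (\<alpha> T) (\<theta> T) (\<eta> T) (\<gamma> T) w (index_rv p T w)))
             (C' / real T))) \<and>
     (r \<le> 1 \<longrightarrow>
        (\<exists>\<alpha> \<theta> \<eta> a.
           alpha_order c1 c2 n s2 \<alpha> \<and> \<theta> \<in> \<Theta>(\<lambda>T. sqrt (real T)) \<and>
           a \<in> \<Theta>(\<lambda>T. 1 / sqrt (real T)) \<and>
           (\<forall>\<^sub>F T in sequentially. steps (a T) (\<alpha> T) (\<theta> T) (\<eta> T) 1)) \<and>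
        (\<exists>\<alpha> \<theta> \<eta>.
           alpha_order c1 c2 n s2 \<alpha> \<and> \<theta> \<in> \<Theta>(\<lambda>T. sqrt (real T)) \<and>
           (\<forall>\<^sub>F T in sequentially. steps 1 (\<alpha> T) (\<theta> T) (\<eta> T) 1)))"
proof (intro exI[of _ "2 * \<Delta> / c1 + L * c2 + 1"] allI, unfold Let_def, intro impI, goal_cases)
  case (1 p \<delta> r \<sigma>\<xi> fstar \<sigma> \<rho>min \<rho>max \<rho>tmin \<rho>tmax \<sigma>A)
  then interpret ticopd_setting p L fstar \<delta> r \<sigma> \<rho>min \<rho>max \<rho>tmin \<rho>tmax \<sigma>A
    by (intro ticopd_setting.intro) auto
  note gap = 1(11)
  show ?case
  proof (intro conjI allI impI, goal_cases)
    case (1 \<alpha> \<theta> \<eta> \<gamma> a)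
    then show ?case using stationarity_rate[OF gap c, of \<alpha> a \<theta> \<eta>] by simp
  next
    case (2 \<alpha> \<theta> \<eta> \<gamma> a)
    then show ?case using consensus_rate[OF gap c, of \<alpha> \<theta> a \<eta>] by simp
  next
    case 3
    then show ?case by (rule step_sizes_exist(1)[OF c n_pos s2_pos delta_r(1,3) _ rho_pos(1,2,4)])
  next
    case 4
    then show ?case by (rule step_sizes_exist(2)[OF c n_pos s2_pos delta_r(1,3) _ rho_pos(1,2,4)])
  qed
qed

end
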